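(* Consider the dual Koopman system on $\mathbb H^2(\mathbb D^n)$ $$\dot f(t)=A_F^*f(t),\quad f(0)=k_{\mathbf x_0},\qquad \mathbf y(t)=C_hf(t),$$ associated with $\dot{\mathbf x}=F(\mathbf x)$, $\mathbf x(0)=\mathbf x_0$, $\mathbf y=h(\mathbf x)$, where Assumptions 1–5 (listed in the context) hold, and let $\beta<0$. If, for all $\beta$-unstable principal eigenfunctions $\psi_j$ of $A_F^*$ (i.e. for all $j\in\{1,\dots,n\}$ such that $\psi_j\in H_\beta^+$), there exists $i\in\{1,\dots,m\}$ satisfying $$\langle h_i,\psi_j\rangle\neq0,$$ then the dual Koopman system is pointwise $\beta$-detectable.
   Context: $\mathbb D^n$ is the open unit polydisc in $\mathbb C^n$, $\mathbb T^n=\{\mathbf z:|z_k|=1\ \forall k\}$, $D(\mathbf 0,R)^n=\{\mathbf z:|z_k|<R\ \forall k\}$. The Hardy space $\mathbb H^2(\mathbb D^n)$ is the Hilbert space of holomorphic $f:\mathbb D^n\to\mathbb C$ with $\|f\|^2=\lim_{r\to1^-}\int_{\mathbb T^n}|f(r\mathbf w)|^2dm_n(\mathbf w)<\infty$ ($m_n$ normalized Lebesgue measure) and inner product $\langle f,g\rangle=\sum_{\alpha\in\mathbb N^n}f_\alpha\overline{g_\alpha}$, where $f_\alpha,g_\alpha$ are Taylor coefficients at $\mathbf 0$; it is a reproducing kernel Hilbert space with reproducing functions $k_{\mathbf z_0}(\mathbf z)=\prod_{i=1}^n(1-\overline{z_{0,i}}z_i)^{-1}$. $\mathbb N$ includes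 $0$; $\mathbb N_0^n=\mathbb N^n\setminus\{0\}$. Assumptions. 1 (holomorphic flow). $F:\mathbb D^n\cup\mathbb T^n\to\mathbb C^n$ is holomorphic on $\mathbb D^n$ and continuous on $\mathbb T^n$, and generates a flow $\mathbb R^+\times\mathbb D^n\to\mathbb D^n$, $(t,\mathbf z)\mapsto\varphi^t(\mathbf z)$, which for all $t\geqslant0$ is holomorphic on $\mathbb D^n$. 2 (forward invariance). For all $t>0$ there is $R_t\in(0,1)$ such that $\varphi^t(\mathbf z)\in D(\mathbf 0,R_t)^n$ for all $\mathbf z\in\mathbb T^n$ (the flow being extended continuously to $\mathbb T^n$). 3 (stable hyperbolic equilibrium). The dynamics admits a stable equilibrium at the origin, whose basin of attraction contains $\overline{\mathbb D^n}$. The eigenvalues $\lambda_1,\dots,\lambda_n$ of the Jacobian matrix $\mathcal J_F(\mathbf 0)$ are simple and satisfy $\mathrm{Re}(\lambda_j)<0$. 4 (non-resonance). For all $(m_1,\dots,m_n)\in\mathbb N^n$ with $\sum_lm_l\geqslant2$, $\lambda_j\neq\sum_lm_l\lambda_l$ for all $j=1,\dots,n$. 5 (output map). The components $h_1,\dots,h_m$ of $h$ belong to $\mathbb H^2(\mathbb D^n)$. $K(t)f=f\circ\varphi^t$, a bounded operator on $\mathbb H^2(\mathbb D^n)$ with adjoint $K(t)^*$; $K(t)^*k_{\mathbf z}=k_{\varphi^t(\mathbf z)}$. $A_Ff=F\cdot\nabla f$ with $D(A_F)=\{f\in\mathbb H^2(\mathbb D^n):F\cdot\nabla f\in\mathbb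 H^2(\mathbb D^n)\}$, and $A_F^*$ is its adjoint (both closed, densely defined). $C_hg=(\langle g,h_1\rangle,\dots,\langle g,h_m\rangle)^T$. For $\alpha\in\mathbb N^n$ put $\lambda_\alpha=\sum_j\alpha_j\lambda_j$ and let $\psi_\alpha$ be the corresponding eigenfunction of $A_F^*$, $A_F^*\psi_\alpha=\overline{\lambda_\alpha}\psi_\alpha$. The principal eigenfunctions $\psi_j$, $j=1,\dots,n$, are those with $A_F^*\psi_j=\overline{\lambda_j}\psi_j$. Let $I_\beta^+=\{\alpha\in\mathbb N_0^n:\mathrm{Re}(\lambda_\alpha)>\beta\}$ (a finite set) and $H_\beta^+=\mathrm{span}\{\psi_\alpha:\alpha\in I_\beta^+\}$; thus $\psi_j\in H_\beta^+$ means $\mathrm{Re}(\lambda_j)>\beta$. For $\tau>0$ let $\mathcal C^\tau:\mathbb H^2(\mathbb D^n)\to L^2([0,\tau],\mathbb C^m)$, $f\mapsto C_hK(\cdot)^*f$. The dual Koopman system is pointwise $\beta$-detectable if, for all $\gamma<-\beta$ and all $\mathbf z,\mathbf z'\in\mathbb D^n$, $k_{\mathbf z}-k_{\mathbf z'}\in\bigcap_{\tau>0}\ker\mathcal C^\tau$ implies $\lim_{t\to\infty}e^{\gamma t}|\langle p_k,K(t)^*(k_{\mathbf z}-k_{\mathbf z'})\rangle|=0$ for all $k=1,\dots,n$, where $p_k(\mathbf z)=z_k$. *)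

theory Defs
  imports "HOL-Analysis.Analysis"
begin

section \<open>Polydiscs and holomorphic functions of several variables\<close>

definition polydisc :: "real \<Rightarrow> (complex^'n) set" where
  "polydisc R = {z. \<forall>k. cmod (z $ k) < R}"

abbreviation unit_polydisc :: "(complex^'n) set" ("\<D>") where
  "\<D> \<equiv> polydisc 1"

definition torus :: "(complex^'n) set" ("\<T>") where
  "\<T> = {z. \<forall>k. cmod (z $ k) = 1}"

text \<open>Complex differentiability on an open set: the real Frechet derivative exists and is
  complex-linear.\<close>

definition holo_on :: "(complex^'n \<Rightarrow> complex) \<Rightarrow> (complex^'n) set \<Rightarrow> bool" where
  "holo_on f S \<longleftrightarrow>
     (\<forall>z\<in>S. \<exists>f'. (f has_derivative f') (at z) \<and> (\<forall>c v. f' (c *s v) = c * f' v))"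

definition partial_deriv :: "'n \<Rightarrow> (complex^'n \<Rightarrow> complex) \<Rightarrow> complex^'n \<Rightarrow> complex" where
  "partial_deriv j f z = deriv (\<lambda>w. f (\<chi> k. if k = j then w else z $ k)) (z $ j)"

definition jacobian :: "(complex^'n \<Rightarrow> complex^'n) \<Rightarrow> complex^'n \<Rightarrow> complex^'n^'n" where
  "jacobian F z = (\<chi> i j. partial_deriv j (\<lambda>w. F w $ i) z)"

text \<open>Functions on \<open>\<D>\<close> are encoded as total functions that vanish outside \<open>\<D>\<close>, so that
  equality of functions on \<open>\<D>\<close> is equality in the logic.\<close>

definition on_disc :: "(complex^'n \<Rightarrow> complex) \<Rightarrow> complex^'n \<Rightarrow> complex" where
  "on_disc f = (\<lambda>z. if z \<in> \<D> then f z else 0)"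


section \<open>The Hardy space of the polydisc\<close>

text \<open>The torus is parametrised by angles in \<open>[0, 2\<pi>]\<close>, which gives normalised Lebesgue measure
  after division by \<open>(2\<pi>)^n\<close>.\<close>

definition torus_mean :: "(complex^'n \<Rightarrow> complex) \<Rightarrow> real \<Rightarrow> real" where
  "torus_mean f r =
     (LINT \<theta> : cbox 0 (\<chi> k. 2 * pi) | (lborel :: (real^'n) measure).
        (cmod (f (\<chi> k. of_real r * cis (\<theta> $ k))))\<^sup>2) / (2 * pi) ^ CARD('n)"

definition hardy :: "(complex^'n \<Rightarrow> complex) set" ("\<H>\<^sup>2") where
  "\<H>\<^sup>2 = {f. holo_on f \<D> \<and> (\<forall>z. z \<notin> \<D> \<longrightarrow> f z = 0) \<and>
             (\<exists>L. (torus_mean f \<longlongrightarrow> L) (at_left 1))}"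

text \<open>Taylor coefficients at the origin: the coefficients of the power series expansion of \<open>f\<close>
  on \<open>\<D>\<close>, which exists and is unique for holomorphic \<open>f\<close>.\<close>

definition taylor :: "(complex^'n \<Rightarrow> complex) \<Rightarrow> ('n \<Rightarrow> nat) \<Rightarrow> complex" where
  "taylor f = (THE a. \<forall>z\<in>\<D>. ((\<lambda>\<alpha>. a \<alpha> * (\<Prod>k\<in>UNIV. (z $ k) ^ \<alpha> k)) has_sum f z) UNIV)"

definition hinner :: "(complex^'n \<Rightarrow> complex) \<Rightarrow> (complex^'n \<Rightarrow> complex) \<Rightarrow> complex" where
  "hinner f g = (\<Sum>\<^sub>\<infinity>\<alpha>. taylor f \<alpha> * cnj (taylor g \<alpha>))"

definition rkernel :: "complex^'n \<Rightarrow> complex^'n \<Rightarrow> complex" where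
  "rkernel z0 = on_disc (\<lambda>z. \<Prod>i\<in>UNIV. inverse (1 - cnj (z0 $ i) * z $ i))"

definition coord_fun :: "'n \<Rightarrow> complex^'n \<Rightarrow> complex" where
  "coord_fun k = on_disc (\<lambda>z. z $ k)"

text \<open>Adjoint of a (possibly unbounded) operator \<open>A\<close> with domain \<open>DA\<close>; the \<open>THE\<close> is
  well determined on \<open>adj_dom DA A\<close> when \<open>DA\<close> is dense.\<close>

definition adj_dom ::
    "(complex^'n \<Rightarrow> complex) set \<Rightarrow> ((complex^'n \<Rightarrow> complex) \<Rightarrow> complex^'n \<Rightarrow> complex)
      \<Rightarrow> (complex^'n \<Rightarrow> complex) set" where
  "adj_dom DA A = {g\<in>\<H>\<^sup>2. \<exists>g'\<in>\<H>\<^sup>2. \<forall>f\<in>DA. hinner (A f) g = hinner f g'}"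

definition adj ::
    "(complex^'n \<Rightarrow> complex) set \<Rightarrow> ((complex^'n \<Rightarrow> complex) \<Rightarrow> complex^'n \<Rightarrow> complex)
      \<Rightarrow> (complex^'n \<Rightarrow> complex) \<Rightarrow> complex^'n \<Rightarrow> complex" where
  "adj DA A g = (THE g'. g' \<in> \<H>\<^sup>2 \<and> (\<forall>f\<in>DA. hinner (A f) g = hinner f g'))"


section \<open>The dynamics\<close>

text \<open>\<open>\<phi> t\<close> on the torus is the continuous extension of \<open>\<phi> t\<close> from \<open>\<D>\<close>; the differential
  equation and the semigroup law are only required on \<open>\<D>\<close>.\<close>

definition holomorphic_flow ::
    "(complex^'n \<Rightarrow> complex^'n) \<Rightarrow> (real \<Rightarrow> complex^'n \<Rightarrow> complex^'n) \<Rightarrow> bool" where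
  "holomorphic_flow F \<phi> \<longleftrightarrow>
     (\<forall>i. holo_on (\<lambda>z. F z $ i) \<D>) \<and> continuous_on (\<D> \<union> \<T>) F \<and>
     (\<forall>z\<in>\<D>. \<phi> 0 z = z) \<and>
     (\<forall>t\<ge>0. \<forall>z\<in>\<D>. \<phi> t z \<in> \<D>) \<and>
     (\<forall>s\<ge>0. \<forall>t\<ge>0. \<forall>z\<in>\<D>. \<phi> (s + t) z = \<phi> s (\<phi> t z)) \<and>
     (\<forall>t\<ge>0. \<forall>z\<in>\<D>. ((\<lambda>s. \<phi> s z) has_vector_derivative F (\<phi> t z)) (at t within {0..})) \<and>
     (\<forall>t\<ge>0. \<forall>i. holo_on (\<lambda>z. \<phi> t z $ i) \<D>) \<and>
     (\<forall>t\<ge>0. continuous_on (\<D> \<union> \<T>) (\<phi> t))"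

definition forward_invariant :: "(real \<Rightarrow> complex^'n \<Rightarrow> complex^'n) \<Rightarrow> bool" where
  "forward_invariant \<phi> \<longleftrightarrow>
     (\<forall>t>0. \<exists>R. 0 < R \<and> R < 1 \<and> (\<forall>z\<in>\<T>. \<phi> t z \<in> polydisc R))"

text \<open>In dimension at least 2 the closed polydisc has boundary points outside the torus; there,
  too, the flow is understood as its continuous extension from \<open>\<D>\<close>. At points of \<open>\<D>\<close> and \<open>\<T>\<close>
  the limit below is \<open>\<phi> t z\<close> itself.\<close>

definition basin :: "(real \<Rightarrow> complex^'n \<Rightarrow> complex^'n) \<Rightarrow> (complex^'n) set" where
  "basin \<phi> = {z \<in> closure \<D>. ((\<lambda>t. Lim (at z within \<D>) (\<phi> t)) \<longlongrightarrow> 0) at_top}"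

definition stable_equilibrium ::
    "(complex^'n \<Rightarrow> complex^'n) \<Rightarrow> (real \<Rightarrow> complex^'n \<Rightarrow> complex^'n) \<Rightarrow> bool" where
  "stable_equilibrium F \<phi> \<longleftrightarrow>
     F 0 = 0 \<and>
     (\<forall>\<epsilon>>0. \<exists>\<delta>>0. \<forall>z\<in>\<D>. norm z < \<delta> \<longrightarrow> (\<forall>t\<ge>0. norm (\<phi> t z) < \<epsilon>))"

text \<open>\<open>lam\<close> lists the eigenvalues of \<open>J\<close> with algebraic multiplicity, and all of them are simple.\<close>

definition simple_eigenvalues :: "complex^'n^'n \<Rightarrow> ('n \<Rightarrow> complex) \<Rightarrow> bool" where
  "simple_eigenvalues J lam \<longleftrightarrow>
     (\<forall>x. det (mat x - J) = (\<Prod>j\<in>UNIV. x - lam j)) \<and> inj lam"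

definition stable_hyperbolic ::
    "(complex^'n \<Rightarrow> complex^'n) \<Rightarrow> (real \<Rightarrow> complex^'n \<Rightarrow> complex^'n) \<Rightarrow> ('n \<Rightarrow> complex) \<Rightarrow> bool"
  where
  "stable_hyperbolic F \<phi> lam \<longleftrightarrow>
     stable_equilibrium F \<phi> \<and> closure \<D> \<subseteq> basin \<phi> \<and>
     simple_eigenvalues (jacobian F 0) lam \<and> (\<forall>j. Re (lam j) < 0)"

definition eigval :: "('n::finite \<Rightarrow> complex) \<Rightarrow> ('n \<Rightarrow> nat) \<Rightarrow> complex" where
  "eigval lam \<alpha> = (\<Sum>j\<in>UNIV. of_nat (\<alpha> j) * lam j)"

definition nonresonant :: "('n::finite \<Rightarrow> complex) \<Rightarrow> bool" where
  "nonresonant lam \<longleftrightarrow> (\<forall>m. (\<Sum>l\<in>UNIV. m l) \<ge> 2 \<longrightarrow> (\<forall>j. lam j \<noteq> eigval lam m))"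


section \<open>Koopman operators and the spectral data of the dual generator\<close>

definition koopman ::
    "(real \<Rightarrow> complex^'n \<Rightarrow> complex^'n) \<Rightarrow> real \<Rightarrow> (complex^'n \<Rightarrow> complex) \<Rightarrow> complex^'n \<Rightarrow> complex"
  where
  "koopman \<phi> t f = on_disc (\<lambda>z. f (\<phi> t z))"

definition koopman_adj ::
    "(real \<Rightarrow> complex^'n \<Rightarrow> complex^'n) \<Rightarrow> real \<Rightarrow> (complex^'n \<Rightarrow> complex) \<Rightarrow> complex^'n \<Rightarrow> complex"
  where
  "koopman_adj \<phi> t = adj \<H>\<^sup>2 (koopman \<phi> t)"

definition gen ::
    "(complex^'n \<Rightarrow> complex^'n) \<Rightarrow> (complex^'n \<Rightarrow> complex) \<Rightarrow> complex^'n \<Rightarrow> complex" where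
  "gen F f = on_disc (\<lambda>z. \<Sum>j\<in>UNIV. F z $ j * partial_deriv j f z)"

definition gen_dom :: "(complex^'n \<Rightarrow> complex^'n) \<Rightarrow> (complex^'n \<Rightarrow> complex) set" where
  "gen_dom F = {f\<in>\<H>\<^sup>2. gen F f \<in> \<H>\<^sup>2}"

definition gen_adj_dom :: "(complex^'n \<Rightarrow> complex^'n) \<Rightarrow> (complex^'n \<Rightarrow> complex) set" where
  "gen_adj_dom F = adj_dom (gen_dom F) (gen F)"

definition gen_adj ::
    "(complex^'n \<Rightarrow> complex^'n) \<Rightarrow> (complex^'n \<Rightarrow> complex) \<Rightarrow> complex^'n \<Rightarrow> complex" where
  "gen_adj F = adj (gen_dom F) (gen F)"

definition dual_eigenfunction ::
    "(complex^'n \<Rightarrow> complex^'n) \<Rightarrow> complex \<Rightarrow> (complex^'n \<Rightarrow> complex) \<Rightarrow> bool" where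
  "dual_eigenfunction F \<mu> \<psi> \<longleftrightarrow>
     \<psi> \<in> gen_adj_dom F \<and> \<psi> \<noteq> (\<lambda>z. 0) \<and> gen_adj F \<psi> = (\<lambda>z. \<mu> * \<psi> z)"

definition unit_index :: "'n \<Rightarrow> 'n \<Rightarrow> nat" where
  "unit_index j = (\<lambda>k. if k = j then 1 else 0)"

definition unstable_indices :: "real \<Rightarrow> ('n::finite \<Rightarrow> complex) \<Rightarrow> ('n \<Rightarrow> nat) set" where
  "unstable_indices \<beta> lam = {\<alpha>. \<alpha> \<noteq> (\<lambda>k. 0) \<and> Re (eigval lam \<alpha>) > \<beta>}"

definition complex_span :: "(complex^'n \<Rightarrow> complex) set \<Rightarrow> (complex^'n \<Rightarrow> complex) set" where
  "complex_span B = {f. \<exists>T c. finite T \<and> T \<subseteq> B \<and> f = (\<lambda>z. \<Sum>b\<in>T. c b * b z)}"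

definition unstable_space ::
    "real \<Rightarrow> ('n \<Rightarrow> complex) \<Rightarrow> (('n \<Rightarrow> nat) \<Rightarrow> complex^'n \<Rightarrow> complex)
      \<Rightarrow> (complex^'n \<Rightarrow> complex) set" where
  "unstable_space \<beta> lam \<psi> = complex_span (\<psi> ` unstable_indices \<beta> lam)"


section \<open>Output and detectability\<close>

definition output_component :: "(complex^'n \<Rightarrow> complex^'m) \<Rightarrow> 'm \<Rightarrow> complex^'n \<Rightarrow> complex" where
  "output_component h i = on_disc (\<lambda>z. h z $ i)"

definition output_op :: "(complex^'n \<Rightarrow> complex^'m) \<Rightarrow> (complex^'n \<Rightarrow> complex) \<Rightarrow> complex^'m" where
  "output_op h g = (\<chi> i. hinner g (output_component h i))"

definition observation ::
    "(real \<Rightarrow> complex^'n \<Rightarrow> complex^'n) \<Rightarrow> (complex^'n \<Rightarrow> complex^'m)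
      \<Rightarrow> (complex^'n \<Rightarrow> complex) \<Rightarrow> real \<Rightarrow> complex^'m" where
  "observation \<phi> h f = (\<lambda>t. output_op h (koopman_adj \<phi> t f))"

text \<open>Kernel of the observation map into \<open>L\<^sup>2([0,\<tau>])\<close>: vanishing there means vanishing almost
  everywhere.\<close>

definition observation_kernel ::
    "(real \<Rightarrow> complex^'n \<Rightarrow> complex^'n) \<Rightarrow> (complex^'n \<Rightarrow> complex^'m) \<Rightarrow> real
      \<Rightarrow> (complex^'n \<Rightarrow> complex) set" where
  "observation_kernel \<phi> h \<tau> = {f\<in>\<H>\<^sup>2. AE t in lborel. t \<in> {0..\<tau>} \<longrightarrow> observation \<phi> h f t = 0}"

definition pointwise_detectable ::
    "real \<Rightarrow> (real \<Rightarrow> complex^'n \<Rightarrow> complex^'n) \<Rightarrow> (complex^'n \<Rightarrow> complex^'m) \<Rightarrow> bool" where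
  "pointwise_detectable \<beta> \<phi> h \<longleftrightarrow>
     (\<forall>\<gamma> < -\<beta>. \<forall>z\<in>\<D>. \<forall>z'\<in>\<D>.
        (\<lambda>x. rkernel z x - rkernel z' x) \<in> (\<Inter>\<tau>\<in>{0<..}. observation_kernel \<phi> h \<tau>) \<longrightarrow>
        (\<forall>k. ((\<lambda>t. exp (\<gamma> * t) *
               cmod (hinner (coord_fun k)
                       (koopman_adj \<phi> t (\<lambda>x. rkernel z x - rkernel z' x)))) \<longlongrightarrow> 0) at_top))"

end

theory Submission
  imports Defs "HOL-Complex_Analysis.Cauchy_Integral_Formula"
begin

text \<open>Since \<open>K(t)\<^sup>* k\<^sub>z = k\<^bsub>\<phi>(t,z)\<^esub>\<close>, the output of \<open>k\<^sub>z - k\<^bsub>z'\<^esub>\<close> vanishes iff \<open>h\<close> takes equal values along the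
  orbits of \<open>z\<close> and \<open>z'\<close>, and the claim is that the difference \<open>w\<close> of these orbits is \<open>O(exp (\<beta> t))\<close>.

  If \<open>A\<^sup>* \<psi> = cnj \<mu> \<psi>\<close>, then the functional \<open>\<langle>\<cdot>, \<psi>\<rangle>\<close> vanishes on
  functions of high order at the origin, because these have the form \<open>\<mu> u - F \<cdot> \<nabla>u\<close> with \<open>u\<close> a Laplace
  transform along the flow. For \<open>\<mu> = \<lambda>\<^sub>j\<close> non-resonance then removes the degrees \<open>\<ge> 2\<close> one after the
  other, so that \<open>\<langle>h, \<psi>\<^sub>j\<rangle>\<close> is the derivative of \<open>h\<close> at \<open>0\<close> along a right eigenvector \<open>v\<^sub>j\<close> of the
  Jacobian matrix.

  Both orbits decay exponentially, so \<open>w\<close> solves \<open>w' = (J + B(t)) w\<close> with \<open>B\<close> exponentially small, and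
  \<open>Dh(0) w\<close> is exponentially smaller than \<open>w\<close>. If \<open>w = O(exp (\<sigma> t))\<close> with \<open>\<sigma> > \<beta>\<close>, then up to a smaller
  error \<open>w\<close> is a combination of the \<open>exp (\<lambda>\<^sub>j t) v\<^sub>j\<close> with \<open>Re \<lambda>\<^sub>j > \<beta>\<close>. Applying \<open>Dh(0)\<close>, the independence
  of exponentials and \<open>Dh(0) v\<^sub>j \<noteq> 0\<close> force all coefficients to be zero, which lowers \<open>\<sigma>\<close> by a fixed
  amount; finitely many such steps reach \<open>\<beta>\<close>.\<close>

section \<open>The mean over the torus\<close>

text \<open>The obstacle is that \<open>\<psi>\<close> is known only through \<open>\<langle>A f,
  \<psi>\<rangle> = \<mu> \<langle>f, \<psi>\<rangle>\<close> for \<open>f\<close> in the domain of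
  the generator, so every test function has to be placed in that domain. Polynomials lie there
  because \<open>F\<close> is continuous up to the torus. The Laplace transforms lie there because
  the orbits decay uniformly over the whole polydisc. The uniformity comes from forward invariance:
  the maximum principle carries the bound on the torus into the polydisc, so the time-one image sits
  in a compact polydisc, and compactness together with a Lyapunov estimate near 0 yields one rate
  \<open>c\<close> for all orbits. The same \<open>c\<close> decides from which degree on the
  Laplace transform converges (\<open>deg \<alpha> * c > - Re \<mu>\<close>), and it bounds the gain
  of one step of the final bootstrap. The outputs have no boundary regularity, but orbits end up
  near 0. There everything rests on the remainder bound
  \<open>K * (norm x + norm y) * norm (x - y)\<close>: for \<open>y = 0\<close> it is a Taylor
  estimate, and along two orbits it is an exponentially small multiple of their difference.\<close>

abbreviation (input) tbox :: "(real^'n) set" where "tbox \<equiv> cbox 0 (\<chi> k. 2 * pi)"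

text \<open>Polymorphic, since it moves one angle in \<open>real^'n\<close> as well as one variable
  in \<open>complex^'n\<close>.\<close>

definition coord_upd :: "'a^'n \<Rightarrow> 'n \<Rightarrow> 'a \<Rightarrow> 'a^'n" where
  "coord_upd x k s = (\<chi> i. if i = k then s else x $ i)"

lemma coord_upd_nth: "coord_upd x k s $ i = (if i = k then s else x $ i)"
  by (simp add: coord_upd_def)

lemma coord_upd_same [simp]: "coord_upd x k (x $ k) = x"
  by (simp add: coord_upd_def vec_eq_iff)

text \<open>The complex-valued companion of \<open>torus_mean\<close>; Cauchy kernels and Fourier
  coefficients are averaged with it.\<close>

definition torus_avg :: "(real^'n \<Rightarrow> complex) \<Rightarrow> complex" where
  "torus_avg G = (LINT \<theta>:tbox|lborel. G \<theta>) / (2 * pi) ^ CARD('n)"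

lemma mem_tbox: "\<theta> \<in> tbox \<longleftrightarrow> (\<forall>k. 0 \<le> \<theta> $ k \<and> \<theta> $ k \<le> 2 * pi)"
  by (simp add: mem_box_cart)

text \<open>Lebesgue measure is the image of a product measure indexed by \<open>Basis\<close>;
  Fubini for the basis vector \<open>axis k 1\<close> isolates the \<open>k\<close>-th
  coordinate.\<close>

lemma lborel_integral_coord:
  fixes g :: "real^'n \<Rightarrow> complex" and k :: 'n
  defines "I \<equiv> Basis - {axis k 1 :: real^'n}"
  assumes g: "integrable lborel g"
  shows "(\<integral>\<theta>. g \<theta> \<partial>lborel) =
    (\<integral>x. (\<integral>y. g (y *\<^sub>R axis k 1 + (\<Sum>b\<in>I. x b *\<^sub>R b)) \<partial>lborel) \<partial>(Pi\<^sub>M I (\<lambda>_. lborel)))"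
proof -
  interpret product_sigma_finite "\<lambda>_::real^'n. lborel :: real measure"
    by standard
  have ax: "axis k 1 \<in> (Basis :: (real^'n) set)" by (simp add: axis_in_Basis_iff)
  have ins: "insert (axis k 1) I = Basis" using ax by (auto simp: I_def)
  have fin: "finite I" "axis k 1 \<notin> I" by (auto simp: I_def)
  let ?T = "\<lambda>f. \<Sum>b\<in>(Basis::(real^'n) set). f b *\<^sub>R b"
  have T: "?T \<in> measurable (Pi\<^sub>M Basis (\<lambda>_. lborel)) borel"
    by measurable
  have gm: "g \<in> borel_measurable borel" using g by auto
  have int: "integrable (Pi\<^sub>M Basis (\<lambda>_. lborel)) (\<lambda>f. g (?T f))"
    using g unfolding lborel_eq[where 'a="real^'n"] by (subst (asm) integrable_distr_eq[OF T gm])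
  have Tupd: "?T (x(axis k 1 := y)) = y *\<^sub>R axis k 1 + (\<Sum>b\<in>I. x b *\<^sub>R b)" for x :: "real^'n \<Rightarrow> real" and y
  proof -
    have "?T (x(axis k 1 := y)) = (\<Sum>b\<in>insert (axis k 1) I. (x(axis k 1 := y)) b *\<^sub>R b)"
      by (simp add: ins)
    also have "\<dots> = y *\<^sub>R axis k 1 + (\<Sum>b\<in>I. (x(axis k 1 := y)) b *\<^sub>R b)"
      using fin by simp
    also have "(\<Sum>b\<in>I. (x(axis k 1 := y)) b *\<^sub>R b) = (\<Sum>b\<in>I. x b *\<^sub>R b)"
      using fin by (intro sum.cong) auto
    finally show ?thesis .
  qed
  have "(\<integral>\<theta>. g \<theta> \<partial>lborel) = (\<integral>f. g (?T f) \<partial>Pi\<^sub>M Basis (\<lambda>_. lborel))"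
    unfolding lborel_eq[where 'a="real^'n"] by (rule integral_distr[OF T gm])
  also have "\<dots> = (\<integral>f. g (?T f) \<partial>Pi\<^sub>M (insert (axis k 1) I) (\<lambda>_. lborel))"
    by (simp add: ins)
  also have "\<dots> = (\<integral>x. (\<integral>y. g (?T (x(axis k 1 := y))) \<partial>lborel) \<partial>(Pi\<^sub>M I (\<lambda>_. lborel)))"
    by (rule product_integral_insert[OF fin]) (use int ins in simp)
  finally show ?thesis unfolding Tupd .
qed

lemma set_integrable_tbox:
  fixes G :: "real^'n \<Rightarrow> 'b::{banach,second_countable_topology}"
  assumes "continuous_on tbox G"
  shows "set_integrable lborel tbox G"
  unfolding set_integrable_def by (rule borel_integrable_compact[OF compact_cbox assms])

text \<open>Fubini in one angle. The inner mean is again written as a function of all angles,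
  constant in the \<open>k\<close>-th, so that both sides have the same form and the formula can be
  applied angle by angle.\<close>

lemma torus_avg_coord:
  fixes G :: "real^'n \<Rightarrow> complex"
  assumes G: "continuous_on tbox G"
  shows "torus_avg G = torus_avg (\<lambda>\<theta>. integral {0..2*pi} (\<lambda>s. G (coord_upd \<theta> k s)) / (2 * pi))"
proof -
  define I where "I = Basis - {axis k 1 :: real^'n}"
  \<comment> \<open>\<open>E x y\<close> has \<open>k\<close>-th coordinate \<open>y\<close> and
    takes the others from \<open>x\<close>. The \<open>k\<close>-th coordinate of
    \<open>E x 0\<close> is 0, which belongs to [0, 2 pi], so membership in the box splits into a
    condition on \<open>y\<close> and one on \<open>x\<close>.\<close>
  define E where "E = (\<lambda>x y. y *\<^sub>R axis k 1 + (\<Sum>b\<in>I. x b *\<^sub>R b))"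
  define H where "H = (\<lambda>\<theta>. integral {0..2*pi} (\<lambda>s. G (coord_upd \<theta> k s)) / (2 * pi))"
  have I0: "(\<Sum>b\<in>I. x b *\<^sub>R b) $ k = 0" for x :: "real^'n \<Rightarrow> real"
  proof -
    have "b $ k = 0" if "b \<in> I" for b
      using that unfolding I_def Basis_vec_def by (auto simp: axis_def)
    then show ?thesis by (simp add: sum_component)
  qed
  have Ek: "E x y $ i = (if i = k then y else E x 0 $ i)" for x y i
    using I0[of x] by (auto simp: E_def axis_def)
  have Eupd: "coord_upd (E x y) k s = E x s" for x y s
    by (simp add: coord_upd_def vec_eq_iff Ek[of x y] Ek[of x s])
  have Ebox: "E x y \<in> tbox \<longleftrightarrow> y \<in> {0..2*pi} \<and> E x 0 \<in> tbox" for x y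
  proof -
    have "E x y \<in> tbox \<longleftrightarrow> (\<forall>i. 0 \<le> (if i = k then y else E x 0 $ i) \<and> (if i = k then y else E x 0 $ i) \<le> 2 * pi)"
      unfolding mem_tbox Ek[of x y] ..
    moreover have "E x 0 $ k = 0" using Ek[of x 0 k] by simp
    moreover have "(0::real) \<le> 2 * pi" by simp
    ultimately show ?thesis unfolding mem_tbox atLeastAtMost_iff by (smt (verit, best))
  qed
  have cH: "continuous_on tbox H"
  proof -
    have "continuous_on tbox (\<lambda>\<theta>. integral (cbox 0 (2*pi)) (\<lambda>s. G (coord_upd \<theta> k s)))"
    proof (rule integral_continuous_on_param)
      have "continuous_on (tbox \<times> cbox 0 (2*pi)) (\<lambda>z. G (coord_upd (fst z) k (snd z)))"
      proof (rule continuous_on_compose2[OF G])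
        show "continuous_on (tbox \<times> cbox 0 (2*pi)) (\<lambda>z. coord_upd (fst z) k (snd z))"
          unfolding coord_upd_def
          apply (intro continuous_on_vec_lambda)
          subgoal for i by (cases "i = k") (auto intro!: continuous_intros)
          done
        show "(\<lambda>z. coord_upd (fst z) k (snd z)) ` (tbox \<times> cbox 0 (2*pi)) \<subseteq> tbox"
        proof (rule image_subsetI)
          fix z :: "(real^'n) \<times> real" assume "z \<in> tbox \<times> cbox 0 (2*pi)"
          then have "fst z \<in> tbox" "snd z \<in> {0..2*pi}" by auto
          then show "coord_upd (fst z) k (snd z) \<in> tbox"
            unfolding mem_tbox by (auto simp: coord_upd_nth)
        qed
      qed
      then show "continuous_on (tbox \<times> cbox 0 (2*pi)) (\<lambda>(\<theta>, s). G (coord_upd \<theta> k s))"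
        by (simp add: case_prod_beta)
    qed
    then show ?thesis unfolding H_def by (auto intro!: continuous_intros simp: cbox_interval)
  qed
  have split: "(LINT \<theta>:tbox|lborel. K \<theta>) = (\<integral>x. indicator {x. E x 0 \<in> tbox} x *\<^sub>R (LINT y:{0..2*pi}|lborel. K (E x y)) \<partial>(Pi\<^sub>M I (\<lambda>_. lborel)))"
    if K: "continuous_on tbox K" for K :: "real^'n \<Rightarrow> complex"
  proof -
    have "(LINT \<theta>:tbox|lborel. K \<theta>) = (\<integral>x. (\<integral>y. indicator tbox (E x y) *\<^sub>R K (E x y) \<partial>lborel) \<partial>(Pi\<^sub>M I (\<lambda>_. lborel)))"
      using lborel_integral_coord[of "\<lambda>\<theta>. indicator tbox \<theta> *\<^sub>R K \<theta>" k] set_integrable_tbox[OF K]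
      unfolding set_integrable_def set_lebesgue_integral_def I_def E_def by simp
    also have "\<dots> = (\<integral>x. indicator {x. E x 0 \<in> tbox} x *\<^sub>R (LINT y:{0..2*pi}|lborel. K (E x y)) \<partial>(Pi\<^sub>M I (\<lambda>_. lborel)))"
    proof (rule Bochner_Integration.integral_cong[OF refl])
      fix x
      have "(\<lambda>y. indicator tbox (E x y) *\<^sub>R K (E x y)) =
          (\<lambda>y. (indicator {x. E x 0 \<in> tbox} x :: real) *\<^sub>R (indicator {0..2*pi} y *\<^sub>R K (E x y)))"
      proof (rule ext)
        fix y
        show "indicator tbox (E x y) *\<^sub>R K (E x y) =
          (indicator {x. E x 0 \<in> tbox} x :: real) *\<^sub>R (indicator {0..2*pi} y *\<^sub>R K (E x y))"
          using Ebox[of x y] by (cases "E x 0 \<in> tbox"; cases "y \<in> {0..2*pi}") simp_all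
      qed
      then show "(\<integral>y. indicator tbox (E x y) *\<^sub>R K (E x y) \<partial>lborel) =
        indicator {x. E x 0 \<in> tbox} x *\<^sub>R (LINT y:{0..2*pi}|lborel. K (E x y))"
        unfolding set_lebesgue_integral_def by (simp del: scaleR_scaleR)
    qed
    finally show ?thesis .
  qed
  have "(LINT y:{0..2*pi}|lborel. G (E x y)) = (LINT y:{0..2*pi}|lborel. H (E x y))" if x: "E x 0 \<in> tbox" for x
  proof -
    have "continuous_on {0..2*pi} (\<lambda>y. G (E x y))"
    proof (rule continuous_on_compose2[OF G])
      show "continuous_on {0..2*pi} (\<lambda>y. E x y)" unfolding E_def by (intro continuous_intros)
      show "(\<lambda>y. E x y) ` {0..2*pi} \<subseteq> tbox"
      proof (rule image_subsetI)
        fix y assume "y \<in> {0..2*pi}"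
        then show "E x y \<in> tbox" using Ebox[of x y] x by blast
      qed
    qed
    then have "set_integrable lborel {0..2*pi} (\<lambda>y. G (E x y))"
      by (rule borel_integrable_atLeastAtMost')
    then have 1: "(LINT y:{0..2*pi}|lborel. G (E x y)) = integral {0..2*pi} (\<lambda>y. G (E x y))"
      by (rule set_borel_integral_eq_integral)
    have "(LINT y:{0..2*pi}|lborel. H (E x y)) = (LINT y:{0..2*pi}|lborel. integral {0..2*pi} (\<lambda>y. G (E x y)) / (2 * pi))"
      by (simp add: H_def Eupd)
    also have "\<dots> = integral {0..2*pi} (\<lambda>y. integral {0..2*pi} (\<lambda>y. G (E x y)) / (2 * pi))"
      by (intro set_borel_integral_eq_integral borel_integrable_atLeastAtMost' continuous_intros)
    also have "\<dots> = integral {0..2*pi} (\<lambda>y. G (E x y))"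
      by (simp add: scaleR_conv_of_real)
    finally show ?thesis using 1 by simp
  qed
  then have "(LINT \<theta>:tbox|lborel. G \<theta>) = (LINT \<theta>:tbox|lborel. H \<theta>)"
    unfolding split[OF G] split[OF cH]
    by (intro Bochner_Integration.integral_cong) (auto simp: indicator_def)
  then show ?thesis unfolding torus_avg_def H_def by simp
qed

section \<open>Linearity, bounds and termwise integration of the torus mean\<close>

lemma torus_avg_eq_integral:
  assumes "continuous_on tbox G"
  shows "torus_avg (G :: real^'n \<Rightarrow> complex) = integral tbox G / (2 * pi) ^ CARD('n)"
  using set_borel_integral_eq_integral(2)[OF set_integrable_tbox[OF assms]] by (simp add: torus_avg_def)

lemma content_tbox: "measure lborel (tbox :: (real^'n) set) = (2 * pi) ^ CARD('n)"
proof -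
  have "(0::real^'n) \<in> tbox" by (simp add: mem_tbox)
  then have "(tbox :: (real^'n) set) \<noteq> {}" by blast
  then show ?thesis by (simp add: content_cbox_cart)
qed

lemma torus_avg_const [simp]: "torus_avg (\<lambda>_::real^'n. c) = c"
  by (simp add: torus_avg_eq_integral content_tbox scaleR_conv_of_real)

lemma torus_avg_add:
  assumes "continuous_on tbox G" "continuous_on tbox H"
  shows "torus_avg (\<lambda>\<theta>. G \<theta> + H \<theta>) = torus_avg G + torus_avg H"
  using assms
  by (simp add: torus_avg_eq_integral continuous_on_add integral_add integrable_continuous add_divide_distrib)

lemma torus_avg_cmult:
  assumes "continuous_on tbox G"
  shows "torus_avg (\<lambda>\<theta>. c * G \<theta>) = c * torus_avg G"
  using assms by (simp add: torus_avg_eq_integral continuous_on_mult_left)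

lemma torus_avg_diff:
  assumes "continuous_on tbox G" "continuous_on tbox H"
  shows "torus_avg (\<lambda>\<theta>. G \<theta> - H \<theta>) = torus_avg G - torus_avg H"
  using assms
  by (simp add: torus_avg_eq_integral continuous_on_diff integral_diff integrable_continuous diff_divide_distrib)

lemma torus_avg_sum:
  assumes "finite S" "\<And>a. a \<in> S \<Longrightarrow> continuous_on tbox (G a)"
  shows "torus_avg (\<lambda>\<theta>. \<Sum>a\<in>S. G a \<theta>) = (\<Sum>a\<in>S. torus_avg (G a))"
  using assms
  by (induction S rule: finite_induct) (simp_all add: torus_avg_add continuous_on_sum)

lemma torus_avg_norm_le:
  assumes G: "continuous_on tbox G" and M: "\<And>\<theta>. \<theta> \<in> tbox \<Longrightarrow> norm (G \<theta>) \<le> M"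
  shows "norm (torus_avg (G :: real^'n \<Rightarrow> complex)) \<le> M"
proof -
  have "(0::real^'n) \<in> tbox" by (simp add: mem_tbox)
  then have "0 \<le> M" using M[of 0] norm_ge_zero order_trans by blast
  then have "norm (integral tbox G) \<le> M * measure lborel (tbox :: (real^'n) set)"
    using has_integral_bound[OF _ integrable_integral[OF integrable_continuous[OF G]] M] by blast
  moreover have "cmod ((2 * complex_of_real pi) ^ CARD('n)) = (2 * pi) ^ CARD('n)"
    by (simp add: norm_power norm_mult)
  ultimately show ?thesis
    unfolding torus_avg_eq_integral[OF G] content_tbox
    by (simp add: norm_divide pos_divide_le_eq)
qed

lemma torus_avg_cong:
  assumes "\<And>\<theta>. \<theta> \<in> tbox \<Longrightarrow> G \<theta> = H \<theta>"
  shows "torus_avg G = torus_avg H"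
  unfolding torus_avg_def set_lebesgue_integral_def using assms
  by (metis (no_types, lifting) indicator_simps(2) scaleR_zero_left Bochner_Integration.integral_cong)

text \<open>Weierstrass' test: the mean is a contraction for the supremum norm, and the remainder of
  the series over a finite set is dominated by the remainder of \<open>b\<close>.\<close>

lemma torus_avg_has_sum:
  fixes G :: "'a \<Rightarrow> real^'n \<Rightarrow> complex"
  assumes G: "\<And>a. continuous_on tbox (G a)" and H: "continuous_on tbox H"
    and bnd: "\<And>a \<theta>. \<theta> \<in> tbox \<Longrightarrow> norm (G a \<theta>) \<le> b a" and b: "b summable_on UNIV"
    and sum: "\<And>\<theta>. \<theta> \<in> tbox \<Longrightarrow> ((\<lambda>a. G a \<theta>) has_sum H \<theta>) UNIV"
  shows "((\<lambda>a. torus_avg (G a)) has_sum torus_avg H) UNIV"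
proof -
  have le: "norm (torus_avg H - (\<Sum>a\<in>S. torus_avg (G a))) \<le> infsum b UNIV - sum b S" if S: "finite S" for S
  proof -
    have "torus_avg H - (\<Sum>a\<in>S. torus_avg (G a)) = torus_avg (\<lambda>\<theta>. H \<theta> - (\<Sum>a\<in>S. G a \<theta>))"
      using S G H by (simp add: torus_avg_sum torus_avg_diff continuous_on_sum)
    moreover have "norm (torus_avg (\<lambda>\<theta>. H \<theta> - (\<Sum>a\<in>S. G a \<theta>))) \<le> infsum b UNIV - sum b S"
    proof (rule torus_avg_norm_le)
      show "continuous_on tbox (\<lambda>\<theta>. H \<theta> - (\<Sum>a\<in>S. G a \<theta>))"
        by (intro continuous_intros H G)
    next
      fix \<theta> :: "real^'n" assume \<theta>: "\<theta> \<in> tbox"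
      have "((\<lambda>a. G a \<theta>) has_sum (H \<theta> - (\<Sum>a\<in>S. G a \<theta>))) (UNIV - S)"
        by (rule has_sum_Diff[OF sum[OF \<theta>] has_sum_finite[OF S]]) simp
      moreover have "(b has_sum (infsum b UNIV - sum b S)) (UNIV - S)"
        by (rule has_sum_Diff[OF has_sum_infsum[OF b] has_sum_finite[OF S]]) simp
      ultimately show "norm (H \<theta> - (\<Sum>a\<in>S. G a \<theta>)) \<le> infsum b UNIV - sum b S"
        by (rule norm_infsum_le) (use bnd \<theta> in auto)
    qed
    ultimately show ?thesis by simp
  qed
  have "((\<lambda>S. infsum b UNIV - sum b S) \<longlongrightarrow> infsum b UNIV - infsum b UNIV) (finite_subsets_at_top UNIV)"
    by (intro tendsto_intros) (use has_sum_infsum[OF b] in \<open>simp add: has_sum_def\<close>)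
  then have "((\<lambda>S. infsum b UNIV - sum b S) \<longlongrightarrow> 0) (finite_subsets_at_top UNIV)" by simp
  then have "((\<lambda>S. torus_avg H - (\<Sum>a\<in>S. torus_avg (G a))) \<longlongrightarrow> 0) (finite_subsets_at_top UNIV)"
    by (rule Lim_null_comparison[rotated])
      (use le in \<open>auto simp: eventually_finite_subsets_at_top intro!: exI[of _ "{}"]\<close>)
  then have "((\<lambda>S. torus_avg H - (torus_avg H - (\<Sum>a\<in>S. torus_avg (G a)))) \<longlongrightarrow> torus_avg H - 0) (finite_subsets_at_top UNIV)"
    by (intro tendsto_diff tendsto_const)
  then show ?thesis by (simp add: has_sum_def)
qed

section \<open>Slices of holomorphic functions\<close>

lemma polydisc_mono: "r \<le> s \<Longrightarrow> polydisc r \<subseteq> polydisc s"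
  by (auto simp: polydisc_def intro: less_le_trans)

lemma open_polydisc: "open (polydisc r :: (complex^'n) set)"
proof -
  have "polydisc r = (\<Inter>k. {z::complex^'n. cmod (z $ k) < r})" by (auto simp: polydisc_def)
  then show ?thesis by (auto intro!: open_Collect_less continuous_intros)
qed

lemma holo_onD:
  assumes "holo_on f S" "z \<in> S"
  shows "(f has_derivative frechet_derivative f (at z)) (at z)"
    and "frechet_derivative f (at z) (c *s v) = c * frechet_derivative f (at z) v"
  using assms frechet_derivative_at unfolding holo_on_def by metis+

lemma holo_on_cong:
  assumes "open S" "\<And>z. z \<in> S \<Longrightarrow> f z = g z" "holo_on f S"
  shows "holo_on g S"
  unfolding holo_on_def
proof
  fix z assume z: "z \<in> S"
  then obtain f' where f': "(f has_derivative f') (at z)" "\<forall>c v. f' (c *s v) = c * f' v"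
    using assms(3) unfolding holo_on_def by blast
  have "(g has_derivative f') (at z)"
    by (rule has_derivative_transform_within_open[OF f'(1) assms(1) z]) (use assms(2) in auto)
  then show "\<exists>f'. (g has_derivative f') (at z) \<and> (\<forall>c v. f' (c *s v) = c * f' v)"
    using f'(2) by blast
qed

lemma holo_on_continuous_on: "holo_on f S \<Longrightarrow> continuous_on S f"
  unfolding holo_on_def
  by (meson continuous_at_imp_continuous_on has_derivative_continuous)

lemma vector_smult_scaleR: "complex_of_real a *s v = a *\<^sub>R v"
  by (simp add: vec_eq_iff scaleR_conv_of_real[where 'a=complex])

lemma bounded_linear_smult: "bounded_linear (\<lambda>\<zeta>::complex. \<zeta> *s (v::complex^'n))"
proof -
  have "(\<lambda>\<zeta>::complex. \<zeta> *s v) = (\<lambda>\<zeta>. \<chi> i. \<zeta> * v $ i)" by (simp add: fun_eq_iff vec_eq_iff)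
  moreover have "linear (\<lambda>\<zeta>::complex. \<chi> i. \<zeta> * v $ i)"
    by (intro linearI) (simp_all add: vec_eq_iff distrib_right)
  ultimately show ?thesis by (simp add: linear_conv_bounded_linear)
qed

text \<open>Complex linearity of the Frechet derivative makes the restriction to a complex line
  holomorphic in one variable; this is the passage to the one-variable theory.\<close>

lemma holo_line_derivative:
  fixes f :: "complex^'n \<Rightarrow> complex"
  assumes "holo_on f S" "z + \<zeta>0 *s v \<in> S"
  shows "((\<lambda>\<zeta>. f (z + \<zeta> *s v)) has_field_derivative frechet_derivative f (at (z + \<zeta>0 *s v)) v) (at \<zeta>0)"
proof -
  have 1: "((\<lambda>\<zeta>. z + \<zeta> *s v) has_derivative (\<lambda>\<zeta>. \<zeta> *s v)) (at \<zeta>0)"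
    using has_derivative_add[OF has_derivative_const bounded_linear_imp_has_derivative[OF bounded_linear_smult[of v]]]
    by simp
  have "((\<lambda>\<zeta>. f (z + \<zeta> *s v)) has_derivative (\<lambda>\<zeta>. frechet_derivative f (at (z + \<zeta>0 *s v)) (\<zeta> *s v))) (at \<zeta>0)"
    by (rule has_derivative_compose[OF 1 holo_onD(1)[OF assms]])
  then show ?thesis
    unfolding has_field_derivative_def by (simp add: holo_onD(2)[OF assms] mult.commute[of _ "frechet_derivative f (at _) v"])
qed

lemma coord_upd_line: "coord_upd x k w = coord_upd x k 0 + w *s axis k (1::complex)"
  by (simp add: vec_eq_iff coord_upd_nth axis_def)

lemma coord_upd_line_fun:
  "(\<lambda>w. f (coord_upd x k w)) = (\<lambda>w. f (coord_upd x k 0 + w *s axis k (1::complex)))"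
  by (rule ext) (rule arg_cong[OF coord_upd_line])

lemma holo_slice:
  fixes f :: "complex^'n \<Rightarrow> complex"
  assumes "holo_on f (polydisc R)" "\<And>i. i \<noteq> k \<Longrightarrow> cmod (x $ i) < R"
  shows "(\<lambda>w. f (coord_upd x k w)) holomorphic_on ball 0 R"
proof -
  have "((\<lambda>w. f (coord_upd x k 0 + w *s axis k 1)) has_field_derivative
      frechet_derivative f (at (coord_upd x k 0 + w *s axis k 1)) (axis k 1)) (at w)" if "w \<in> ball 0 R" for w
    by (rule holo_line_derivative[OF assms(1)], subst coord_upd_line[symmetric])
      (use that assms(2) in \<open>auto simp: polydisc_def coord_upd_nth\<close>)
  then have "(\<lambda>w. f (coord_upd x k 0 + w *s axis k 1)) holomorphic_on ball 0 R"
    unfolding holomorphic_on_def field_differentiable_def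
    using has_field_derivative_at_within by blast
  then show ?thesis unfolding coord_upd_line_fun .
qed

lemma partial_deriv_eq:
  assumes "holo_on f S" "z \<in> S"
  shows "partial_deriv j f z = frechet_derivative f (at z) (axis j 1)"
proof -
  have "z = coord_upd z j 0 + (z $ j) *s axis j 1" by (subst coord_upd_line[symmetric]) simp
  then have "((\<lambda>\<zeta>. f (coord_upd z j 0 + \<zeta> *s axis j 1)) has_field_derivative frechet_derivative f (at z) (axis j 1)) (at (z $ j))"
    using holo_line_derivative[OF assms(1), of "coord_upd z j 0" "z $ j" "axis j 1"] assms(2) by simp
  then have "deriv (\<lambda>\<zeta>. f (coord_upd z j \<zeta>)) (z $ j) = frechet_derivative f (at z) (axis j 1)"
    unfolding coord_upd_line_fun by (rule DERIV_imp_deriv)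
  then show ?thesis by (simp add: partial_deriv_def coord_upd_def)
qed

text \<open>With \<open>u = r * cis s\<close> one has du / (u - z) = i ds / (1 - z / u), which puts
  Cauchy's formula in a shape where the kernel is a geometric series in z / u.\<close>

lemma circle_cauchy:
  fixes g :: "complex \<Rightarrow> complex"
  assumes g: "g holomorphic_on ball 0 1" and r: "0 < r" "r < 1" and z: "cmod z < r"
  shows "integral {0..2*pi} (\<lambda>s. g (of_real r * cis s) * inverse (1 - z * cis (- s) / of_real r)) = 2 * pi * g z"
proof -
  have "cball (0::complex) r \<subseteq> ball 0 1" using r by auto
  then have "((\<lambda>u. g u / (u - z)) has_contour_integral (2 * of_real pi * \<i> * g z)) (circlepath 0 r)"
    using Cauchy_integral_circlepath_simple[of g 0 r z] g z holomorphic_on_subset by auto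
  then have "((\<lambda>t. g (0 + r * cis t) / (0 + r * cis t - z) * r * \<i> * cis t) has_integral (2 * of_real pi * \<i> * g z)) {0..2*pi}"
    unfolding circlepath_def by (subst (asm) has_contour_integral_part_circlepath_iff) simp_all
  then have "((\<lambda>t. (g (0 + r * cis t) / (0 + r * cis t - z) * r * \<i> * cis t) / \<i>) has_integral (2 * of_real pi * \<i> * g z) / \<i>) {0..2*pi}"
    by (rule has_integral_divide)
  also have "(\<lambda>t. (g (0 + r * cis t) / (0 + r * cis t - z) * r * \<i> * cis t) / \<i>) = 
      (\<lambda>t. g (of_real r * cis t) * inverse (1 - z * cis (- t) / of_real r))"
  proof (rule ext)
    fix t
    have ne: "of_real r * cis t - z \<noteq> 0"
    proof
      assume "of_real r * cis t - z = 0"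
      then have "cmod z = cmod (of_real r * cis t)" by simp
      also have "\<dots> = r" using r by (simp add: norm_mult)
      finally show False using z by simp
    qed
    have "1 - z * cis (- t) / of_real r = (of_real r * cis t - z) / (of_real r * cis t)"
    proof -
      obtain c where c: "cis t = c" "c \<noteq> 0" using cis_neq_zero by blast
      have "cis (- t) = inverse c" using c cis_inverse by metis
      then show ?thesis using c r by (simp add: field_simps)
    qed
    then show "(g (0 + r * cis t) / (0 + r * cis t - z) * r * \<i> * cis t) / \<i> = g (of_real r * cis t) * inverse (1 - z * cis (- t) / of_real r)"
      using ne by (simp add: mult_ac)
  qed
  finally show ?thesis by (simp add: integral_unique)
qed

section \<open>The Cauchy formula on the polydisc\<close>

definition torus_point :: "real \<Rightarrow> real^'n \<Rightarrow> complex^'n" where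
  "torus_point r \<theta> = (\<chi> k. of_real r * cis (\<theta> $ k))"

lemma torus_point_nth: "torus_point r \<theta> $ k = of_real r * cis (\<theta> $ k)"
  by (simp add: torus_point_def)

lemma continuous_torus_point: "continuous_on S (torus_point r)"
  unfolding torus_point_def by (intro continuous_intros continuous_on_vec_lambda)

lemma torus_point_polydisc: "0 \<le> r \<Longrightarrow> r < R \<Longrightarrow> torus_point r \<theta> \<in> polydisc R"
  by (simp add: polydisc_def torus_point_nth norm_mult)

lemma continuous_torus_point_comp:
  assumes "continuous_on \<D> f" "0 \<le> r" "r < 1"
  shows "continuous_on S (\<lambda>\<theta>. f (torus_point r \<theta>))"
  by (rule continuous_on_compose2[OF assms(1) continuous_torus_point])
    (use assms torus_point_polydisc in auto)

text \<open>Interpolates between the centre (\<open>S = {}\<close>) and a point of the torus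
  (\<open>S = UNIV\<close>).\<close>

definition merge_coords :: "'n set \<Rightarrow> complex^'n \<Rightarrow> complex^'n \<Rightarrow> complex^'n" where
  "merge_coords S z w = (\<chi> k. if k \<in> S then w $ k else z $ k)"

lemma merge_coords_nth: "merge_coords S z w $ k = (if k \<in> S then w $ k else z $ k)"
  by (simp add: merge_coords_def)

lemma cauchy_kernel_denom:
  assumes "0 < r" "cmod z < r"
  shows "1 - z * cis (- s) / of_real r \<noteq> 0"
proof
  assume "1 - z * cis (- s) / of_real r = 0"
  then have "cmod (z * cis (- s) / of_real r) = 1" by (metis norm_one right_minus_eq)
  then show False using assms by (simp add: norm_mult norm_divide)
qed

text \<open>Induction over the variables already moved to the torus: the mean over the new angle is
  a one-variable Cauchy integral, which returns the value with that variable still at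
  \<open>z\<close>.\<close>

lemma torus_cauchy_partial:
  fixes f :: "complex^'n \<Rightarrow> complex"
  assumes f: "holo_on f \<D>" and r: "0 < r" "r < 1" and z: "z \<in> polydisc r" and S: "finite S"
  shows "f z = torus_avg (\<lambda>\<theta>. f (merge_coords S z (torus_point r \<theta>)) *
            (\<Prod>k\<in>S. inverse (1 - z $ k * cis (- (\<theta> $ k)) / of_real r)))"
  using S
proof (induction S rule: finite_induct)
  case empty
  have "merge_coords {} z w = z" for w by (simp add: merge_coords_def vec_eq_iff)
  then show ?case by simp
next
  case (insert k S)
  define K where "K = (\<lambda>S \<theta>. \<Prod>k\<in>S. inverse (1 - z $ k * cis (- (\<theta> $ k)) / of_real r))"
  define G where "G = (\<lambda>\<theta>. f (merge_coords (insert k S) z (torus_point r \<theta>)) * K (insert k S) \<theta>)"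
  have zk: "cmod (z $ i) < r" "cmod (z $ i) < 1" for i
    using z r by (auto simp: polydisc_def intro: less_trans)
  have inD: "merge_coords T z (torus_point r \<theta>) \<in> \<D>" for T \<theta>
    using zk r by (auto simp: polydisc_def merge_coords_nth torus_point_nth norm_mult)
  have contK: "continuous_on tbox (K T)" for T
    unfolding K_def using cauchy_kernel_denom[OF r(1) zk(1)] r(1)
    by (intro continuous_intros) auto
  have contm: "continuous_on tbox (\<lambda>\<theta>. merge_coords T z (torus_point r \<theta>))" for T
    unfolding merge_coords_def torus_point_def
    apply (intro continuous_on_vec_lambda)
    subgoal for i by (cases "i \<in> T") (auto intro!: continuous_intros)
    done
  have contG: "continuous_on tbox G"
    unfolding G_def
    by (intro continuous_intros contK continuous_on_compose2[OF holo_on_continuous_on[OF f] contm])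
      (use inD in auto)
  have upd: "merge_coords (insert k S) z (torus_point r (coord_upd \<theta> k s)) =
      coord_upd (merge_coords S z (torus_point r \<theta>)) k (of_real r * cis s)" for \<theta> s
    by (simp add: vec_eq_iff merge_coords_nth coord_upd_nth torus_point_nth)
  have Kupd: "K (insert k S) (coord_upd \<theta> k s) = inverse (1 - z $ k * cis (- s) / of_real r) * K S \<theta>" for \<theta> s
  proof -
    have "K (insert k S) (coord_upd \<theta> k s) = inverse (1 - z $ k * cis (- s) / of_real r) *
        (\<Prod>j\<in>S. inverse (1 - z $ j * cis (- (coord_upd \<theta> k s $ j)) / of_real r))"
      unfolding K_def using insert.hyps by (simp add: coord_upd_nth)
    also have "(\<Prod>j\<in>S. inverse (1 - z $ j * cis (- (coord_upd \<theta> k s $ j)) / of_real r)) = K S \<theta>"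
      unfolding K_def using insert.hyps by (intro prod.cong) (auto simp: coord_upd_nth)
    finally show ?thesis .
  qed
  have "integral {0..2*pi} (\<lambda>s. G (coord_upd \<theta> k s)) / (2 * pi) =
      f (merge_coords S z (torus_point r \<theta>)) * K S \<theta>" for \<theta>
  proof -
    let ?m = "merge_coords S z (torus_point r \<theta>)"
    have "(\<lambda>w. f (coord_upd ?m k w)) holomorphic_on ball 0 1"
      using inD[of S \<theta>] by (intro holo_slice[OF f]) (auto simp: polydisc_def)
    from circle_cauchy[OF this r zk(1)[of k]]
    have "integral {0..2*pi} (\<lambda>s. f (coord_upd ?m k (of_real r * cis s)) * inverse (1 - z $ k * cis (- s) / of_real r))
        = 2 * pi * f (coord_upd ?m k (z $ k))" .
    moreover have "coord_upd ?m k (z $ k) = ?m"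
      using insert.hyps by (simp add: vec_eq_iff coord_upd_nth merge_coords_nth)
    moreover have "(\<lambda>s. G (coord_upd \<theta> k s)) = (\<lambda>s. f (coord_upd ?m k (of_real r * cis s)) * inverse (1 - z $ k * cis (- s) / of_real r) * K S \<theta>)"
      unfolding G_def upd Kupd by (simp add: mult.assoc)
    ultimately show ?thesis by simp
  qed
  then have "torus_avg G = torus_avg (\<lambda>\<theta>. f (merge_coords S z (torus_point r \<theta>)) * K S \<theta>)"
    by (subst torus_avg_coord[OF contG, of k]) simp
  then show ?case using insert.IH unfolding G_def K_def by simp
qed

lemma torus_cauchy:
  fixes f :: "complex^'n \<Rightarrow> complex"
  assumes f: "holo_on f \<D>" and r: "0 < r" "r < 1" and z: "z \<in> polydisc r"
  shows "f z = torus_avg (\<lambda>\<theta>. f (torus_point r \<theta>) *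
            (\<Prod>k\<in>UNIV. inverse (1 - z $ k * cis (- (\<theta> $ k)) / of_real r)))"
proof -
  have "merge_coords UNIV z w = w" for w by (simp add: merge_coords_def vec_eq_iff)
  then show ?thesis using torus_cauchy_partial[OF f r z, of UNIV] by simp
qed

section \<open>Power series\<close>

definition vmono :: "complex^'n \<Rightarrow> ('n \<Rightarrow> nat) \<Rightarrow> complex" where
  "vmono z \<alpha> = (\<Prod>k\<in>UNIV. (z $ k) ^ \<alpha> k)"

definition deg :: "('n::finite \<Rightarrow> nat) \<Rightarrow> nat" where "deg \<alpha> = (\<Sum>k\<in>UNIV. \<alpha> k)"

text \<open>A finite set of exponents lies in a cube, and over a cube the sum is a product of
  one-variable partial sums.\<close>

lemma multi_geometric_summable:
  fixes q :: "'n::finite \<Rightarrow> real"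
  assumes q: "\<And>k. 0 \<le> q k" "\<And>k. q k < 1"
  shows "(\<lambda>\<alpha>. \<Prod>k\<in>UNIV. q k ^ \<alpha> k) summable_on UNIV"
proof (rule nonneg_bounded_partial_sums_imp_summable_on)
  show "0 \<le> (\<Prod>k\<in>UNIV. q k ^ \<alpha> k)" for \<alpha> by (intro prod_nonneg) (use q in auto)
  show "\<forall>\<^sub>F X in finite_subsets_at_top UNIV. (\<Sum>\<alpha>\<in>X. \<Prod>k\<in>UNIV. q k ^ \<alpha> k) \<le> (\<Prod>k\<in>UNIV. inverse (1 - q k))"
  proof (rule eventually_finite_subsets_at_top_weakI)
    fix X :: "('n \<Rightarrow> nat) set" assume X: "finite X"
    define N where "N = Max (insert 0 ((\<lambda>(\<alpha>, k). \<alpha> k) ` (X \<times> UNIV)))"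
    have "\<alpha> k \<le> N" if "\<alpha> \<in> X" for \<alpha> k
      unfolding N_def using that X by (intro Max_ge) force+
    then have sub: "X \<subseteq> PiE UNIV (\<lambda>_. {..N})" by auto
    have "(\<Sum>\<alpha>\<in>X. \<Prod>k\<in>UNIV. q k ^ \<alpha> k) \<le> (\<Sum>\<alpha>\<in>PiE UNIV (\<lambda>_. {..N}). \<Prod>k\<in>UNIV. q k ^ \<alpha> k)"
      using sub by (intro sum_mono2 finite_PiE prod_nonneg) (use q in auto)
    also have "\<dots> = (\<Prod>k\<in>UNIV. \<Sum>m\<le>N. q k ^ m)"
      by (rule prod_sum_PiE[symmetric]) auto
    also have "\<dots> \<le> (\<Prod>k\<in>UNIV. inverse (1 - q k))"
    proof (rule prod_mono, intro conjI)
      fix k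
      show "0 \<le> (\<Sum>m\<le>N. q k ^ m)" using q by (intro sum_nonneg) auto
      have sm: "summable (\<lambda>m. q k ^ m)" using q[of k] by (intro summable_geometric) auto
      have "(\<Sum>m\<le>N. q k ^ m) \<le> (\<Sum>m. q k ^ m)"
        by (rule sum_le_suminf[OF sm]) (use q in auto)
      also have "\<dots> = inverse (1 - q k)"
        using suminf_geometric[of "q k"] q[of k] by (simp add: inverse_eq_divide)
      finally show "(\<Sum>m\<le>N. q k ^ m) \<le> inverse (1 - q k)" .
    qed
    finally show "(\<Sum>\<alpha>\<in>X. \<Prod>k\<in>UNIV. q k ^ \<alpha> k) \<le> (\<Prod>k\<in>UNIV. inverse (1 - q k))" .
  qed
qed

lemma multi_geometric_has_sum:
  fixes q :: "'n::finite \<Rightarrow> complex"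
  assumes q: "\<And>k. norm (q k) < 1"
  shows "((\<lambda>\<alpha>. \<Prod>k\<in>UNIV. q k ^ \<alpha> k) has_sum (\<Prod>k\<in>UNIV. inverse (1 - q k))) UNIV"
proof -
  have sm: "summable (\<lambda>m. norm (q k ^ m))" for k
    using summable_geometric[of "norm (q k)"] q[of k] by (simp add: norm_power)
  have abs: "(\<lambda>m. norm (q k ^ m)) summable_on UNIV" for k
    by (rule norm_summable_imp_summable_on) (use sm[of k] in simp)
  have one: "infsum (\<lambda>m. q k ^ m) UNIV = inverse (1 - q k)" for k
    using norm_summable_imp_has_sum[OF sm geometric_sums[OF q[of k]]]
    by (intro infsumI) (auto simp: inverse_eq_divide)
  have U: "PiE UNIV (\<lambda>_. UNIV) = (UNIV :: ('n \<Rightarrow> nat) set)" by auto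
  have "infsum (\<lambda>\<alpha>. \<Prod>k\<in>UNIV. q k ^ \<alpha> k) (PiE UNIV (\<lambda>_. UNIV)) = (\<Prod>k\<in>UNIV. infsum (\<lambda>m. q k ^ m) UNIV)"
    by (rule infsum_prod_PiE_abs) (use abs in auto)
  then have "infsum (\<lambda>\<alpha>. \<Prod>k\<in>UNIV. q k ^ \<alpha> k) UNIV = (\<Prod>k\<in>UNIV. inverse (1 - q k))"
    unfolding U one .
  moreover have "(\<lambda>\<alpha>. \<Prod>k\<in>UNIV. q k ^ \<alpha> k) summable_on UNIV"
    by (rule abs_summable_summable)
      (use multi_geometric_summable[of "\<lambda>k. norm (q k)"] q in \<open>simp add: norm_power prod_norm[symmetric]\<close>)
  ultimately show ?thesis by (metis has_sum_infsum)
qed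

lemma norm_vmono: "cmod (vmono z \<alpha>) = (\<Prod>k\<in>UNIV. cmod (z $ k) ^ \<alpha> k)"
  by (simp add: vmono_def prod_norm[symmetric] norm_power)

lemma norm_vmono_le: "(\<And>k. cmod (z $ k) \<le> r) \<Longrightarrow> cmod (vmono z \<alpha>) \<le> r ^ deg \<alpha>"
  unfolding norm_vmono deg_def power_sum by (intro prod_mono) (auto intro: power_mono)

lemma vmono_torus: "vmono (torus_point r \<theta>) \<alpha> = of_real (r ^ deg \<alpha>) * (\<Prod>k\<in>UNIV. cis (real (\<alpha> k) * \<theta> $ k))"
  by (simp add: vmono_def torus_point_nth power_mult_distrib prod.distrib deg_def power_sum Complex.DeMoivre)

definition torus_char :: "('n \<Rightarrow> nat) \<Rightarrow> real^'n \<Rightarrow> complex" where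
  "torus_char \<alpha> \<theta> = (\<Prod>k\<in>UNIV. cis (real (\<alpha> k) * \<theta> $ k))"

lemma continuous_torus_char: "continuous_on S (torus_char \<alpha>)"
  unfolding torus_char_def by (intro continuous_intros)

lemma norm_torus_char [simp]: "cmod (torus_char \<alpha> \<theta>) = 1"
  by (simp add: torus_char_def prod_norm[symmetric])

text \<open>If the exponents differ at \<open>k\<close>, averaging over the \<open>k\<close>-th
  angle alone already gives 0, because \<open>cis (m * s)\<close> with a nonzero integer
  \<open>m\<close> integrates to 0 over a period.\<close>

lemma torus_orthonormal:
  "torus_avg (\<lambda>\<theta>::real^'n. torus_char \<alpha> \<theta> * cnj (torus_char \<beta> \<theta>)) = (if \<alpha> = \<beta> then 1 else 0)"
proof (cases "\<alpha> = \<beta>")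
  case True
  have "torus_char \<beta> \<theta> * cnj (torus_char \<beta> \<theta>) = 1" for \<theta>
    using complex_norm_square[of "torus_char \<beta> \<theta>"] by simp
  then show ?thesis using True by simp
next
  case False
  then obtain k where k: "\<alpha> k \<noteq> \<beta> k" by blast
  define m where "m = real (\<alpha> k) - real (\<beta> k)"
  have m: "m \<noteq> 0" using k by (simp add: m_def)
  define P where "P = (\<lambda>\<theta>::real^'n. \<Prod>j\<in>UNIV - {k}. cis ((real (\<alpha> j) - real (\<beta> j)) * \<theta> $ j))"
  have eq: "torus_char \<alpha> \<theta> * cnj (torus_char \<beta> \<theta>) = cis (m * \<theta> $ k) * P \<theta>" for \<theta>
  proof -
    have "torus_char \<alpha> \<theta> * cnj (torus_char \<beta> \<theta>) = (\<Prod>j\<in>UNIV. cis ((real (\<alpha> j) - real (\<beta> j)) * \<theta> $ j))"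
      unfolding torus_char_def cnj_prod prod.distrib[symmetric]
      by (simp add: cis_cnj cis_mult left_diff_distrib)
    then show ?thesis unfolding P_def m_def
      by (subst (asm) prod.remove[of _ k]) auto
  qed
  have Pu: "P (coord_upd \<theta> k s) = P \<theta>" for \<theta> s
    unfolding P_def by (intro prod.cong) (auto simp: coord_upd_nth)
  have int0: "((\<lambda>s. cis (m * s)) has_integral 0) {0..2*pi}"
  proof -
    have "((\<lambda>s. cis (m * s)) has_integral (cis (m * (2*pi)) / (\<i> * m) - cis (m * 0) / (\<i> * m))) {0..2*pi}"
    proof (rule fundamental_theorem_of_calculus)
      fix s assume "s \<in> {0..2*pi}"
      have "((\<lambda>s. exp (\<i> * of_real (m * s)) / (\<i> * m)) has_vector_derivative exp (\<i> * of_real (m * s))) (at s within {0..2*pi})"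
        using m by (auto intro!: derivative_eq_intros has_vector_derivative_real_field
            simp: field_simps scaleR_conv_of_real)
      then show "((\<lambda>s. cis (m * s) / (\<i> * m)) has_vector_derivative cis (m * s)) (at s within {0..2*pi})"
        by (simp add: cis_conv_exp)
    qed simp
    moreover have "cis (m * (2*pi)) = 1"
    proof -
      have "cis (2 * pi * of_int (int (\<alpha> k) - int (\<beta> k))) = 1" by (rule cis_multiple_2pi) simp
      then show ?thesis by (simp add: m_def mult_ac)
    qed
    ultimately show ?thesis by simp
  qed
  have "continuous_on tbox (\<lambda>\<theta>. torus_char \<alpha> \<theta> * cnj (torus_char \<beta> \<theta>))"
    by (intro continuous_intros continuous_torus_char)
  then have "torus_avg (\<lambda>\<theta>. torus_char \<alpha> \<theta> * cnj (torus_char \<beta> \<theta>)) = 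
      torus_avg (\<lambda>\<theta>. integral {0..2*pi} (\<lambda>s. cis (m * s) * P \<theta>) / (2*pi))"
    by (subst torus_avg_coord[where k=k]) (simp_all add: eq Pu coord_upd_nth)
  also have "\<dots> = 0" by (simp add: integral_unique[OF int0])
  finally show ?thesis using False by simp
qed

section \<open>Expansion of holomorphic functions and uniqueness of the coefficients\<close>

lemma vmono_continuous: "continuous_on S (\<lambda>z. vmono z \<alpha>)"
  unfolding vmono_def by (intro continuous_intros)

text \<open>The series is evaluated at the point with all coordinates \<open>r\<close>, where the
  monomial has modulus \<open>r ^ deg \<alpha>\<close>; unconditional and absolute summability agree
  in the complex numbers.\<close>

lemma power_series_abs_summable:
  fixes a :: "('n::finite \<Rightarrow> nat) \<Rightarrow> complex"
  assumes sum: "\<And>z. z \<in> polydisc R \<Longrightarrow> ((\<lambda>\<alpha>. a \<alpha> * vmono z \<alpha>) has_sum f z) UNIV" and r: "0 \<le> r" "r < R"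
  shows "(\<lambda>\<alpha>. cmod (a \<alpha>) * r ^ deg \<alpha>) summable_on UNIV"
proof -
  have "(\<chi> k. of_real r) \<in> (polydisc R :: (complex^'n) set)" using r by (simp add: polydisc_def)
  from sum[OF this] have "(\<lambda>\<alpha>. a \<alpha> * vmono (\<chi> k. of_real r) \<alpha>) summable_on UNIV"
    by (auto simp: summable_on_def)
  then have "(\<lambda>\<alpha>. norm (a \<alpha> * vmono (\<chi> k. of_real r) \<alpha>)) summable_on UNIV"
    by (rule iffD1[OF summable_on_iff_abs_summable_on_complex])
  moreover have "norm (a \<alpha> * vmono (\<chi> k. of_real r) \<alpha>) = cmod (a \<alpha>) * r ^ deg \<alpha>" for \<alpha>
    using r by (simp add: norm_mult norm_vmono deg_def power_sum)
  ultimately show ?thesis by simp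
qed

text \<open>Termwise integration against a character leaves one term. \<open>R\<close> is kept free
  because the expansions are first obtained on polydiscs smaller than the unit one.\<close>

lemma power_series_coeff:
  fixes a :: "('n::finite \<Rightarrow> nat) \<Rightarrow> complex"
  assumes cont: "continuous_on (polydisc R) f" and r: "0 < r" "r < R"
    and sum: "\<And>z. z \<in> polydisc R \<Longrightarrow> ((\<lambda>\<alpha>. a \<alpha> * vmono z \<alpha>) has_sum f z) UNIV"
  shows "torus_avg (\<lambda>\<theta>. f (torus_point r \<theta>) * cnj (torus_char \<beta> \<theta>)) = a \<beta> * of_real (r ^ deg \<beta>)"
proof -
  have tp: "torus_point r \<theta> \<in> polydisc R" for \<theta> :: "real^'n" using r by (simp add: torus_point_polydisc)
  have "((\<lambda>\<alpha>. torus_avg (\<lambda>\<theta>. (a \<alpha> * of_real (r ^ deg \<alpha>)) * (torus_char \<alpha> \<theta> * cnj (torus_char \<beta> \<theta>)))) has_sum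
      torus_avg (\<lambda>\<theta>. f (torus_point r \<theta>) * cnj (torus_char \<beta> \<theta>))) UNIV"
  proof (rule torus_avg_has_sum)
    show "continuous_on tbox (\<lambda>\<theta>. (a \<alpha> * of_real (r ^ deg \<alpha>)) * (torus_char \<alpha> \<theta> * cnj (torus_char \<beta> \<theta>)))" for \<alpha>
      by (intro continuous_intros continuous_torus_char)
    show "continuous_on tbox (\<lambda>\<theta>. f (torus_point r \<theta>) * cnj (torus_char \<beta> \<theta>))"
      by (intro continuous_intros continuous_torus_char continuous_on_compose2[OF cont continuous_torus_point])
        (use tp in auto)
    show "norm ((a \<alpha> * of_real (r ^ deg \<alpha>)) * (torus_char \<alpha> \<theta> * cnj (torus_char \<beta> \<theta>))) \<le> cmod (a \<alpha>) * r ^ deg \<alpha>" for \<alpha> \<theta>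
      using r by (simp add: norm_mult norm_power)
    show "(\<lambda>\<alpha>. cmod (a \<alpha>) * r ^ deg \<alpha>) summable_on UNIV"
      using power_series_abs_summable[OF sum] r by auto
    show "((\<lambda>\<alpha>. (a \<alpha> * of_real (r ^ deg \<alpha>)) * (torus_char \<alpha> \<theta> * cnj (torus_char \<beta> \<theta>))) has_sum
        f (torus_point r \<theta>) * cnj (torus_char \<beta> \<theta>)) UNIV" for \<theta>
      using has_sum_cmult_left[OF sum[OF tp[of \<theta>]], where c = "cnj (torus_char \<beta> \<theta>)"]
      by (simp add: vmono_torus torus_char_def mult_ac)
  qed
  moreover have "torus_avg (\<lambda>\<theta>::real^'n. (a \<alpha> * of_real (r ^ deg \<alpha>)) * (torus_char \<alpha> \<theta> * cnj (torus_char \<beta> \<theta>))) =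
      (if \<alpha> = \<beta> then a \<beta> * of_real (r ^ deg \<beta>) else 0)" for \<alpha>
    by (subst torus_avg_cmult) (auto intro!: continuous_intros continuous_torus_char simp: torus_orthonormal)
  ultimately have "((\<lambda>\<alpha>. if \<alpha> = \<beta> then a \<beta> * of_real (r ^ deg \<beta>) else 0) has_sum
      torus_avg (\<lambda>\<theta>. f (torus_point r \<theta>) * cnj (torus_char \<beta> \<theta>))) UNIV" by simp
  moreover have "((\<lambda>\<alpha>. if \<alpha> = \<beta> then a \<beta> * of_real (r ^ deg \<beta>) else 0) has_sum a \<beta> * of_real (r ^ deg \<beta>)) UNIV"
    by (rule has_sum_finite_neutralI[of "{\<beta>}"]) auto
  ultimately show ?thesis by (rule has_sum_unique)
qed

text \<open>The Cauchy kernel is expanded into a multiple geometric series under the mean. At this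
  stage the coefficients may still depend on \<open>r\<close>.\<close>

lemma holo_power_series_local:
  fixes f :: "complex^'n \<Rightarrow> complex"
  assumes f: "holo_on f \<D>" and r: "0 < r" "r < 1" and z: "z \<in> polydisc r"
  shows "((\<lambda>\<alpha>. torus_avg (\<lambda>\<theta>. f (torus_point r \<theta>) * cnj (torus_char \<alpha> \<theta>)) / of_real (r ^ deg \<alpha>) * vmono z \<alpha>)
     has_sum f z) UNIV"
proof -
  have tp: "torus_point r \<theta> \<in> \<D>" for \<theta> :: "real^'n" using r by (simp add: torus_point_polydisc)
  have cf: "continuous_on tbox (\<lambda>\<theta>. f (torus_point r \<theta>))"
    by (rule continuous_torus_point_comp[OF holo_on_continuous_on[OF f]]) (use r in auto)
  have zk: "cmod (z $ k) < r" for k using z by (simp add: polydisc_def)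
  obtain M where M: "\<And>\<theta>. \<theta> \<in> tbox \<Longrightarrow> cmod (f (torus_point r \<theta>)) \<le> M"
    using compact_imp_bounded[OF compact_continuous_image[OF cf compact_cbox]]
    unfolding bounded_iff by auto
  define K where "K = (\<lambda>\<theta>. \<Prod>k\<in>UNIV. inverse (1 - z $ k * cis (- (\<theta> $ k)) / of_real r))"
  define T where "T = (\<lambda>\<alpha> \<theta>. \<Prod>k\<in>UNIV. (z $ k * cis (- (\<theta> $ k)) / of_real r) ^ \<alpha> k)"
  have T_eq: "T \<alpha> \<theta> = vmono z \<alpha> / of_real (r ^ deg \<alpha>) * cnj (torus_char \<alpha> \<theta>)" for \<alpha> \<theta>
    unfolding T_def vmono_def torus_char_def
    by (simp add: power_mult_distrib power_divide prod.distrib prod_dividef deg_def power_sum Complex.DeMoivre cis_cnj)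
  have normT: "cmod (T \<alpha> \<theta>) = (\<Prod>k\<in>UNIV. (cmod (z $ k) / r) ^ \<alpha> k)" for \<alpha> \<theta>
    using r by (simp add: T_def prod_norm[symmetric] norm_power norm_mult norm_divide)
  have q: "0 \<le> cmod (z $ k) / r" "cmod (z $ k) / r < 1" for k using zk r by auto
  have "((\<lambda>\<alpha>. torus_avg (\<lambda>\<theta>. f (torus_point r \<theta>) * T \<alpha> \<theta>)) has_sum
      torus_avg (\<lambda>\<theta>. f (torus_point r \<theta>) * K \<theta>)) UNIV"
  proof (rule torus_avg_has_sum)
    show "continuous_on tbox (\<lambda>\<theta>. f (torus_point r \<theta>) * T \<alpha> \<theta>)" for \<alpha>
      unfolding T_eq by (intro continuous_intros cf continuous_torus_char)
    show "continuous_on tbox (\<lambda>\<theta>. f (torus_point r \<theta>) * K \<theta>)"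
      unfolding K_def using cauchy_kernel_denom[OF r(1) zk] r(1)
      by (intro continuous_intros cf) auto
    show "norm (f (torus_point r \<theta>) * T \<alpha> \<theta>) \<le> M * (\<Prod>k\<in>UNIV. (cmod (z $ k) / r) ^ \<alpha> k)" if "\<theta> \<in> tbox" for \<alpha> \<theta>
      unfolding norm_mult normT using M[OF that] q by (intro mult_right_mono prod_nonneg) auto
    show "(\<lambda>\<alpha>. M * (\<Prod>k\<in>UNIV. (cmod (z $ k) / r) ^ \<alpha> k)) summable_on UNIV"
      by (intro summable_on_cmult_right multi_geometric_summable q)
    show "((\<lambda>\<alpha>. f (torus_point r \<theta>) * T \<alpha> \<theta>) has_sum f (torus_point r \<theta>) * K \<theta>) UNIV" for \<theta>
      unfolding T_def K_def
      by (intro has_sum_cmult_right multi_geometric_has_sum)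
        (use q r in \<open>simp add: norm_mult norm_divide\<close>)
  qed
  also have "torus_avg (\<lambda>\<theta>. f (torus_point r \<theta>) * K \<theta>) = f z"
    unfolding K_def by (rule torus_cauchy[OF f r z, symmetric])
  also have "(\<lambda>\<alpha>. torus_avg (\<lambda>\<theta>. f (torus_point r \<theta>) * T \<alpha> \<theta>)) =
      (\<lambda>\<alpha>. torus_avg (\<lambda>\<theta>. f (torus_point r \<theta>) * cnj (torus_char \<alpha> \<theta>)) / of_real (r ^ deg \<alpha>) * vmono z \<alpha>)"
  proof (rule ext)
    fix \<alpha>
    have "torus_avg (\<lambda>\<theta>. f (torus_point r \<theta>) * T \<alpha> \<theta>) =
        torus_avg (\<lambda>\<theta>. vmono z \<alpha> / of_real (r ^ deg \<alpha>) * (f (torus_point r \<theta>) * cnj (torus_char \<alpha> \<theta>)))"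
      unfolding T_eq by (simp add: mult_ac)
    also have "\<dots> = vmono z \<alpha> / of_real (r ^ deg \<alpha>) * torus_avg (\<lambda>\<theta>. f (torus_point r \<theta>) * cnj (torus_char \<alpha> \<theta>))"
      by (intro torus_avg_cmult continuous_intros cf continuous_torus_char)
    finally show "torus_avg (\<lambda>\<theta>. f (torus_point r \<theta>) * T \<alpha> \<theta>) =
        torus_avg (\<lambda>\<theta>. f (torus_point r \<theta>) * cnj (torus_char \<alpha> \<theta>)) / of_real (r ^ deg \<alpha>) * vmono z \<alpha>" by simp
  qed
  finally show ?thesis .
qed

lemma polydisc_between:
  assumes "z \<in> polydisc (1::real)"
  obtains r where "1/2 \<le> r" "r < 1" "z \<in> polydisc r"
proof -
  define m where "m = Max (range (\<lambda>k. cmod (z $ k)))"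
  have m: "cmod (z $ k) \<le> m" for k unfolding m_def by (rule Max_ge) auto
  have "m \<in> range (\<lambda>k. cmod (z $ k))" unfolding m_def by (rule Max_in) auto
  then have "m < 1" using assms by (auto simp: polydisc_def)
  then obtain r where "max (1/2) m < r" "r < 1" using dense[of "max (1/2) m" 1] by auto
  with m that[of r] show ?thesis by (auto simp: polydisc_def intro: le_less_trans)
qed

text \<open>The coefficients are recovered from means over the torus of radius 1/2, so the
  description in \<open>taylor\<close> determines them. All later computations of
  \<open>taylor\<close> for concrete functions pass through this rule.\<close>

lemma taylor_eqI:
  assumes cont: "continuous_on \<D> f"
    and sum: "\<And>z. z \<in> \<D> \<Longrightarrow> ((\<lambda>\<alpha>. a \<alpha> * vmono z \<alpha>) has_sum f z) UNIV"
  shows "taylor f = a"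
  unfolding taylor_def vmono_def[symmetric]
proof (rule the_equality)
  show "\<forall>z\<in>\<D>. ((\<lambda>\<alpha>. a \<alpha> * vmono z \<alpha>) has_sum f z) UNIV" using sum by blast
next
  fix b assume b: "\<forall>z\<in>\<D>. ((\<lambda>\<alpha>. b \<alpha> * vmono z \<alpha>) has_sum f z) UNIV"
  show "b = a"
  proof (rule ext)
    fix \<beta>
    have "b \<beta> * of_real ((1/2) ^ deg \<beta>) = a \<beta> * of_real ((1/2) ^ deg \<beta>)"
      using power_series_coeff[OF cont, of "1/2" a \<beta>] power_series_coeff[OF cont, of "1/2" b \<beta>] sum b by simp
    then show "b \<beta> = a \<beta>" by simp
  qed
qed

text \<open>The coefficients obtained at a radius \<open>r \<ge> 1/2\<close> and at 1/2 both
  describe the mean over the torus of radius 1/4, which lies inside both polydiscs; hence they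
  coincide, and one family serves the whole of \<open>\<D>\<close>.\<close>

lemma holo_power_series:
  assumes f: "holo_on f \<D>"
  obtains a where "\<And>z. z \<in> \<D> \<Longrightarrow> ((\<lambda>\<alpha>. a \<alpha> * vmono z \<alpha>) has_sum f z) UNIV"
proof -
  define c where "c = (\<lambda>r \<alpha>. torus_avg (\<lambda>\<theta>. f (torus_point r \<theta>) * cnj (torus_char \<alpha> \<theta>)) / of_real (r ^ deg \<alpha>))"
  have loc: "((\<lambda>\<alpha>. c r \<alpha> * vmono z \<alpha>) has_sum f z) UNIV" if "0 < r" "r < 1" "z \<in> polydisc r" for r z
    unfolding c_def by (rule holo_power_series_local[OF f that])
  have cont: "continuous_on (polydisc r) f" if "r \<le> 1" for r
    using continuous_on_subset[OF holo_on_continuous_on[OF f] polydisc_mono[OF that]] .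
  have "c r = c (1/2)" if r: "1/2 \<le> r" "r < 1" for r
  proof (rule ext)
    fix \<alpha>
    have "c r \<alpha> * of_real ((1/4) ^ deg \<alpha>) = torus_avg (\<lambda>\<theta>. f (torus_point (1/4) \<theta>) * cnj (torus_char \<alpha> \<theta>))"
      using power_series_coeff[OF cont[of r], of "1/4" "c r" \<alpha>] loc r by simp
    also have "\<dots> = c (1/2) \<alpha> * of_real ((1/4) ^ deg \<alpha>)"
      using power_series_coeff[OF cont[of "1/2"], of "1/4" "c (1/2)" \<alpha>] loc by simp
    finally show "c r \<alpha> = c (1/2) \<alpha>" by simp
  qed
  then have "((\<lambda>\<alpha>. c (1/2) \<alpha> * vmono z \<alpha>) has_sum f z) UNIV" if z: "z \<in> \<D>" for z
    using polydisc_between[OF z] loc by (metis less_le_trans half_gt_zero_iff zero_less_one)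
  then show ?thesis using that by blast
qed

lemma taylor_has_sum:
  assumes f: "holo_on f \<D>" and z: "z \<in> \<D>"
  shows "((\<lambda>\<alpha>. taylor f \<alpha> * vmono z \<alpha>) has_sum f z) UNIV"
proof -
  obtain a where a: "\<And>z. z \<in> \<D> \<Longrightarrow> ((\<lambda>\<alpha>. a \<alpha> * vmono z \<alpha>) has_sum f z) UNIV"
    using holo_power_series[OF f] by blast
  then show ?thesis using taylor_eqI[OF holo_on_continuous_on[OF f] a] z by simp
qed

lemma taylor_torus_avg:
  assumes f: "holo_on f \<D>" and r: "0 < r" "r < 1"
  shows "torus_avg (\<lambda>\<theta>. f (torus_point r \<theta>) * cnj (torus_char \<alpha> \<theta>)) = taylor f \<alpha> * of_real (r ^ deg \<alpha>)"
  by (rule power_series_coeff[OF holo_on_continuous_on[OF f] r taylor_has_sum[OF f]])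

lemma taylor_cauchy_estimate:
  assumes f: "holo_on f \<D>" and r: "0 < r" "r < 1"
    and M: "\<And>z. (\<And>k. cmod (z $ k) = r) \<Longrightarrow> cmod (f z) \<le> M"
  shows "cmod (taylor f \<alpha>) * r ^ deg \<alpha> \<le> M"
proof -
  have "cmod (torus_avg (\<lambda>\<theta>. f (torus_point r \<theta>) * cnj (torus_char \<alpha> \<theta>))) \<le> M"
    by (intro torus_avg_norm_le continuous_intros continuous_torus_char
        continuous_torus_point_comp[OF holo_on_continuous_on[OF f]])
      (use r M in \<open>auto simp: norm_mult torus_point_nth\<close>)
  then show ?thesis
    unfolding taylor_torus_avg[OF f r] using r by (simp add: norm_mult norm_power)
qed

lemma taylor_cmult:
  assumes "holo_on f \<D>"
  shows "taylor (\<lambda>z. c * f z) = (\<lambda>\<alpha>. c * taylor f \<alpha>)"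
  by (rule taylor_eqI)
    (use assms holo_on_continuous_on taylor_has_sum in
      \<open>auto intro!: continuous_on_mult_left has_sum_cmult_right simp: mult.assoc\<close>)

lemma taylor_diff:
  assumes f: "holo_on f \<D>" and g: "holo_on g \<D>"
  shows "taylor (\<lambda>z. f z - g z) = (\<lambda>\<alpha>. taylor f \<alpha> - taylor g \<alpha>)"
proof (rule taylor_eqI)
  show "continuous_on \<D> (\<lambda>z. f z - g z)"
    using assms holo_on_continuous_on by (auto intro: continuous_on_diff)
  fix z assume z: "z \<in> (\<D> :: (complex^'a) set)"
  show "((\<lambda>\<alpha>. (taylor f \<alpha> - taylor g \<alpha>) * vmono z \<alpha>) has_sum f z - g z) UNIV"
    using has_sum_add[OF taylor_has_sum[OF f z] has_sum_cmult_right[OF taylor_has_sum[OF g z], where c = "-1"]]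
    by (simp add: left_diff_distrib)
qed

lemma taylor_cong:
  assumes "\<And>z. z \<in> \<D> \<Longrightarrow> f z = g z"
  shows "taylor f = taylor g"
  unfolding taylor_def using assms by (metis (no_types, lifting))

lemma taylor_vmono: "taylor (\<lambda>z. vmono z \<beta>) = (\<lambda>\<alpha>. if \<alpha> = \<beta> then 1 else 0)"
proof (rule taylor_eqI[OF vmono_continuous])
  fix z :: "complex^'a"
  show "((\<lambda>\<alpha>. (if \<alpha> = \<beta> then 1 else 0) * vmono z \<alpha>) has_sum vmono z \<beta>) UNIV"
    by (rule has_sum_finite_neutralI[of "{\<beta>}"]) auto
qed

text \<open>The factor comes from estimating the Cauchy kernel. It depends on \<open>z\<close> and
  \<open>r\<close> but not on \<open>f\<close>, so it is the same for all powers of a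
  function.\<close>

lemma torus_cauchy_bound:
  assumes f: "holo_on f \<D>" and r: "0 < r" "r < 1" and z: "z \<in> polydisc r"
    and M: "\<And>z. (\<And>k. cmod (z $ k) = r) \<Longrightarrow> cmod (f z) \<le> M"
  shows "cmod (f z) \<le> M * (\<Prod>k\<in>UNIV. inverse (1 - cmod (z $ k) / r))"
proof -
  have zk: "cmod (z $ k) < r" for k using z by (simp add: polydisc_def)
  have tpM: "cmod (f (torus_point r \<theta>)) \<le> M" for \<theta>
    by (rule M) (use r in \<open>simp add: torus_point_nth norm_mult\<close>)
  show ?thesis
    unfolding torus_cauchy[OF f r z]
  proof (rule torus_avg_norm_le)
    show "continuous_on tbox (\<lambda>\<theta>. f (torus_point r \<theta>) * (\<Prod>k\<in>UNIV. inverse (1 - z $ k * cis (- (\<theta> $ k)) / of_real r)))"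
      using cauchy_kernel_denom[OF r(1) zk] r
      by (intro continuous_intros continuous_torus_point_comp[OF holo_on_continuous_on[OF f]]) auto
    fix \<theta>
    have "cmod (inverse (1 - z $ k * cis (- (\<theta> $ k)) / of_real r)) \<le> inverse (1 - cmod (z $ k) / r)" for k
    proof -
      have "1 - cmod (z $ k) / r \<le> cmod (1 - z $ k * cis (- (\<theta> $ k)) / of_real r)"
        using norm_triangle_ineq2[of 1 "z $ k * cis (- (\<theta> $ k)) / of_real r"] r by (simp add: norm_mult norm_divide)
      moreover have "0 < 1 - cmod (z $ k) / r" using zk r by simp
      ultimately show ?thesis unfolding norm_inverse by (rule le_imp_inverse_le)
    qed
    then have "cmod (\<Prod>k\<in>UNIV. inverse (1 - z $ k * cis (- (\<theta> $ k)) / of_real r)) \<le> (\<Prod>k\<in>UNIV. inverse (1 - cmod (z $ k) / r))"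
      unfolding prod_norm[symmetric] by (intro prod_mono) auto
    moreover have "0 \<le> M" using tpM[of 0] norm_ge_zero order_trans by blast
    ultimately show "norm (f (torus_point r \<theta>) * (\<Prod>k\<in>UNIV. inverse (1 - z $ k * cis (- (\<theta> $ k)) / of_real r)))
        \<le> M * (\<Prod>k\<in>UNIV. inverse (1 - cmod (z $ k) / r))"
      unfolding norm_mult using tpM[of \<theta>] by (intro mult_mono) auto
  qed
qed

section \<open>Closure properties of holomorphic functions\<close>

lemma holo_const: "holo_on (\<lambda>z. c) S"
  unfolding holo_on_def by (auto intro!: exI[of _ "\<lambda>_. 0"])

lemma holo_coord: "holo_on (\<lambda>z. z $ k) S"
  unfolding holo_on_def
  by (auto intro!: exI[of _ "\<lambda>v. v $ k"] bounded_linear_imp_has_derivative bounded_linear_vec_nth)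

lemma holo_add:
  assumes "holo_on f S" "holo_on g S"
  shows "holo_on (\<lambda>z. f z + g z) S"
  unfolding holo_on_def
proof
  fix z assume z: "z \<in> S"
  show "\<exists>f'. ((\<lambda>z. f z + g z) has_derivative f') (at z) \<and> (\<forall>c v. f' (c *s v) = c * f' v)"
    by (rule exI, rule conjI[OF has_derivative_add[OF holo_onD(1)[OF assms(1) z] holo_onD(1)[OF assms(2) z]]])
      (simp add: holo_onD(2)[OF assms(1) z] holo_onD(2)[OF assms(2) z] distrib_left)
qed

lemma holo_mult:
  assumes "holo_on f S" "holo_on g S"
  shows "holo_on (\<lambda>z. f z * g z) S"
  unfolding holo_on_def
proof
  fix z assume z: "z \<in> S"
  show "\<exists>f'. ((\<lambda>z. f z * g z) has_derivative f') (at z) \<and> (\<forall>c v. f' (c *s v) = c * f' v)"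
    by (rule exI, rule conjI[OF has_derivative_mult[OF holo_onD(1)[OF assms(1) z] holo_onD(1)[OF assms(2) z]]])
      (simp add: holo_onD(2)[OF assms(1) z] holo_onD(2)[OF assms(2) z] algebra_simps)
qed

lemma holo_cmult: "holo_on f S \<Longrightarrow> holo_on (\<lambda>z. c * f z) S"
  by (rule holo_mult[OF holo_const])

lemma holo_diff:
  assumes "holo_on f S" "holo_on g S"
  shows "holo_on (\<lambda>z. f z - g z) S"
  using holo_add[OF assms(1) holo_cmult[OF assms(2), of "-1"]] by simp

lemma holo_sum: "(\<And>i. i \<in> I \<Longrightarrow> holo_on (f i) S) \<Longrightarrow> holo_on (\<lambda>z. \<Sum>i\<in>I. f i z) S"
  by (induction I rule: infinite_finite_induct) (auto intro: holo_const holo_add)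

lemma holo_prod: "(\<And>i. i \<in> I \<Longrightarrow> holo_on (f i) S) \<Longrightarrow> holo_on (\<lambda>z. \<Prod>i\<in>I. f i z) S"
  by (induction I rule: infinite_finite_induct) (auto intro: holo_const holo_mult)

lemma holo_power: "holo_on f S \<Longrightarrow> holo_on (\<lambda>z. f z ^ m) S"
  by (induction m) (auto intro: holo_const holo_mult)

lemma holo_inverse:
  assumes "holo_on f S" "\<And>z. z \<in> S \<Longrightarrow> f z \<noteq> 0"
  shows "holo_on (\<lambda>z. inverse (f z)) S"
  unfolding holo_on_def
proof
  fix z assume z: "z \<in> S"
  show "\<exists>f'. ((\<lambda>z. inverse (f z)) has_derivative f') (at z) \<and> (\<forall>c v. f' (c *s v) = c * f' v)"
    by (rule exI, rule conjI[OF Deriv.has_derivative_inverse[OF assms(2)[OF z] holo_onD(1)[OF assms(1) z]]])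
      (simp add: holo_onD(2)[OF assms(1) z])
qed

lemma has_derivative_vec:
  fixes f :: "'a::real_normed_vector \<Rightarrow> complex^'n"
  assumes "\<And>i. ((\<lambda>z. f z $ i) has_derivative f' i) (at z)"
  shows "(f has_derivative (\<lambda>v. \<chi> i. f' i v)) (at z)"
proof -
  have "((\<lambda>z. \<Sum>i\<in>UNIV. (f z $ i) *s axis i 1) has_derivative (\<lambda>v. \<Sum>i\<in>UNIV. f' i v *s (axis i 1 :: complex^'n))) (at z)"
    by (intro has_derivative_sum bounded_linear.has_derivative[OF bounded_linear_smult] assms)
  moreover have "(\<Sum>i\<in>UNIV. c i *s (axis i 1 :: complex^'n)) = (\<chi> i. c i)" for c
    by (simp add: vec_eq_iff axis_def if_distrib[of "\<lambda>x. _ * x"] cong: if_cong)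
  ultimately show ?thesis by simp
qed

lemma holo_compose:
  fixes \<Phi> :: "complex^'n \<Rightarrow> complex^'m"
  assumes f: "holo_on f T" and \<Phi>: "\<And>i. holo_on (\<lambda>z. \<Phi> z $ i) S" and sub: "\<And>z. z \<in> S \<Longrightarrow> \<Phi> z \<in> T"
  shows "holo_on (\<lambda>z. f (\<Phi> z)) S"
  unfolding holo_on_def
proof
  fix z assume z: "z \<in> S"
  have "(\<Phi> has_derivative (\<lambda>v. \<chi> i. frechet_derivative (\<lambda>z. \<Phi> z $ i) (at z) v)) (at z)"
    by (intro has_derivative_vec holo_onD(1)[OF \<Phi> z])
  note d = has_derivative_compose[OF this holo_onD(1)[OF f sub[OF z]]]
  have "(\<chi> i. frechet_derivative (\<lambda>z. \<Phi> z $ i) (at z) (c *s v)) = c *s (\<chi> i. frechet_derivative (\<lambda>z. \<Phi> z $ i) (at z) v)" for c v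
    by (simp add: vec_eq_iff holo_onD(2)[OF \<Phi> z])
  then show "\<exists>f'. ((\<lambda>z. f (\<Phi> z)) has_derivative f') (at z) \<and> (\<forall>c v. f' (c *s v) = c * f' v)"
    using d by (intro exI[of _ "\<lambda>v. frechet_derivative f (at (\<Phi> z)) (\<chi> i. frechet_derivative (\<lambda>z. \<Phi> z $ i) (at z) v)"])
      (simp add: holo_onD(2)[OF f sub[OF z]])
qed

lemma on_disc_eq: "z \<in> \<D> \<Longrightarrow> on_disc f z = f z"
  by (simp add: on_disc_def)

lemma holo_on_disc: "holo_on f \<D> \<Longrightarrow> holo_on (on_disc f) \<D>"
  by (rule holo_on_cong[OF open_polydisc]) (simp add: on_disc_eq)

lemma taylor_on_disc: "taylor (on_disc f) = taylor f"
  by (rule taylor_cong) (simp add: on_disc_eq)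

section \<open>The Hardy space\<close>

lemma hardyD:
  assumes "f \<in> \<H>\<^sup>2"
  shows "holo_on f \<D>" "z \<notin> \<D> \<Longrightarrow> f z = 0"
  using assms by (auto simp: hardy_def)

lemma torus_mean_eq: "torus_mean f r = (LINT \<theta>:tbox|lborel. (cmod (f (torus_point r \<theta>)))\<^sup>2) / (2 * pi) ^ CARD('n)"
  for f :: "complex^'n \<Rightarrow> complex"
  by (simp add: torus_mean_def torus_point_def)

lemma torus_point_closed_disc: "0 \<le> r \<Longrightarrow> r \<le> 1 \<Longrightarrow> torus_point r \<theta> \<in> \<D> \<union> \<T>"
  by (auto simp: polydisc_def torus_def torus_point_nth norm_mult)

lemma continuous_torus_point_joint:
  fixes g :: "complex^'n \<Rightarrow> 'b::topological_space"
  assumes "continuous_on (\<D> \<union> \<T>) g"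
  shows "continuous_on ({0..1} \<times> tbox) (\<lambda>(r, \<theta>). g (torus_point r \<theta>))"
proof -
  have "continuous_on ({0..1} \<times> tbox) (\<lambda>p. g (torus_point (fst p) (snd p)))"
  proof (rule continuous_on_compose2[OF assms])
    show "continuous_on ({0..1} \<times> tbox) (\<lambda>p. torus_point (fst p) (snd p))"
      unfolding torus_point_def by (intro continuous_intros continuous_on_vec_lambda)
    show "(\<lambda>p. torus_point (fst p) (snd p)) ` ({0..1} \<times> tbox) \<subseteq> \<D> \<union> \<T>"
      by (intro image_subsetI torus_point_closed_disc) auto
  qed
  then show ?thesis by (simp add: case_prod_beta)
qed

text \<open>\<open>f\<close> itself is 0 on the torus, so the boundary values are supplied by
  \<open>g\<close>. The mean of \<open>g\<close> is continuous in the radius up to 1, and this gives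
  the limit required by \<open>hardy\<close>. The set \<open>\<D> \<union> \<T>\<close> contains all
  radii ending on the torus.\<close>

lemma hardy_I:
  fixes f :: "complex^'n \<Rightarrow> complex"
  assumes f: "holo_on f \<D>" "\<And>z. z \<notin> \<D> \<Longrightarrow> f z = 0"
    and g: "continuous_on (\<D> \<union> \<T>) g" "\<And>z. z \<in> \<D> \<Longrightarrow> g z = f z"
  shows "f \<in> \<H>\<^sup>2"
proof -
  define I where "I = (\<lambda>r. integral (tbox :: (real^'n) set) (\<lambda>\<theta>. (cmod (g (torus_point r \<theta>)))\<^sup>2))"
  have cont: "continuous_on ({0..1} \<times> (tbox :: (real^'n) set)) (\<lambda>(r, \<theta>). (cmod (g (torus_point r \<theta>)))\<^sup>2)"
    by (rule continuous_torus_point_joint) (intro continuous_intros g)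
  have "continuous_on {0..1} I"
    unfolding I_def by (rule integral_continuous_on_param[OF cont])
  then have "(I \<longlongrightarrow> I 1) (at_left 1)"
    unfolding continuous_on_def using at_within_Icc_at_left[of 0 "1::real"] by (metis atLeastAtMost_iff le_numeral_extra(4) zero_le_one zero_less_one)
  then have lim: "((\<lambda>r. I r / (2 * pi) ^ CARD('n)) \<longlongrightarrow> I 1 / (2 * pi) ^ CARD('n)) (at_left 1)"
    by (intro tendsto_intros) auto
  have "\<forall>\<^sub>F r in at_left 1. torus_mean f r = I r / (2 * pi) ^ CARD('n)"
    using eventually_at_left_real[of 0 "1::real"]
  proof (rule eventually_mono)
    fix r :: real assume r: "r \<in> {0<..<1}"
    have "f (torus_point r \<theta>) = g (torus_point r \<theta>)" for \<theta>
      by (rule g(2)[symmetric]) (use r in \<open>simp add: torus_point_polydisc\<close>)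
    moreover have "continuous_on tbox (\<lambda>\<theta>. (cmod (g (torus_point r \<theta>)))\<^sup>2)"
      by (intro continuous_intros continuous_on_compose2[OF g(1) continuous_torus_point])
        (use r torus_point_closed_disc[of r] in auto)
    ultimately show "torus_mean f r = I r / (2 * pi) ^ CARD('n)"
      unfolding torus_mean_eq I_def by (simp add: set_borel_integral_eq_integral(2)[OF set_integrable_tbox])
  qed simp
  then have "(torus_mean f \<longlongrightarrow> I 1 / (2 * pi) ^ CARD('n)) (at_left 1)"
    using lim by (simp add: tendsto_cong)
  then show ?thesis using f unfolding hardy_def by blast
qed

lemma hardy_on_disc:
  assumes "holo_on f \<D>" "continuous_on (\<D> \<union> \<T>) f"
  shows "on_disc f \<in> \<H>\<^sup>2"
  by (rule hardy_I[OF holo_on_disc[OF assms(1)] _ assms(2)]) (auto simp: on_disc_def)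

section \<open>Bessel's inequality and the pairing of Taylor coefficients\<close>

lemma torus_avg_cnj: "torus_avg (\<lambda>\<theta>. cnj (G \<theta>)) = cnj (torus_avg G)"
proof -
  have "(LINT \<theta>:tbox|lborel. cnj (G \<theta>)) = cnj (LINT \<theta>:tbox|lborel. G \<theta>)"
  proof -
    have "(\<lambda>\<theta>. indicator tbox \<theta> *\<^sub>R cnj (G \<theta>)) = (\<lambda>\<theta>. cnj (indicator tbox \<theta> *\<^sub>R G \<theta>))"
      by (auto simp: indicator_def)
    then show ?thesis unfolding set_lebesgue_integral_def by (simp only: Bochner_Integration.integral_cnj)
  qed
  then show ?thesis by (simp add: torus_avg_def)
qed

lemma torus_avg_mult_cnj:
  "torus_avg (\<lambda>\<theta>. G \<theta> * cnj (G \<theta>)) = of_real ((LINT \<theta>:tbox|lborel. (cmod (G \<theta>))\<^sup>2) / (2 * pi) ^ CARD('n))"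
  for G :: "real^'n \<Rightarrow> complex"
proof -
  have "G \<theta> * cnj (G \<theta>) = of_real ((cmod (G \<theta>))\<^sup>2)" for \<theta> using complex_norm_square[of "G \<theta>"] by simp
  then show ?thesis
    unfolding torus_avg_def by (simp only: set_integral_complex_of_real) simp
qed

text \<open>With \<open>p\<close> the partial Fourier sum over \<open>S\<close> on the torus of
  radius \<open>r\<close>, the mean of the squared modulus of \<open>g - p\<close> is nonnegative;
  the cross terms and the square of \<open>p\<close> all equal the same sum, so expanding the square
  leaves the claim.\<close>

lemma bessel_inequality:
  fixes f :: "complex^'n \<Rightarrow> complex"
  assumes f: "holo_on f \<D>" and r: "0 < r" "r < 1" and S: "finite S"
  shows "(\<Sum>\<alpha>\<in>S. (cmod (taylor f \<alpha>) * r ^ deg \<alpha>)\<^sup>2) \<le> torus_mean f r"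
proof -
  define g where "g = (\<lambda>\<theta>. f (torus_point r \<theta>))"
  define c where "c = (\<lambda>\<alpha>. taylor f \<alpha> * of_real (r ^ deg \<alpha>))"
  define p where "p = (\<lambda>\<theta>. \<Sum>\<alpha>\<in>S. c \<alpha> * torus_char \<alpha> \<theta>)"
  have cg: "continuous_on tbox g"
    unfolding g_def by (rule continuous_torus_point_comp[OF holo_on_continuous_on[OF f]]) (use r in auto)
  have cp: "continuous_on tbox p" unfolding p_def by (intro continuous_intros continuous_torus_char)
  have gc: "torus_avg (\<lambda>\<theta>. g \<theta> * cnj (torus_char \<alpha> \<theta>)) = c \<alpha>" for \<alpha>
    unfolding g_def c_def by (rule taylor_torus_avg[OF f r])
  have gp: "torus_avg (\<lambda>\<theta>. g \<theta> * cnj (p \<theta>)) = (\<Sum>\<alpha>\<in>S. c \<alpha> * cnj (c \<alpha>))"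
  proof -
    have "torus_avg (\<lambda>\<theta>. g \<theta> * cnj (p \<theta>)) = torus_avg (\<lambda>\<theta>. \<Sum>\<alpha>\<in>S. cnj (c \<alpha>) * (g \<theta> * cnj (torus_char \<alpha> \<theta>)))"
      by (simp add: p_def sum_distrib_left mult_ac)
    also have "\<dots> = (\<Sum>\<alpha>\<in>S. torus_avg (\<lambda>\<theta>. cnj (c \<alpha>) * (g \<theta> * cnj (torus_char \<alpha> \<theta>))))"
      by (intro torus_avg_sum S continuous_intros cg continuous_torus_char)
    also have "\<dots> = (\<Sum>\<alpha>\<in>S. cnj (c \<alpha>) * torus_avg (\<lambda>\<theta>. g \<theta> * cnj (torus_char \<alpha> \<theta>)))"
      by (intro sum.cong refl torus_avg_cmult continuous_intros cg continuous_torus_char)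
    finally show ?thesis by (simp add: gc mult_ac)
  qed
  have pc: "torus_avg (\<lambda>\<theta>. p \<theta> * cnj (torus_char \<beta> \<theta>)) = c \<beta>" if \<beta>: "\<beta> \<in> S" for \<beta>
  proof -
    have "torus_avg (\<lambda>\<theta>. p \<theta> * cnj (torus_char \<beta> \<theta>)) = torus_avg (\<lambda>\<theta>. \<Sum>\<alpha>\<in>S. c \<alpha> * (torus_char \<alpha> \<theta> * cnj (torus_char \<beta> \<theta>)))"
      by (simp only: p_def sum_distrib_right mult.assoc)
    also have "\<dots> = (\<Sum>\<alpha>\<in>S. torus_avg (\<lambda>\<theta>. c \<alpha> * (torus_char \<alpha> \<theta> * cnj (torus_char \<beta> \<theta>))))"
      by (intro torus_avg_sum S continuous_intros continuous_torus_char)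
    also have "\<dots> = (\<Sum>\<alpha>\<in>S. c \<alpha> * torus_avg (\<lambda>\<theta>::real^'n. torus_char \<alpha> \<theta> * cnj (torus_char \<beta> \<theta>)))"
      by (intro sum.cong refl torus_avg_cmult continuous_intros continuous_torus_char)
    also have "\<dots> = (\<Sum>\<alpha>\<in>S. if \<alpha> = \<beta> then c \<alpha> else 0)"
      by (intro sum.cong) (auto simp: torus_orthonormal)
    finally show ?thesis using \<beta> S by simp
  qed
  have pp: "torus_avg (\<lambda>\<theta>. p \<theta> * cnj (p \<theta>)) = (\<Sum>\<alpha>\<in>S. c \<alpha> * cnj (c \<alpha>))"
  proof -
    have "torus_avg (\<lambda>\<theta>. p \<theta> * cnj (p \<theta>)) = torus_avg (\<lambda>\<theta>. \<Sum>\<alpha>\<in>S. cnj (c \<alpha>) * (p \<theta> * cnj (torus_char \<alpha> \<theta>)))"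
    proof (rule torus_avg_cong)
      fix \<theta> :: "real^'n"
      have "cnj (p \<theta>) = (\<Sum>\<alpha>\<in>S. cnj (c \<alpha>) * cnj (torus_char \<alpha> \<theta>))" by (simp add: p_def)
      then show "p \<theta> * cnj (p \<theta>) = (\<Sum>\<alpha>\<in>S. cnj (c \<alpha>) * (p \<theta> * cnj (torus_char \<alpha> \<theta>)))"
        by (simp add: sum_distrib_left mult_ac)
    qed
    also have "\<dots> = (\<Sum>\<alpha>\<in>S. torus_avg (\<lambda>\<theta>. cnj (c \<alpha>) * (p \<theta> * cnj (torus_char \<alpha> \<theta>))))"
      by (intro torus_avg_sum S continuous_intros cp continuous_torus_char)
    also have "\<dots> = (\<Sum>\<alpha>\<in>S. cnj (c \<alpha>) * torus_avg (\<lambda>\<theta>. p \<theta> * cnj (torus_char \<alpha> \<theta>)))"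
      by (intro sum.cong refl torus_avg_cmult continuous_intros cp continuous_torus_char)
    finally show ?thesis by (simp add: pc mult_ac)
  qed
  have "torus_avg (\<lambda>\<theta>. (g \<theta> - p \<theta>) * cnj (g \<theta> - p \<theta>)) =
      torus_avg (\<lambda>\<theta>. (g \<theta> * cnj (g \<theta>) - g \<theta> * cnj (p \<theta>)) - (cnj (g \<theta> * cnj (p \<theta>)) - p \<theta> * cnj (p \<theta>)))"
    by (simp add: algebra_simps)
  also have "\<dots> = (torus_avg (\<lambda>\<theta>. g \<theta> * cnj (g \<theta>)) - torus_avg (\<lambda>\<theta>. g \<theta> * cnj (p \<theta>))) -
      (cnj (torus_avg (\<lambda>\<theta>. g \<theta> * cnj (p \<theta>))) - torus_avg (\<lambda>\<theta>. p \<theta> * cnj (p \<theta>)))"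
  proof -
    have "torus_avg (\<lambda>\<theta>. g \<theta> * cnj (g \<theta>) - g \<theta> * cnj (p \<theta>)) = torus_avg (\<lambda>\<theta>. g \<theta> * cnj (g \<theta>)) - torus_avg (\<lambda>\<theta>. g \<theta> * cnj (p \<theta>))"
      by (intro torus_avg_diff continuous_intros cg cp)
    moreover have "torus_avg (\<lambda>\<theta>. cnj (g \<theta> * cnj (p \<theta>)) - p \<theta> * cnj (p \<theta>)) = torus_avg (\<lambda>\<theta>. cnj (g \<theta> * cnj (p \<theta>))) - torus_avg (\<lambda>\<theta>. p \<theta> * cnj (p \<theta>))"
      by (intro torus_avg_diff continuous_intros cg cp)
    moreover have "torus_avg (\<lambda>\<theta>. (g \<theta> * cnj (g \<theta>) - g \<theta> * cnj (p \<theta>)) - (cnj (g \<theta> * cnj (p \<theta>)) - p \<theta> * cnj (p \<theta>))) =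
        torus_avg (\<lambda>\<theta>. g \<theta> * cnj (g \<theta>) - g \<theta> * cnj (p \<theta>)) - torus_avg (\<lambda>\<theta>. cnj (g \<theta> * cnj (p \<theta>)) - p \<theta> * cnj (p \<theta>))"
      by (intro torus_avg_diff continuous_intros cg cp)
    ultimately show ?thesis by (simp only: torus_avg_cnj)
  qed
  also have "\<dots> = torus_avg (\<lambda>\<theta>. g \<theta> * cnj (g \<theta>)) - (\<Sum>\<alpha>\<in>S. c \<alpha> * cnj (c \<alpha>))"
    unfolding gp pp by (simp add: mult_ac)
  also have "(\<Sum>\<alpha>\<in>S. c \<alpha> * cnj (c \<alpha>)) = of_real (\<Sum>\<alpha>\<in>S. (cmod (taylor f \<alpha>) * r ^ deg \<alpha>)\<^sup>2)"
  proof -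
    have "c \<alpha> * cnj (c \<alpha>) = of_real ((cmod (taylor f \<alpha>) * r ^ deg \<alpha>)\<^sup>2)" for \<alpha>
    proof -
      have "cmod (c \<alpha>) = cmod (taylor f \<alpha>) * r ^ deg \<alpha>"
        using r by (simp add: c_def norm_mult norm_power)
      then show ?thesis using complex_norm_square[of "c \<alpha>"] by simp
    qed
    then show ?thesis by simp
  qed
  also have "torus_avg (\<lambda>\<theta>. g \<theta> * cnj (g \<theta>)) = of_real (torus_mean f r)"
    unfolding torus_avg_mult_cnj torus_mean_eq g_def ..
  finally have "of_real (torus_mean f r - (\<Sum>\<alpha>\<in>S. (cmod (taylor f \<alpha>) * r ^ deg \<alpha>)\<^sup>2)) =
      torus_avg (\<lambda>\<theta>. (g \<theta> - p \<theta>) * cnj (g \<theta> - p \<theta>))" by simp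
  also have "\<dots> = of_real ((LINT \<theta>:tbox|lborel. (cmod (g \<theta> - p \<theta>))\<^sup>2) / (2 * pi) ^ CARD('n))"
    by (rule torus_avg_mult_cnj)
  finally have "torus_mean f r - (\<Sum>\<alpha>\<in>S. (cmod (taylor f \<alpha>) * r ^ deg \<alpha>)\<^sup>2) =
      (LINT \<theta>:tbox|lborel. (cmod (g \<theta> - p \<theta>))\<^sup>2) / (2 * pi) ^ CARD('n)"
    using of_real_eq_iff by blast
  also have "\<dots> \<ge> 0"
    unfolding set_lebesgue_integral_def by (intro divide_nonneg_nonneg Bochner_Integration.integral_nonneg) auto
  finally show ?thesis by simp
qed

text \<open>Bessel's inequality for a fixed finite set of indices, in the limit as the radius tends
  to 1.\<close>

lemma hardy_taylor_summable:
  assumes f: "f \<in> \<H>\<^sup>2"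
  shows "(\<lambda>\<alpha>. (cmod (taylor f \<alpha>))\<^sup>2) summable_on UNIV"
proof -
  obtain L where L: "(torus_mean f \<longlongrightarrow> L) (at_left 1)" using f by (auto simp: hardy_def)
  show ?thesis
  proof (rule nonneg_bounded_partial_sums_imp_summable_on)
    show "\<forall>\<^sub>F X in finite_subsets_at_top UNIV. (\<Sum>\<alpha>\<in>X. (cmod (taylor f \<alpha>))\<^sup>2) \<le> L"
    proof (rule eventually_finite_subsets_at_top_weakI)
      fix X :: "('a \<Rightarrow> nat) set" assume X: "finite X"
      have "((\<lambda>r. \<Sum>\<alpha>\<in>X. (cmod (taylor f \<alpha>) * r ^ deg \<alpha>)\<^sup>2) \<longlongrightarrow> (\<Sum>\<alpha>\<in>X. (cmod (taylor f \<alpha>) * 1 ^ deg \<alpha>)\<^sup>2)) (at_left 1)"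
        by (intro tendsto_intros)
      moreover have "\<forall>\<^sub>F r in at_left 1. (\<Sum>\<alpha>\<in>X. (cmod (taylor f \<alpha>) * r ^ deg \<alpha>)\<^sup>2) \<le> torus_mean f r"
        by (rule eventually_mono[OF eventually_at_left_real[OF zero_less_one]]) (auto intro: bessel_inequality[OF hardyD(1)[OF f] _ _ X])
      ultimately have "(\<Sum>\<alpha>\<in>X. (cmod (taylor f \<alpha>) * 1 ^ deg \<alpha>)\<^sup>2) \<le> L"
        by (intro tendsto_le[OF _ L]) auto
      then show "(\<Sum>\<alpha>\<in>X. (cmod (taylor f \<alpha>))\<^sup>2) \<le> L" by simp
    qed
  qed simp
qed

lemma hinner_summable:
  assumes f: "f \<in> \<H>\<^sup>2" and g: "g \<in> \<H>\<^sup>2"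
  shows "(\<lambda>\<alpha>. taylor f \<alpha> * cnj (taylor g \<alpha>)) summable_on UNIV"
proof (rule abs_summable_summable, rule summable_on_comparison_test)
  show "(\<lambda>\<alpha>. (cmod (taylor f \<alpha>))\<^sup>2 + (cmod (taylor g \<alpha>))\<^sup>2) summable_on UNIV"
    by (intro summable_on_add hardy_taylor_summable f g)
  fix \<alpha>
  have "2 * (cmod (taylor f \<alpha>) * cmod (taylor g \<alpha>)) \<le> (cmod (taylor f \<alpha>))\<^sup>2 + (cmod (taylor g \<alpha>))\<^sup>2"
    using sum_squares_bound[of "cmod (taylor f \<alpha>)" "cmod (taylor g \<alpha>)"] by simp
  moreover have "0 \<le> cmod (taylor f \<alpha>) * cmod (taylor g \<alpha>)" by simp
  ultimately show "norm (taylor f \<alpha> * cnj (taylor g \<alpha>)) \<le> (cmod (taylor f \<alpha>))\<^sup>2 + (cmod (taylor g \<alpha>))\<^sup>2"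
    unfolding norm_mult complex_mod_cnj by linarith
qed auto

lemma hinner_cnj: "hinner g f = cnj (hinner f g)"
  unfolding hinner_def infsum_cnj[symmetric] by (simp add: mult.commute)

text \<open>The combination \<open>c * f - g\<close> is the one in which the generator maps a
  Laplace transform.\<close>

lemma hinner_scale_diff:
  assumes f: "f \<in> \<H>\<^sup>2" and g: "g \<in> \<H>\<^sup>2" and k: "k \<in> \<H>\<^sup>2"
  shows "hinner (\<lambda>z. c * f z - g z) k = c * hinner f k - hinner g k"
proof -
  have hs: "((\<lambda>\<alpha>. taylor f \<alpha> * cnj (taylor k \<alpha>)) has_sum hinner f k) UNIV" if "f \<in> \<H>\<^sup>2" for f
    unfolding hinner_def using hinner_summable[OF that k] by simp
  have t: "taylor (\<lambda>z. c * f z - g z) = (\<lambda>\<alpha>. c * taylor f \<alpha> - taylor g \<alpha>)"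
    using taylor_diff[OF holo_cmult[OF hardyD(1)[OF f]] hardyD(1)[OF g]] taylor_cmult[OF hardyD(1)[OF f]] by simp
  have "((\<lambda>\<alpha>. c * (taylor f \<alpha> * cnj (taylor k \<alpha>)) + (-1) * (taylor g \<alpha> * cnj (taylor k \<alpha>))) has_sum
      (c * hinner f k + (-1) * hinner g k)) UNIV"
    by (intro has_sum_add has_sum_cmult_right hs f g)
  then show ?thesis
    unfolding hinner_def[of "\<lambda>z. c * f z - g z"] t by (intro infsumI) (simp add: algebra_simps)
qed

lemma hinner_cmult_right: 
  assumes "holo_on k \<D>"
  shows "hinner f (\<lambda>z. c * k z) = cnj c * hinner f k"
  unfolding hinner_def taylor_cmult[OF assms] infsum_cmult_right'[symmetric] by (simp add: mult_ac)

lemma hardy_eqI: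
  assumes f: "f \<in> \<H>\<^sup>2" and g: "g \<in> \<H>\<^sup>2" and t: "taylor f = taylor g"
  shows "f = g"
proof (rule ext)
  fix z
  show "f z = g z"
  proof (cases "z \<in> \<D>")
    case True
    then show ?thesis
      using taylor_has_sum[OF hardyD(1)[OF f] True] taylor_has_sum[OF hardyD(1)[OF g] True] has_sum_unique t by metis
  next
    case False
    then show ?thesis using hardyD(2) f g by metis
  qed
qed

lemma holo_vmono: "holo_on (\<lambda>z. vmono z \<alpha>) S"
  unfolding vmono_def by (intro holo_prod holo_power holo_coord)

lemma hardy_vmono: "on_disc (\<lambda>z. vmono z \<alpha>) \<in> \<H>\<^sup>2"
  by (intro hardy_on_disc holo_vmono vmono_continuous)

lemma hinner_vmono: "hinner (on_disc (\<lambda>z. vmono z \<alpha>)) g = cnj (taylor g \<alpha>)"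
  unfolding hinner_def taylor_on_disc taylor_vmono
  by (rule infsumI, rule has_sum_finite_neutralI[of "{\<alpha>}"]) auto

text \<open>Pairing a monomial with a function reads off a Taylor coefficient, so once the domain
  contains all monomials the condition in \<open>adj\<close> has at most one solution.\<close>

lemma adj_eqI:
  assumes mono: "\<And>\<alpha>. on_disc (\<lambda>z. vmono z \<alpha>) \<in> DA" and g': "g' \<in> \<H>\<^sup>2" "\<And>f. f \<in> DA \<Longrightarrow> hinner (A f) g = hinner f g'"
  shows "adj DA A g = g'"
  unfolding adj_def
proof (rule the_equality)
  show "g' \<in> \<H>\<^sup>2 \<and> (\<forall>f\<in>DA. hinner (A f) g = hinner f g')" using g' by blast
next
  fix k assume k: "k \<in> \<H>\<^sup>2 \<and> (\<forall>f\<in>DA. hinner (A f) g = hinner f k)"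
  show "k = g'"
  proof (rule hardy_eqI)
    show "taylor k = taylor g'"
    proof
      fix \<alpha>
      have "cnj (taylor k \<alpha>) = cnj (taylor g' \<alpha>)"
        using k g'(2) mono[of \<alpha>] hinner_vmono by metis
      then show "taylor k \<alpha> = taylor g' \<alpha>" by simp
    qed
  qed (use k g' in auto)
qed

section \<open>Reproducing kernels and the dual Koopman semigroup\<close>

lemma rkernel_denom:
  assumes "w \<in> \<D>" "z \<in> \<D> \<union> \<T>"
  shows "1 - cnj (w $ i) * z $ i \<noteq> 0"
proof
  assume "1 - cnj (w $ i) * z $ i = 0"
  then have "cmod (cnj (w $ i) * z $ i) = 1" by (metis norm_one right_minus_eq)
  moreover have "cmod (z $ i) \<le> 1" using assms by (auto simp: polydisc_def torus_def less_imp_le)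
  moreover have "cmod (w $ i) < 1" using assms by (auto simp: polydisc_def)
  moreover have "cmod (w $ i) * cmod (z $ i) \<le> cmod (w $ i)"
    using calculation(2) by (simp add: mult_left_le)
  ultimately show False by (simp add: norm_mult)
qed

lemma rkernel_holo:
  assumes "w \<in> \<D>"
  shows "holo_on (\<lambda>z. \<Prod>i\<in>UNIV. inverse (1 - cnj (w $ i) * z $ i)) \<D>"
  using rkernel_denom[OF assms]
  by (intro holo_prod holo_inverse holo_diff holo_const holo_cmult holo_coord) auto

lemma rkernel_continuous:
  assumes "w \<in> \<D>"
  shows "continuous_on (\<D> \<union> \<T>) (\<lambda>z. \<Prod>i\<in>UNIV. inverse (1 - cnj (w $ i) * z $ i))"
  using rkernel_denom[OF assms] by (intro continuous_intros) auto

lemma taylor_rkernel: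
  assumes w: "w \<in> \<D>"
  shows "taylor (rkernel w) = (\<lambda>\<alpha>. cnj (vmono w \<alpha>))"
  unfolding rkernel_def taylor_on_disc
proof (rule taylor_eqI[OF holo_on_continuous_on[OF rkernel_holo[OF w]]])
  fix z :: "complex^'a" assume z: "z \<in> \<D>"
  have "norm (cnj (w $ k) * z $ k) < 1" for k
  proof -
    have "cmod (w $ k) < 1" "cmod (z $ k) < 1" using w z by (auto simp: polydisc_def)
    then show ?thesis using mult_strict_mono[of "cmod (w $ k)" 1 "cmod (z $ k)" 1] by (simp add: norm_mult)
  qed
  then have "((\<lambda>\<alpha>. \<Prod>k\<in>UNIV. (cnj (w $ k) * z $ k) ^ \<alpha> k) has_sum (\<Prod>i\<in>UNIV. inverse (1 - cnj (w $ i) * z $ i))) UNIV"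
    by (rule multi_geometric_has_sum)
  then show "((\<lambda>\<alpha>. cnj (vmono w \<alpha>) * vmono z \<alpha>) has_sum (\<Prod>i\<in>UNIV. inverse (1 - cnj (w $ i) * z $ i))) UNIV"
    by (simp add: vmono_def power_mult_distrib prod.distrib)
qed

lemma rkernel_diff_hardy:
  assumes "w \<in> \<D>" "w' \<in> \<D>"
  shows "(\<lambda>x. rkernel w x - rkernel w' x) \<in> \<H>\<^sup>2"
proof -
  have "(\<lambda>x. rkernel w x - rkernel w' x) =
      on_disc (\<lambda>z. (\<Prod>i\<in>UNIV. inverse (1 - cnj (w $ i) * z $ i)) - (\<Prod>i\<in>UNIV. inverse (1 - cnj (w' $ i) * z $ i)))"
    by (auto simp: rkernel_def on_disc_def fun_eq_iff)
  then show ?thesis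
    using hardy_on_disc[OF holo_diff[OF rkernel_holo[OF assms(1)] rkernel_holo[OF assms(2)]]
        continuous_on_diff[OF rkernel_continuous[OF assms(1)] rkernel_continuous[OF assms(2)]]] by simp
qed

text \<open>The kernel at \<open>w\<close> has the coefficients
  \<open>cnj (vmono w \<alpha>)\<close>, so the pairing is literally the Taylor series of
  \<open>f\<close> at \<open>w\<close> minus the one at \<open>w'\<close>. Differences are treated
  at once because detectability is a statement about them.\<close>

lemma reproducing_diff:
  assumes f: "holo_on f \<D>" and w: "w \<in> \<D>" "w' \<in> \<D>"
  shows "hinner f (\<lambda>x. rkernel w x - rkernel w' x) = f w - f w'"
proof -
  have h: "holo_on (rkernel w) \<D>" if "w \<in> \<D>" for w :: "complex^'a"
    unfolding rkernel_def by (rule holo_on_disc[OF rkernel_holo[OF that]])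
  have "((\<lambda>\<alpha>. taylor f \<alpha> * vmono w \<alpha> + (-1) * (taylor f \<alpha> * vmono w' \<alpha>)) has_sum (f w + (-1) * f w')) UNIV"
    by (intro has_sum_add has_sum_cmult_right taylor_has_sum f w)
  then show ?thesis
    unfolding hinner_def taylor_diff[OF h[OF w(1)] h[OF w(2)]] taylor_rkernel[OF w(1)] taylor_rkernel[OF w(2)]
    by (intro infsumI) (simp add: algebra_simps)
qed

text \<open>Evaluating \<open>f\<close> composed with the flow at \<open>w\<close> is evaluating
  \<open>f\<close> at the moved point, so the moved kernels satisfy the defining relation of the
  adjoint.\<close>

lemma koopman_adj_rkernel_diff:
  assumes flow: "holomorphic_flow F \<phi>" and t: "0 \<le> t" and w: "w \<in> \<D>" "w' \<in> \<D>"
  shows "koopman_adj \<phi> t (\<lambda>x. rkernel w x - rkernel w' x) = (\<lambda>x. rkernel (\<phi> t w) x - rkernel (\<phi> t w') x)"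
  unfolding koopman_adj_def
proof (rule adj_eqI[OF hardy_vmono])
  have \<phi>: "\<And>z. z \<in> \<D> \<Longrightarrow> \<phi> t z \<in> \<D>" "\<And>i. holo_on (\<lambda>z. \<phi> t z $ i) \<D>"
    using flow t by (auto simp: holomorphic_flow_def)
  show "(\<lambda>x. rkernel (\<phi> t w) x - rkernel (\<phi> t w') x) \<in> \<H>\<^sup>2"
    by (intro rkernel_diff_hardy \<phi> w)
  fix f :: "complex^'a \<Rightarrow> complex" assume f: "f \<in> \<H>\<^sup>2"
  have "holo_on (koopman \<phi> t f) \<D>"
    unfolding koopman_def by (intro holo_on_disc holo_compose[OF hardyD(1)[OF f] \<phi>(2)] \<phi>(1))
  then show "hinner (koopman \<phi> t f) (\<lambda>x. rkernel w x - rkernel w' x) = hinner f (\<lambda>x. rkernel (\<phi> t w) x - rkernel (\<phi> t w') x)"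
    by (simp add: reproducing_diff[OF _ w] reproducing_diff[OF hardyD(1)[OF f] \<phi>(1)[OF w(1)] \<phi>(1)[OF w(2)]]
        koopman_def on_disc_eq w)
qed

section \<open>The maximum principle\<close>

lemma torus_point_surj:
  assumes "\<And>k. cmod (z $ k) = r"
  obtains \<theta> where "\<theta> \<in> tbox" "torus_point r \<theta> = z"
proof -
  have "torus_point r (\<chi> k. Arg2pi (z $ k)) $ k = z $ k" for k
    using Arg2pi_eq[of "z $ k", symmetric] assms[of k] by (simp add: torus_point_nth cis_conv_exp)
  then have "torus_point r (\<chi> k. Arg2pi (z $ k)) = z" by (simp add: vec_eq_iff)
  moreover have "(\<chi> k. Arg2pi (z $ k)) \<in> tbox"
    using Arg2pi less_imp_le by (auto simp: mem_tbox)
  ultimately show ?thesis using that by blast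
qed

text \<open>Uniform continuity in radius and angle: on tori close to the boundary the modulus
  exceeds its bound on \<open>\<T>\<close> by at most \<open>e\<close>.\<close>

lemma torus_boundary_bound:
  fixes f :: "complex^'n \<Rightarrow> complex"
  assumes cont: "continuous_on (\<D> \<union> \<T>) f" and T: "\<And>z. z \<in> \<T> \<Longrightarrow> cmod (f z) \<le> R" and e: "0 < e"
  obtains r0 where "r0 < 1" "\<And>r z. r0 < r \<Longrightarrow> r < 1 \<Longrightarrow> 0 < r \<Longrightarrow> (\<And>k. cmod (z $ k) = r) \<Longrightarrow> cmod (f z) \<le> R + e"
proof -
  have uc: "uniformly_continuous_on ({0..1} \<times> (tbox :: (real^'n) set)) (\<lambda>(r, \<theta>). f (torus_point r \<theta>))"
    by (intro compact_uniformly_continuous continuous_torus_point_joint cont compact_Times compact_cbox) auto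
  then obtain d where d: "0 < d" "\<And>p q. p \<in> {0..1} \<times> (tbox :: (real^'n) set) \<Longrightarrow> q \<in> {0..1} \<times> tbox \<Longrightarrow> dist q p < d \<Longrightarrow>
      dist (f (torus_point (fst q) (snd q))) (f (torus_point (fst p) (snd p))) < e"
    using e unfolding uniformly_continuous_on_def by (force simp: case_prod_beta)
  show ?thesis
  proof
    show "1 - d < 1" using d by simp
    fix r and z :: "complex^'n" assume r: "1 - d < r" "r < 1" "0 < r" and z: "\<And>k. cmod (z $ k) = r"
    obtain \<theta> where \<theta>: "\<theta> \<in> tbox" "torus_point r \<theta> = z" using torus_point_surj[OF z] .
    have "dist (r, \<theta>) (1, \<theta>) < d" using r by (simp add: dist_prod_def dist_real_def)
    then have "dist (f (torus_point r \<theta>)) (f (torus_point 1 \<theta>)) < e"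
      using d(2)[of "(1, \<theta>)" "(r, \<theta>)"] r \<theta>(1) by simp
    moreover have "cmod (f (torus_point 1 \<theta>)) \<le> R"
      by (rule T) (simp add: torus_def torus_point_nth)
    moreover have "cmod (f z) \<le> cmod (f (torus_point 1 \<theta>)) + dist (f (torus_point r \<theta>)) (f (torus_point 1 \<theta>))"
      unfolding \<theta>(2) dist_norm using norm_triangle_sub[of "f z" "f (torus_point 1 \<theta>)"] by simp
    ultimately show "cmod (f z) \<le> R + e" by simp
  qed
qed

text \<open>The Cauchy formula bounds \<open>\<bar>f z\<bar>\<close> by a constant depending on \<open>z\<close> times the supremum of \<open>\<bar>f\<bar>\<close>
  over a torus; applying it to the powers of \<open>f\<close> removes the constant.\<close>

lemma polydisc_max_principle:
  fixes f :: "complex^'n \<Rightarrow> complex"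
  assumes f: "holo_on f \<D>" and cont: "continuous_on (\<D> \<union> \<T>) f"
    and T: "\<And>z. z \<in> \<T> \<Longrightarrow> cmod (f z) \<le> R" and z: "z \<in> \<D>"
  shows "cmod (f z) \<le> R"
proof (rule field_le_epsilon)
  fix e :: real assume e: "0 < e"
  obtain r0 where r0: "r0 < 1" "\<And>r z. r0 < r \<Longrightarrow> r < 1 \<Longrightarrow> 0 < r \<Longrightarrow> (\<And>k. cmod (z $ k) = r) \<Longrightarrow> cmod (f z) \<le> R + e"
    using torus_boundary_bound[OF cont T e] by blast
  obtain r1 where r1: "1/2 \<le> r1" "r1 < 1" "z \<in> polydisc r1" using polydisc_between[OF z] .
  obtain r where r: "max r0 r1 < r" "r < 1" using dense[of "max r0 r1" 1] r0 r1 by auto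
  have rp: "0 < r" using r r1 by simp
  have zr: "z \<in> polydisc r" using r1(3) r polydisc_mono[of r1 r] by auto
  have bnd: "cmod (f w) \<le> R + e" if "\<And>k. cmod (w $ k) = r" for w
    using r0(2)[of r w] r rp that by simp
  define C where "C = (\<Prod>k\<in>UNIV. inverse (1 - cmod (z $ k) / r))"
  have Re: "0 \<le> R + e"
    by (rule order_trans[OF norm_ge_zero bnd[of "\<chi> k. of_real r"]]) (use rp in simp)
  have pw: "cmod (f z) ^ m \<le> (R + e) ^ m * C" for m
  proof -
    have "cmod ((f z) ^ m) \<le> (R + e) ^ m * C"
      unfolding C_def by (rule torus_cauchy_bound[OF holo_power[OF f] rp r(2) zr])
        (use bnd in \<open>auto simp: norm_power intro: power_mono\<close>)
    then show ?thesis by (simp add: norm_power)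
  qed
  show "cmod (f z) \<le> R + e"
  proof (rule ccontr)
    assume "\<not> cmod (f z) \<le> R + e"
    then have gt: "R + e < cmod (f z)" by simp
    show False
    \<comment> \<open>The quotient used below requires \<open>R + e\<close> to be nonzero; otherwise
      the first power already contradicts the assumption.\<close>
    proof (cases "R + e = 0")
      case True
      then show False using pw[of 1] gt by simp
    next
      case False
      then have pos: "0 < R + e" using Re by simp
      have "1 < cmod (f z) / (R + e)" using gt pos by simp
      then obtain m where "C < (cmod (f z) / (R + e)) ^ m" using real_arch_pow by blast
      then show False using pw[of m] pos by (simp add: power_divide field_simps)
    qed
  qed
qed

section \<open>Second-order estimates\<close>

text \<open>Cauchy's inequalities on the disc of radius \<open>s\<close> bound the tail from the
  second coefficient on by \<open>M / s^2\<close> times a geometric series, whose sum is at most 2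
  since \<open>s \<ge> 2\<close>.\<close>

lemma taylor2_bound_1d:
  fixes g :: "complex \<Rightarrow> complex"
  assumes hol: "g holomorphic_on U" and U: "open U" "cball 0 s \<subseteq> U" and s: "2 \<le> s"
    and M: "\<And>x. x \<in> cball 0 s \<Longrightarrow> cmod (g x) \<le> M"
  shows "cmod (g 1 - g 0 - deriv g 0) \<le> 2 * M / s\<^sup>2"
proof -
  have sp: "0 < s" using s by simp
  define a where "a = (\<lambda>n. (deriv ^^ n) g 0 / fact n)"
  have hb: "g holomorphic_on ball 0 s" using hol U(2) ball_subset_cball holomorphic_on_subset by blast
  have cb: "continuous_on (cball 0 s) g" using hol U(2) holomorphic_on_imp_continuous_on holomorphic_on_subset by blast
  have an: "cmod (a n) \<le> M * (1/s) ^ n" for n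
  proof -
    have "norm ((deriv ^^ n) g 0) \<le> fact n * M / s ^ n"
      by (rule Cauchy_inequality[OF hb cb sp]) (use M in auto)
    then show ?thesis by (simp add: a_def norm_divide field_simps)
  qed
  have "(\<lambda>n. (deriv ^^ n) g 0 / fact n * (1 - 0) ^ n) sums g 1"
    by (rule holomorphic_power_series[OF hb]) (use s in auto)
  then have "a sums g 1" by (simp add: a_def)
  then have "(\<lambda>n. a (n + 2)) sums (g 1 - (\<Sum>i<2. a i))" by (rule sums_split_initial_segment)
  moreover have "(\<Sum>i<2. a i) = g 0 + deriv g 0" by (simp add: a_def numeral_2_eq_2)
  ultimately have sm: "(\<lambda>n. a (n + 2)) sums (g 1 - g 0 - deriv g 0)" by (simp add: diff_diff_eq)
  have geo: "(\<lambda>n. M * (1/s) ^ (n + 2)) sums (M * (1/s)\<^sup>2 * (1 / (1 - 1/s)))"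
  proof -
    have "(\<lambda>n. (M * (1/s)\<^sup>2) * (1/s) ^ n) sums ((M * (1/s)\<^sup>2) * (1 / (1 - 1/s)))"
      by (intro sums_mult geometric_sums) (use s in simp)
    then show ?thesis by (simp only: power_add mult_ac)
  qed
  have "cmod (g 1 - g 0 - deriv g 0) \<le> M * (1/s)\<^sup>2 * (1 / (1 - 1/s))"
    by (rule norm_sums_le[OF sm geo]) (rule an)
  also have "\<dots> \<le> M * (1/s)\<^sup>2 * 2"
  proof (rule mult_left_mono)
    show "1 / (1 - 1/s) \<le> 2" using s by (simp add: field_simps)
    have "0 \<le> M" using M[of 0] sp norm_ge_zero[of "g 0"] by (simp del: norm_ge_zero)
    then show "0 \<le> M * (1/s)\<^sup>2" by simp
  qed
  finally show ?thesis by (simp add: power_divide mult.commute)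
qed

lemma norm_vector_smult: "norm (c *s (v :: complex^'n)) = cmod c * norm v"
  by (simp add: norm_vec_def norm_mult L2_set_right_distrib)

lemma holo_taylor2:
  fixes f :: "complex^'n \<Rightarrow> complex"
  assumes f: "holo_on f S" and S: "ball z d \<subseteq> S" and M: "\<And>x. x \<in> ball z d \<Longrightarrow> cmod (f x) \<le> M"
    and d: "0 < d" and h: "norm h \<le> d / 4"
  shows "cmod (f (z + h) - f z - frechet_derivative f (at z) h) \<le> 8 * M / d\<^sup>2 * (norm h)\<^sup>2"
proof (cases "h = 0")
  case True
  have "z \<in> S" using S d by auto
  then have "frechet_derivative f (at z) 0 = 0"
    using linear_0[OF has_derivative_linear[OF holo_onD(1)[OF f]]] by simp
  then show ?thesis using True by simp
next
  case False
  then have hp: "0 < norm h" by simp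
  \<comment> \<open>Along the line through \<open>z\<close> in direction \<open>h\<close> the disc
    of radius \<open>d / norm h\<close> is available. Half of it is used, so
    \<open>2 * M / s\<^sup>2\<close> becomes \<open>8 * M * (norm h)\<^sup>2 / d\<^sup>2\<close>,
    and \<open>norm h \<le> d / 4\<close> is exactly \<open>2 \<le> s\<close>.\<close>
  define s where "s = d / (2 * norm h)"
  define g where "g = (\<lambda>\<zeta>. f (z + \<zeta> *s h))"
  define U where "U = ball (0::complex) (d / norm h)"
  have inb: "z + \<zeta> *s h \<in> ball z d" if "\<zeta> \<in> U" for \<zeta>
    using that hp by (simp add: U_def dist_norm norm_vector_smult field_simps)
  have der: "(g has_field_derivative frechet_derivative f (at (z + \<zeta> *s h)) h) (at \<zeta>)" if "\<zeta> \<in> U" for \<zeta>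
    unfolding g_def by (rule holo_line_derivative[OF f]) (use inb[OF that] S in auto)
  have hol: "g holomorphic_on U"
    unfolding holomorphic_on_def field_differentiable_def using der has_field_derivative_at_within by blast
  have s2: "2 \<le> s" using h hp by (simp add: s_def field_simps)
  have sub: "cball 0 s \<subseteq> U"
  proof -
    have "s < d / norm h" using d hp by (simp add: s_def field_simps)
    then show ?thesis by (auto simp: U_def)
  qed
  have "cmod (g 1 - g 0 - deriv g 0) \<le> 2 * M / s\<^sup>2"
    by (rule taylor2_bound_1d[OF hol _ sub s2]) (use sub inb M in \<open>auto simp: g_def U_def\<close>)
  moreover have "deriv g 0 = frechet_derivative f (at z) h"
    using DERIV_imp_deriv[OF der[of 0]] d hp by (simp add: U_def)
  ultimately show ?thesis using hp d by (simp add: g_def s_def field_simps power2_eq_square)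
qed

lemma scale_to_norm:
  fixes L :: "complex^'n \<Rightarrow> complex"
  assumes L: "\<And>c v. L (c *s v) = c * L v" and e: "0 < e"
    and B: "\<And>v. norm v = e \<Longrightarrow> cmod (L v) \<le> B * e"
  shows "cmod (L v) \<le> B * norm v"
proof (cases "v = 0")
  case True
  then show ?thesis using L[of 0 v] by simp
next
  case False
  then have vp: "0 < norm v" by simp
  have "norm (of_real (e / norm v) *s v) = e" using vp e by (simp add: norm_vector_smult norm_divide)
  from B[OF this] have "e / norm v * cmod (L v) \<le> B * e"
    using vp e by (simp add: L norm_mult norm_divide)
  then show ?thesis using vp e by (simp add: field_simps)
qed

text \<open>On vectors of norm \<open>d / 4\<close> the second-order remainder is at most
  \<open>M / 2\<close>; adding the two values of \<open>f\<close> gives \<open>5 * M / 2\<close>,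
  which is \<open>10 * M / d\<close> times that norm. Homogeneity does the rest.\<close>

lemma holo_derivative_bound:
  fixes f :: "complex^'n \<Rightarrow> complex"
  assumes f: "holo_on f S" and S: "ball z d \<subseteq> S" and M: "\<And>x. x \<in> ball z d \<Longrightarrow> cmod (f x) \<le> M"
    and d: "0 < d"
  shows "cmod (frechet_derivative f (at z) h) \<le> 10 * M / d * norm h"
proof (rule scale_to_norm[where e = "d / 4"])
  have zS: "z \<in> S" using S d by auto
  show "frechet_derivative f (at z) (c *s v) = c * frechet_derivative f (at z) v" for c v
    by (rule holo_onD(2)[OF f zS])
  fix v :: "complex^'n" assume v: "norm v = d / 4"
  have "cmod (f (z + v) - f z - frechet_derivative f (at z) v) \<le> 8 * M / d\<^sup>2 * (norm v)\<^sup>2"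
    by (rule holo_taylor2[OF f S M d]) (use v in auto)
  also have "\<dots> = M / 2" unfolding v using d by (simp add: power2_eq_square field_simps)
  finally have 1: "cmod (f (z + v) - f z - frechet_derivative f (at z) v) \<le> M / 2" .
  have 2: "cmod (f (z + v)) \<le> M" "cmod (f z) \<le> M"
    using d v by (auto intro!: M simp: dist_norm)
  have "cmod (frechet_derivative f (at z) v) \<le> cmod (f (z + v)) + cmod (f z) + cmod (f (z + v) - f z - frechet_derivative f (at z) v)"
    by norm
  then show "cmod (frechet_derivative f (at z) v) \<le> 10 * M / d * (d / 4)"
    using 1 2 d by simp
qed (use d in simp)

text \<open>For \<open>norm v = norm y\<close> the difference of the derivatives at \<open>v\<close>
  is a combination of three second-order remainders: at \<open>y\<close> in direction
  \<open>v\<close>, at 0 in direction \<open>y + v\<close>, and at 0 in direction \<open>y\<close>.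
  In units of \<open>8 * M / d\<^sup>2 * (norm y)\<^sup>2\<close> they cost 4, 4 and 1, whence the
  72.\<close>

lemma holo_derivative_difference:
  fixes f :: "complex^'n \<Rightarrow> complex"
  assumes f: "holo_on f S" and S: "ball 0 d \<subseteq> S" and M: "\<And>x. x \<in> ball 0 d \<Longrightarrow> cmod (f x) \<le> M"
    and d: "0 < d" and y: "norm y \<le> d / 8"
  shows "cmod (frechet_derivative f (at y) h - frechet_derivative f (at 0) h) \<le> 72 * M / d\<^sup>2 * norm y * norm h"
proof (cases "y = 0")
  case False
  then have yp: "0 < norm y" by simp
  define C where "C = 8 * M / d\<^sup>2"
  have z0: "0 \<in> S" and yS: "y \<in> S" using S d y by auto
  have suby: "ball y (d/2) \<subseteq> ball 0 d"
  proof
    fix x assume "x \<in> ball y (d/2)"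
    then have "norm (x - y) < d/2" by (simp add: dist_norm norm_minus_commute)
    then show "x \<in> ball 0 d" using y d norm_triangle_sub[of x y] by simp
  qed
  show ?thesis
  proof (rule scale_to_norm[where e = "norm y"])
    show "frechet_derivative f (at y) (c *s v) - frechet_derivative f (at 0) (c *s v) =
        c * (frechet_derivative f (at y) v - frechet_derivative f (at 0) v)" for c v
      by (simp add: holo_onD(2)[OF f z0] holo_onD(2)[OF f yS] right_diff_distrib)
    fix v :: "complex^'n" assume v: "norm v = norm y"
    have nyv: "norm (y + v) \<le> 2 * norm y" using norm_triangle_ineq[of y v] v by simp
    have 1: "cmod (f (y + v) - f y - frechet_derivative f (at y) v) \<le> 4 * C * (norm y)\<^sup>2"
    proof -
      have "cmod (f (y + v) - f y - frechet_derivative f (at y) v) \<le> 8 * M / (d/2)\<^sup>2 * (norm v)\<^sup>2"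
        by (rule holo_taylor2[OF f]) (use suby S M d v y in auto)
      then show ?thesis by (simp add: C_def v power_divide field_simps)
    qed
    have 2: "cmod (f (0 + (y + v)) - f 0 - frechet_derivative f (at 0) (y + v)) \<le> C * (norm (y + v))\<^sup>2"
      unfolding C_def by (rule holo_taylor2[OF f S M d]) (use nyv y in auto)
    have 3: "cmod (f (0 + y) - f 0 - frechet_derivative f (at 0) y) \<le> C * (norm y)\<^sup>2"
      unfolding C_def by (rule holo_taylor2[OF f S M d]) (use y d in auto)
    have "0 \<le> M" using M[of 0] d norm_ge_zero[of "f 0"] by (simp del: norm_ge_zero)
    then have C0: "0 \<le> C" using d by (simp add: C_def)
    have "(norm (y + v))\<^sup>2 \<le> 4 * (norm y)\<^sup>2"
      using power_mono[OF nyv, of 2] by (simp add: power_mult_distrib)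
    then have twice: "cmod (f (y + v) - f 0 - frechet_derivative f (at 0) (y + v)) \<le> 4 * C * (norm y)\<^sup>2"
      using 2 mult_left_mono[OF _ C0, of "(norm (y + v))\<^sup>2" "4 * (norm y)\<^sup>2"] by simp
    have lin: "frechet_derivative f (at 0) (y + v) = frechet_derivative f (at 0) y + frechet_derivative f (at 0) v"
      using linear_add[OF has_derivative_linear[OF holo_onD(1)[OF f z0]]] .
    have "frechet_derivative f (at y) v - frechet_derivative f (at 0) v =
        (f (y + v) - f 0 - frechet_derivative f (at 0) (y + v)) - (f (y + v) - f y - frechet_derivative f (at y) v)
        - (f y - f 0 - frechet_derivative f (at 0) y)"
      unfolding lin by simp
    moreover have "cmod (a - b - c) \<le> cmod a + cmod b + cmod c" for a b c :: complex
      by norm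
    ultimately have "cmod (frechet_derivative f (at y) v - frechet_derivative f (at 0) v) \<le>
        cmod (f (y + v) - f 0 - frechet_derivative f (at 0) (y + v)) + cmod (f (y + v) - f y - frechet_derivative f (at y) v)
        + cmod (f y - f 0 - frechet_derivative f (at 0) y)"
      by metis
    also have "\<dots> \<le> 4 * C * (norm y)\<^sup>2 + 4 * C * (norm y)\<^sup>2 + C * (norm y)\<^sup>2"
      using 1 twice 3 by simp
    finally show "cmod (frechet_derivative f (at y) v - frechet_derivative f (at 0) v) \<le> 72 * M / d\<^sup>2 * norm y * norm y"
      by (simp add: C_def power2_eq_square)
  qed (use yp in simp)
next
  case True
  then show ?thesis by simp
qed

lemma norm_nth_le_vec: "cmod (x $ i) \<le> norm (x :: complex^'n)"
  by (rule Finite_Cartesian_Product.norm_nth_le)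

lemma ball_subset_polydisc: "ball 0 d \<subseteq> (polydisc d :: (complex^'n) set)"
  using norm_nth_le_vec by (fastforce simp: polydisc_def intro: le_less_trans)

lemma zero_in_disc: "0 \<in> \<D>"
  by (simp add: polydisc_def)

text \<open>The expansion at \<open>y\<close> costs \<open>128 * M\<close> and replacing the
  derivative at \<open>y\<close> by the one at 0 costs \<open>288 * M\<close>, together 416. The
  radius 1/32 makes both estimates applicable within the ball of radius 1/2.\<close>

lemma holo_difference_at_0:
  fixes f :: "complex^'n \<Rightarrow> complex"
  assumes f: "holo_on f \<D>"
  obtains K \<delta> where "0 < \<delta>" "0 \<le> K"
    "\<And>x y. norm x \<le> \<delta> \<Longrightarrow> norm y \<le> \<delta> \<Longrightarrow>
      cmod (f x - f y - frechet_derivative f (at 0) (x - y)) \<le> K * (norm x + norm y) * norm (x - y)"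
proof -
  have cb: "cball 0 (1/2) \<subseteq> (\<D> :: (complex^'n) set)"
    using ball_subset_polydisc[of 1] by force
  have S: "ball 0 (1/2) \<subseteq> (\<D> :: (complex^'n) set)" using cb ball_subset_cball by blast
  have "bounded (f ` cball 0 (1/2))"
    by (intro compact_imp_bounded compact_continuous_image continuous_on_subset[OF holo_on_continuous_on[OF f] cb]) auto
  then obtain M where M: "\<And>x. x \<in> cball 0 (1/2) \<Longrightarrow> cmod (f x) \<le> M"
    unfolding bounded_iff by blast
  then have Mb: "\<And>x. x \<in> ball 0 (1/2) \<Longrightarrow> cmod (f x) \<le> M" by simp
  have M0: "0 \<le> M" using M[of 0] norm_ge_zero[of "f 0"] by (simp del: norm_ge_zero)
  show ?thesis
  proof
    show "0 < (1/32::real)" "0 \<le> 416 * M" using M0 by auto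
    fix x y :: "complex^'n" assume x: "norm x \<le> 1/32" and y: "norm y \<le> 1/32"
    have xy: "norm (x - y) \<le> 1/16" using norm_triangle_ineq4[of x y] x y by simp
    have sub: "ball y (1/4) \<subseteq> ball 0 (1/2)"
    proof
      fix w assume "w \<in> ball y (1/4)"
      then have "norm (w - y) < 1/4" by (simp add: dist_norm norm_minus_commute)
      then show "w \<in> ball 0 (1/2)" using y norm_triangle_sub[of w y] by simp
    qed
    have 1: "cmod (f (y + (x - y)) - f y - frechet_derivative f (at y) (x - y)) \<le> 8 * M / (1/4)\<^sup>2 * (norm (x - y))\<^sup>2"
      by (rule holo_taylor2[OF f]) (use sub S Mb xy in auto)
    have 2: "cmod (frechet_derivative f (at y) (x - y) - frechet_derivative f (at 0) (x - y)) \<le>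
        72 * M / (1/2)\<^sup>2 * norm y * norm (x - y)"
      by (rule holo_derivative_difference[OF f S Mb]) (use y in auto)
    have "cmod (f x - f y - frechet_derivative f (at 0) (x - y)) \<le>
        cmod (f (y + (x - y)) - f y - frechet_derivative f (at y) (x - y)) +
        cmod (frechet_derivative f (at y) (x - y) - frechet_derivative f (at 0) (x - y))"
      using norm_triangle_ineq[of "f x - f y - frechet_derivative f (at y) (x - y)"
          "frechet_derivative f (at y) (x - y) - frechet_derivative f (at 0) (x - y)"]
      unfolding add_diff_eq diff_add_cancel add_diff_cancel_left' by (simp only: add_diff_eq diff_add_cancel)
    also have "\<dots> \<le> 128 * M * norm (x - y) * norm (x - y) + 288 * M * norm y * norm (x - y)"
      using 1 2 by (simp add: power2_eq_square)
    also have "\<dots> \<le> 128 * M * (norm x + norm y) * norm (x - y) + 288 * M * (norm x + norm y) * norm (x - y)"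
      using M0 norm_triangle_ineq4[of x y] by (intro add_mono mult_right_mono mult_left_mono) auto
    finally show "cmod (f x - f y - frechet_derivative f (at 0) (x - y)) \<le> 416 * M * (norm x + norm y) * norm (x - y)"
      by (simp add: algebra_simps)
  qed
qed

section \<open>Taylor coefficients of low degree\<close>

lemma norm_le_card_mult:
  assumes "\<And>k. cmod (z $ k) \<le> r"
  shows "norm (z :: complex^'n) \<le> real CARD('n) * r"
proof -
  have "norm z \<le> (\<Sum>k\<in>UNIV. cmod (z $ k))" unfolding norm_vec_def by (rule L2_set_le_sum) auto
  also have "\<dots> \<le> (\<Sum>k\<in>(UNIV::'n set). r)" by (intro sum_mono assms)
  finally show ?thesis by simp
qed

text \<open>On the torus of radius \<open>r\<close> the norm is at most \<open>N * r\<close>, so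
  Cauchy's estimate bounds a coefficient of degree at most \<open>d\<close> by a multiple of
  \<open>r\<close>; then \<open>r\<close> tends to 0.\<close>

lemma taylor_vanish:
  fixes g :: "complex^'n \<Rightarrow> complex"
  assumes g: "holo_on g \<D>" and \<delta>: "0 < \<delta>"
    and bnd: "\<And>z. norm z \<le> \<delta> \<Longrightarrow> cmod (g z) \<le> C * norm z ^ Suc d" and \<alpha>: "deg \<alpha> \<le> d"
  shows "taylor g \<alpha> = 0"
proof -
  define N where "N = real CARD('n)"
  have N: "1 \<le> N" unfolding N_def using one_le_card_finite[where 'a='n] by linarith
  define C' where "C' = \<bar>C\<bar> * N ^ Suc d"
  \<comment> \<open>The bound 1/2 keeps the torus inside \<open>\<D>\<close>, and
    \<open>\<delta> / N\<close> keeps it inside the ball where \<open>g\<close> is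
    controlled.\<close>
  define r0 where "r0 = min (1/2) (\<delta> / N)"
  have r0: "0 < r0" using \<delta> N by (simp add: r0_def)
  have "cmod (taylor g \<alpha>) \<le> C' * r" if r: "0 < r" "r < r0" for r
  proof -
    have r1: "r < 1" using r by (simp add: r0_def)
    have "cmod (taylor g \<alpha>) * r ^ deg \<alpha> \<le> \<bar>C\<bar> * (N * r) ^ Suc d"
    proof (rule taylor_cauchy_estimate[OF g r(1) r1])
      fix z :: "complex^'n" assume z: "\<And>k. cmod (z $ k) = r"
      have nz: "norm z \<le> N * r" unfolding N_def by (rule norm_le_card_mult) (simp add: z)
      also have "N * r \<le> \<delta>" using r N by (simp add: r0_def field_simps)
      finally have "cmod (g z) \<le> C * norm z ^ Suc d" by (rule bnd)
      also have "\<dots> \<le> \<bar>C\<bar> * norm z ^ Suc d" by (intro mult_right_mono) auto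
      also have "\<dots> \<le> \<bar>C\<bar> * (N * r) ^ Suc d" using nz by (intro mult_left_mono power_mono) auto
      finally show "cmod (g z) \<le> \<bar>C\<bar> * (N * r) ^ Suc d" .
    qed
    also have "\<dots> = C' * r ^ Suc d" by (simp add: C'_def power_mult_distrib)
    also have "\<dots> = C' * r * r ^ d" by simp
    also have "\<dots> \<le> C' * r * r ^ deg \<alpha>"
      using r r1 \<alpha> N by (intro mult_left_mono power_decreasing) (auto simp: C'_def)
    finally show ?thesis using r by simp
  qed
  then have "\<forall>\<^sub>F r in at_right 0. cmod (taylor g \<alpha>) \<le> C' * r"
    using eventually_at_right_real[OF r0] by (auto elim: eventually_mono)
  moreover have "((\<lambda>r. C' * r) \<longlongrightarrow> C' * 0) (at_right 0)" by (intro tendsto_intros)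
  ultimately have "cmod (taylor g \<alpha>) \<le> C' * 0"
    by (intro tendsto_lowerbound) auto
  then show ?thesis by simp
qed

lemma deg_unit_index: "deg (unit_index k) = 1"
  by (simp add: deg_def unit_index_def)

lemma vmono_unit_index: "vmono z (unit_index k) = z $ k"
proof -
  have "vmono z (unit_index k) = (\<Prod>j\<in>UNIV. if j = k then z $ j else 1)"
    unfolding vmono_def by (intro prod.cong) (auto simp: unit_index_def)
  then show ?thesis by simp
qed

lemma frechet_derivative_coords:
  assumes f: "holo_on f S" and z: "z \<in> S"
  shows "frechet_derivative f (at z) v = (\<Sum>k\<in>UNIV. frechet_derivative f (at z) (axis k 1) * v $ k)"
proof -
  have lin: "linear (frechet_derivative f (at z))" by (rule has_derivative_linear[OF holo_onD(1)[OF f z]])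
  have "v = (\<Sum>k\<in>UNIV. v $ k *s axis k 1)"
    by (simp add: vec_eq_iff axis_def if_distrib[of "\<lambda>x. _ * x"] cong: if_cong)
  then have "frechet_derivative f (at z) v = (\<Sum>k\<in>UNIV. frechet_derivative f (at z) (v $ k *s axis k 1))"
    using linear_sum[OF lin] by metis
  then show ?thesis by (simp add: holo_onD(2)[OF f z] mult.commute)
qed

lemma unit_index_inj: "unit_index j = unit_index k \<longleftrightarrow> j = k"
  by (metis one_neq_zero unit_index_def)

lemma has_sum_finite_sum:
  fixes f :: "'i \<Rightarrow> 'a \<Rightarrow> 'b::topological_comm_monoid_add"
  assumes "\<And>i. i \<in> I \<Longrightarrow> (f i has_sum s i) A"
  shows "((\<lambda>x. \<Sum>i\<in>I. f i x) has_sum (\<Sum>i\<in>I. s i)) A"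
  using assms by (induction I rule: infinite_finite_induct) (auto intro!: has_sum_add)

text \<open>After subtraction of the affine part at 0 a quadratically small function is left, whose
  coefficients of degree at most 1 vanish. The affine part is written with \<open>vmono\<close> so
  that its coefficients are visible.\<close>

lemma taylor_unit_index:
  fixes f :: "complex^'n \<Rightarrow> complex"
  assumes f: "holo_on f \<D>"
  shows "taylor f (unit_index k) = frechet_derivative f (at 0) (axis k 1)"
proof -
  define L where "L = (\<lambda>z. \<Sum>k\<in>UNIV. frechet_derivative f (at 0) (axis k 1) * vmono z (unit_index k))"
  have L: "L z = frechet_derivative f (at 0) z" for z
    unfolding L_def vmono_unit_index by (rule frechet_derivative_coords[OF f zero_in_disc, symmetric])
  have hL: "holo_on L \<D>" unfolding L_def by (intro holo_sum holo_cmult holo_vmono)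
  define c0 where "c0 = (\<lambda>z::complex^'n. f 0 * vmono z (\<lambda>_. 0))"
  have hc: "holo_on c0 \<D>" unfolding c0_def by (intro holo_cmult holo_vmono)
  have c0: "c0 z = f 0" for z by (simp add: c0_def vmono_def)
  obtain K \<delta> where K: "0 < \<delta>" "0 \<le> K"
    "\<And>x y. norm x \<le> \<delta> \<Longrightarrow> norm y \<le> \<delta> \<Longrightarrow>
      cmod (f x - f y - frechet_derivative f (at 0) (x - y)) \<le> K * (norm x + norm y) * norm (x - y)"
    using holo_difference_at_0[OF f] by metis
  have "taylor (\<lambda>z. (f z - c0 z) - L z) (unit_index k) = 0"
  proof (rule taylor_vanish[OF _ K(1)])
    show "holo_on (\<lambda>z. f z - c0 z - L z) \<D>" by (intro holo_diff f hc hL)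
    show "cmod (f z - c0 z - L z) \<le> K * norm z ^ Suc 1" if "norm z \<le> \<delta>" for z
      using K(3)[OF that, of 0] K(1) by (simp add: c0 L power2_eq_square mult.assoc numeral_2_eq_2[symmetric])
  qed (simp add: deg_unit_index)
  moreover have "taylor c0 (unit_index k) = 0"
    unfolding c0_def taylor_cmult[OF holo_vmono] taylor_vmono
    by (auto simp: unit_index_def fun_eq_iff intro: exI[of _ k])
  moreover have "taylor L (unit_index k) = frechet_derivative f (at 0) (axis k 1)"
  proof -
    have "taylor L = (\<lambda>\<alpha>. \<Sum>j\<in>UNIV. frechet_derivative f (at 0) (axis j 1) * (if \<alpha> = unit_index j then 1 else 0))"
    proof (rule taylor_eqI[OF holo_on_continuous_on[OF hL]])
      fix z :: "complex^'n" assume z: "z \<in> \<D>"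
      have "((\<lambda>\<alpha>. \<Sum>j\<in>UNIV. frechet_derivative f (at 0) (axis j 1) * (taylor (\<lambda>z. vmono z (unit_index j)) \<alpha> * vmono z \<alpha>)) has_sum L z) UNIV"
        unfolding L_def by (intro has_sum_finite_sum has_sum_cmult_right taylor_has_sum holo_vmono z)
      then show "((\<lambda>\<alpha>. (\<Sum>j\<in>UNIV. frechet_derivative f (at 0) (axis j 1) * (if \<alpha> = unit_index j then 1 else 0)) * vmono z \<alpha>) has_sum L z) UNIV"
        unfolding taylor_vmono by (simp add: sum_distrib_right mult.assoc)
    qed
    then show ?thesis by (simp add: unit_index_inj if_distrib[of "\<lambda>x. _ * x"] cong: if_cong)
  qed
  ultimately show ?thesis
    by (simp add: taylor_diff[OF holo_diff[OF f hc] hL] taylor_diff[OF f hc])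
qed

section \<open>Eigencoordinates\<close>

text \<open>Applying \<open>T\<close> minus \<open>lam k\<close> to a relation removes the term of
  \<open>k\<close> and multiplies the others by nonzero factors.\<close>

lemma eigenvectors_independent:
  fixes w :: "'n \<Rightarrow> complex^'m" and T :: "complex^'m \<Rightarrow> complex^'m"
  assumes T: "\<And>x y. T (x + y) = T x + T y" "\<And>c x. T (c *s x) = c *s T x"
    and eig: "\<And>j. T (w j) = lam j *s w j" and ne: "\<And>j. w j \<noteq> 0" and inj: "inj lam"
    and S: "finite S" and sum: "(\<Sum>j\<in>S. c j *s w j) = 0" and j: "j \<in> S"
  shows "c j = 0"
  using S sum j
proof (induction S arbitrary: c j rule: finite_induct)
  case (insert k S)
  have T0: "T 0 = 0" using T(2)[of 0 0] by simp
  have Tsum: "T (\<Sum>j\<in>A. f j) = (\<Sum>j\<in>A. T (f j))" if "finite A" for A and f :: "'n \<Rightarrow> complex^'m"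
    using that by (induction A rule: finite_induct) (simp_all add: T0 T(1))
  have s: "c k *s w k + (\<Sum>j\<in>S. c j *s w j) = 0" using insert by simp
  have "T (c k *s w k + (\<Sum>j\<in>S. c j *s w j)) - lam k *s (c k *s w k + (\<Sum>j\<in>S. c j *s w j)) = 0"
    unfolding s by (simp add: T0)
  then have "(\<Sum>j\<in>S. c j *s (lam j *s w j)) - lam k *s (\<Sum>j\<in>S. c j *s w j) = 0"
    by (simp add: T Tsum[OF insert.hyps(1)] eig vector_add_ldistrib vector_smult_assoc mult.commute)
  moreover have "lam k *s (\<Sum>j\<in>S. c j *s w j) = (\<Sum>j\<in>S. c j *s (lam k *s w j))"
    by (simp add: vec_eq_iff sum_distrib_left mult_ac)
  ultimately have "(\<Sum>j\<in>S. (c j * (lam j - lam k)) *s w j) = 0"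
    by (simp add: sum_subtractf[symmetric] vec_eq_iff algebra_simps)
  then have *: "c i * (lam i - lam k) = 0" if "i \<in> S" for i
    using insert.IH[of "\<lambda>j. c j * (lam j - lam k)" i] that by blast
  have cS: "c i = 0" if i: "i \<in> S" for i
  proof -
    have "i \<noteq> k" using i insert.hyps by auto
    then have "lam i \<noteq> lam k" using inj by (auto dest: injD)
    then show ?thesis using *[OF i] by simp
  qed
  then have "c k *s w k = 0" using s by (simp add: sum.neutral)
  then have "c k = 0" using ne[of k] by (auto simp: vec_eq_iff)
  then show ?case using cS insert.prems by auto
qed simp

text \<open>The rows of \<open>W\<close> are left eigenvectors of \<open>J\<close>, which exist
  since the characteristic polynomial vanishes at each \<open>lam j\<close> and are independent
  since the eigenvalues are distinct. The columns of \<open>V\<close> are then right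
  eigenvectors.\<close>

lemma eigencoordinates:
  fixes J :: "complex^'n^'n"
  assumes "simple_eigenvalues J lam"
  obtains W V where "W ** V = mat 1" "V ** W = mat 1"
    "\<And>j x. (W *v (J *v x)) $ j = lam j * (W *v x) $ j"
proof -
  have inj: "inj lam" using assms by (simp add: simple_eigenvalues_def)
  have char: "det (mat x - J) = (\<Prod>j\<in>UNIV. x - lam j)" for x
    using assms by (simp add: simple_eigenvalues_def)
  have "\<exists>w. w \<noteq> 0 \<and> transpose J *v w = lam j *s w" for j
  proof -
    have "(\<Prod>i\<in>UNIV. lam j - lam i) = 0" by (rule prod_zero) auto
    then have "det (transpose (mat (lam j) - J)) = 0" by (simp add: char det_transpose)
    then have "\<not> (\<exists>B. B ** transpose (mat (lam j) - J) = mat 1)"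
      using invertible_det_nz invertible_left_inverse by blast
    then obtain w where w: "w \<noteq> 0" "transpose (mat (lam j) - J) *v w = 0"
      using matrix_left_invertible_ker by blast
    have "transpose (mat (lam j) - J) *v w = lam j *s w - transpose J *v w"
      by (simp add: vec_eq_iff matrix_vector_mult_def transpose_def mat_def left_diff_distrib sum_subtractf
          if_distrib[of "\<lambda>x. x * _"] cong: if_cong)
    then show ?thesis using w by (intro exI[of _ w]) simp
  qed
  then obtain w where w: "\<And>j. w j \<noteq> 0" "\<And>j. transpose J *v w j = lam j *s w j" by metis
  define W where "W = (\<chi> j. w j)"
  have "\<forall>c. (\<Sum>i\<in>UNIV. c i *s row i W) = 0 \<longrightarrow> (\<forall>i. c i = 0)"
  proof (intro allI impI)
    fix c i assume "(\<Sum>i\<in>UNIV. c i *s row i W) = 0"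
    then have "(\<Sum>i\<in>UNIV. c i *s w i) = 0" by (simp add: W_def row_def)
    then show "c i = 0"
      by (rule eigenvectors_independent[of "\<lambda>x. transpose J *v x" w lam, rotated -2])
        (use w inj in \<open>auto simp: matrix_vector_right_distrib vector_scalar_commute\<close>)
  qed
  then obtain V where V: "W ** V = mat 1"
    using matrix_right_invertible_independent_rows by blast
  then have V': "V ** W = mat 1" using matrix_left_right_inverse by blast
  have "(W ** J) $ j $ i = lam j * W $ j $ i" for j i
  proof -
    have "(transpose J *v w j) $ i = lam j * w j $ i" using w(2) by simp
    then show ?thesis
      by (simp add: matrix_matrix_mult_def W_def matrix_vector_mult_def transpose_def mult.commute)
  qed
  then have "(W *v (J *v x)) $ j = lam j * (W *v x) $ j" for j x
    unfolding matrix_vector_mul_assoc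
    by (simp add: matrix_vector_mult_def sum_distrib_left mult.assoc)
  then show ?thesis using that V V' by blast
qed

lemma bounded_linear_matrix: "bounded_linear (\<lambda>x. (A :: complex^'n^'m) *v x)"
proof -
  have "linear (\<lambda>x. A *v x)"
    by (intro linearI) (simp_all add: matrix_vector_right_distrib vector_smult_scaleR[symmetric] vector_scalar_commute)
  then show ?thesis by (simp add: linear_conv_bounded_linear)
qed

lemma matrix_norm_bound:
  fixes A :: "complex^'n^'m"
  obtains B where "0 < B" "\<And>x. norm (A *v x) \<le> B * norm x"
  using bounded_linear.pos_bounded[OF bounded_linear_matrix[of A]] by (metis mult.commute)

text \<open>The inner product is the real one, so each coordinate contributes only the real part of
  its eigenvalue.\<close>

lemma inner_diagonal_le:
  fixes y :: "complex^'n"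
  assumes "\<And>j. Re (lam j) \<le> - c"
  shows "y \<bullet> (\<chi> j. lam j * y $ j) \<le> - c * (norm y)\<^sup>2"
proof -
  have "y $ j \<bullet> (lam j * y $ j) = Re (lam j) * (cmod (y $ j))\<^sup>2" for j
    unfolding cmod_power2 by (simp add: inner_complex_def power2_eq_square algebra_simps)
  then have "y \<bullet> (\<chi> j. lam j * y $ j) = (\<Sum>j\<in>UNIV. Re (lam j) * (cmod (y $ j))\<^sup>2)"
    by (simp add: inner_vec_def)
  also have "\<dots> \<le> (\<Sum>j\<in>UNIV. - c * (cmod (y $ j))\<^sup>2)"
    using assms by (intro sum_mono mult_right_mono) auto
  also have "\<dots> = - c * (norm y)\<^sup>2"
    by (simp add: sum_distrib_left norm_vec_def L2_set_def sum_nonneg sum_negf)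
  finally show ?thesis .
qed

section \<open>Exponential decay of the flow\<close>

lemma flowD:
  assumes "holomorphic_flow F \<phi>"
  shows "\<And>i. holo_on (\<lambda>z. F z $ i) \<D>" "continuous_on (\<D> \<union> \<T>) F"
    "\<And>z. z \<in> \<D> \<Longrightarrow> \<phi> 0 z = z"
    "\<And>t z. 0 \<le> t \<Longrightarrow> z \<in> \<D> \<Longrightarrow> \<phi> t z \<in> \<D>"
    "\<And>s t z. 0 \<le> s \<Longrightarrow> 0 \<le> t \<Longrightarrow> z \<in> \<D> \<Longrightarrow> \<phi> (s + t) z = \<phi> s (\<phi> t z)"
    "\<And>t z. 0 \<le> t \<Longrightarrow> z \<in> \<D> \<Longrightarrow> ((\<lambda>s. \<phi> s z) has_vector_derivative F (\<phi> t z)) (at t within {0..})"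
    "\<And>t i. 0 \<le> t \<Longrightarrow> holo_on (\<lambda>z. \<phi> t z $ i) \<D>"
    "\<And>t. 0 \<le> t \<Longrightarrow> continuous_on (\<D> \<union> \<T>) (\<phi> t)"
  using assms unfolding holomorphic_flow_def by simp_all

lemma flow_continuous_time:
  assumes "holomorphic_flow F \<phi>" "z \<in> \<D>"
  shows "continuous_on {0..} (\<lambda>t. \<phi> t z)"
  unfolding continuous_on_eq_continuous_within
  using flowD(6)[OF assms(1) _ assms(2)] has_vector_derivative_continuous by (metis atLeast_iff)

lemma flow_deriv_at:
  assumes "holomorphic_flow F \<phi>" "z \<in> \<D>" "0 < t"
  shows "((\<lambda>s. \<phi> s z) has_vector_derivative F (\<phi> t z)) (at t)"
proof -
  have "((\<lambda>s. \<phi> s z) has_vector_derivative F (\<phi> t z)) (at t within {0<..})"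
    by (rule has_vector_derivative_within_subset[OF flowD(6)[OF assms(1) _ assms(2)]]) (use assms(3) in auto)
  then show ?thesis using assms(3) by (simp add: at_within_open[OF _ open_greaterThan])
qed

section \<open>First-order expansion of the vector field at the equilibrium\<close>

lemma jacobian_mult:
  fixes F :: "complex^'n \<Rightarrow> complex^'n"
  assumes "\<And>i. holo_on (\<lambda>z. F z $ i) \<D>"
  shows "(jacobian F 0 *v v) $ i = frechet_derivative (\<lambda>z. F z $ i) (at 0) v"
  unfolding frechet_derivative_coords[OF assms zero_in_disc, of i v]
  by (simp add: matrix_vector_mult_def jacobian_def partial_deriv_eq[OF assms zero_in_disc])

lemma holo_vector_difference_at_0:
  fixes G :: "complex^'n \<Rightarrow> complex^'m"
  assumes G: "\<And>i. holo_on (\<lambda>z. G z $ i) \<D>"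
  obtains K \<delta> where "0 < \<delta>" "0 \<le> K"
    "\<And>x y. norm x \<le> \<delta> \<Longrightarrow> norm y \<le> \<delta> \<Longrightarrow>
      norm (G x - G y - (\<chi> i. frechet_derivative (\<lambda>z. G z $ i) (at 0) (x - y))) \<le> K * (norm x + norm y) * norm (x - y)"
proof -
  have "\<exists>K \<delta>. 0 < \<delta> \<and> 0 \<le> K \<and> (\<forall>x y. norm x \<le> \<delta> \<longrightarrow> norm y \<le> \<delta> \<longrightarrow>
      cmod (G x $ i - G y $ i - frechet_derivative (\<lambda>z. G z $ i) (at 0) (x - y)) \<le> K * (norm x + norm y) * norm (x - y))" for i
    by (rule holo_difference_at_0[OF G[of i]]) blast
  then obtain K \<delta> where K: "\<And>i. 0 < \<delta> i" "\<And>i. 0 \<le> K i"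
    "\<And>i x y. norm x \<le> \<delta> i \<Longrightarrow> norm y \<le> \<delta> i \<Longrightarrow>
      cmod (G x $ i - G y $ i - frechet_derivative (\<lambda>z. G z $ i) (at 0) (x - y)) \<le> K i * (norm x + norm y) * norm (x - y)"
    by metis
  define d where "d = Min (range \<delta>)"
  have d: "d \<le> \<delta> i" for i unfolding d_def by (rule Min_le) auto
  have d0: "0 < d" unfolding d_def using K(1) by (subst Min_gr_iff) auto
  show ?thesis
  proof
    show "0 < d" by (rule d0)
    show "0 \<le> (\<Sum>i\<in>UNIV. K i)" by (intro sum_nonneg K)
    fix x y :: "complex^'n" assume x: "norm x \<le> d" and y: "norm y \<le> d"
    let ?e = "G x - G y - (\<chi> i. frechet_derivative (\<lambda>z. G z $ i) (at 0) (x - y))"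
    have "norm ?e \<le> (\<Sum>i\<in>UNIV. cmod (?e $ i))"
      unfolding norm_vec_def by (rule L2_set_le_sum) auto
    also have "\<dots> \<le> (\<Sum>i\<in>UNIV. K i * (norm x + norm y) * norm (x - y))"
      using K(3)[of x _ y] x y order_trans[OF _ d] by (intro sum_mono) simp
    finally show "norm ?e \<le> (\<Sum>i\<in>UNIV. K i) * (norm x + norm y) * norm (x - y)"
      by (simp add: sum_distrib_right)
  qed
qed

lemma vector_field_difference_at_0:
  fixes F :: "complex^'n \<Rightarrow> complex^'n"
  assumes F: "\<And>i. holo_on (\<lambda>z. F z $ i) \<D>"
  obtains K \<delta> where "0 < \<delta>" "0 \<le> K"
    "\<And>x y. norm x \<le> \<delta> \<Longrightarrow> norm y \<le> \<delta> \<Longrightarrow>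
      norm (F x - F y - jacobian F 0 *v (x - y)) \<le> K * (norm x + norm y) * norm (x - y)"
proof -
  have jac: "(\<chi> i. frechet_derivative (\<lambda>z. F z $ i) (at 0) v) = jacobian F 0 *v v" for v
    by (simp add: vec_eq_iff jacobian_mult[OF F])
  show ?thesis
  proof (rule holo_vector_difference_at_0[OF F])
    fix K \<delta> :: real
    assume K: "0 < \<delta>" "0 \<le> K"
      "\<And>x y. norm x \<le> \<delta> \<Longrightarrow> norm y \<le> \<delta> \<Longrightarrow>
        norm (F x - F y - (\<chi> i. frechet_derivative (\<lambda>z. F z $ i) (at 0) (x - y))) \<le> K * (norm x + norm y) * norm (x - y)"
    show ?thesis by (rule that[OF K(1,2)]) (rule K(3)[unfolded jac])
  qed
qed

lemma stable_hyperbolicD: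
  assumes "stable_hyperbolic F \<phi> lam"
  shows "F 0 = 0" "\<And>e. 0 < e \<Longrightarrow> \<exists>d>0. \<forall>z\<in>\<D>. norm z < d \<longrightarrow> (\<forall>t\<ge>0. norm (\<phi> t z) < e)"
    "closure \<D> \<subseteq> basin \<phi>" "simple_eigenvalues (jacobian F 0) lam" "\<And>j. Re (lam j) < 0"
  using assms unfolding stable_hyperbolic_def stable_equilibrium_def by blast+

lemma max_Re_negative:
  fixes lam :: "'n::finite \<Rightarrow> complex"
  assumes "\<And>j. Re (lam j) < 0"
  obtains c where "0 < c" "\<And>j. Re (lam j) \<le> - c"
proof -
  define m where "m = Max (range (\<lambda>j. Re (lam j)))"
  have "Re (lam j) \<le> m" for j unfolding m_def by (rule Max_ge) auto
  moreover have "m \<in> range (\<lambda>j. Re (lam j))" unfolding m_def by (rule Max_in) auto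
  ultimately show ?thesis using that[of "- m"] assms by auto
qed

text \<open>Lyapunov's argument in the eigencoordinates \<open>y\<close>. Stability confines the
  orbit to the ball of radius \<open>e\<close>, where the nonlinear part costs at most
  \<open>c / 2\<close> of the linear rate \<open>c\<close>; hence \<open>exp (c * t)\<close> times
  the squared norm of \<open>y\<close> does not increase, which is decay at rate
  \<open>c / 2\<close>.\<close>

lemma local_decay:
  fixes F :: "complex^'n \<Rightarrow> complex^'n"
  assumes flow: "holomorphic_flow F \<phi>" and hyp: "stable_hyperbolic F \<phi> lam"
  obtains c C \<delta> where "0 < c" "0 < C" "0 < \<delta>"
    "\<And>z t. z \<in> \<D> \<Longrightarrow> norm z < \<delta> \<Longrightarrow> 0 \<le> t \<Longrightarrow> norm (\<phi> t z) \<le> C * exp (- c * t) * norm z"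
proof -
  note hD = stable_hyperbolicD[OF hyp]
  obtain W V where WV: "W ** V = mat 1" "V ** W = mat 1"
    "\<And>j x. (W *v (jacobian F 0 *v x)) $ j = lam j * (W *v x) $ j"
    using eigencoordinates[OF hD(4)] by blast
  obtain BW where BW: "0 < BW" "\<And>x. norm (W *v x) \<le> BW * norm x" using matrix_norm_bound[of W] by blast
  obtain BV where BV: "0 < BV" "\<And>x. norm (V *v x) \<le> BV * norm x" using matrix_norm_bound[of V] by blast
  have xW: "norm x \<le> BV * norm (W *v x)" for x
    using BV(2)[of "W *v x"] WV(2) by (simp add: matrix_vector_mul_assoc)
  obtain c where c: "0 < c" "\<And>j. Re (lam j) \<le> - c" using max_Re_negative[of lam] hD(5) by blast
  obtain K \<delta> where K: "0 < \<delta>" "0 \<le> K"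
    "\<And>x y. norm x \<le> \<delta> \<Longrightarrow> norm y \<le> \<delta> \<Longrightarrow>
      norm (F x - F y - jacobian F 0 *v (x - y)) \<le> K * (norm x + norm y) * norm (x - y)"
    using vector_field_difference_at_0[OF flowD(1)[OF flow]] by metis
  \<comment> \<open>The summand 1 makes \<open>K'\<close> positive, so that it may be divided by
    even when the remainder constant \<open>K\<close> is 0.\<close>
  define K' where "K' = BW * K * BV + 1"
  have K': "0 < K'" using K(2) BW(1) BV(1) by (simp add: K'_def add_nonneg_pos)
  define e where "e = min \<delta> (c / (2 * K'))"
  have e: "0 < e" "e \<le> \<delta>" "K' * e \<le> c / 2" using K(1) c(1) K' by (auto simp: e_def min_def field_simps)
  obtain d where d: "0 < d" "\<And>z t. z \<in> \<D> \<Longrightarrow> norm z < d \<Longrightarrow> 0 \<le> t \<Longrightarrow> norm (\<phi> t z) < e"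
    using hD(2)[OF e(1)] by blast
  have main: "norm (\<phi> t z) \<le> (BV * BW) * exp (- (c/2) * t) * norm z" if z: "z \<in> \<D>" "norm z < d" and t: "0 \<le> t" for z t
  proof -
    define y where "y = (\<lambda>t. W *v \<phi> t z)"
    define E where "E = (\<lambda>t. exp (c * t) * (y t \<bullet> y t))"
    have sm: "norm (\<phi> s z) \<le> e" if "0 \<le> s" for s using d(2)[OF z that] by simp
    have dE: "\<exists>D. DERIV E s :> D \<and> D \<le> 0" if s: "0 < s" for s
    proof -
      let ?x = "\<phi> s z"
      define r where "r = W *v (F ?x - jacobian F 0 *v ?x)"
      have "((\<lambda>t. \<phi> t z) has_derivative (\<lambda>h. h *\<^sub>R F ?x)) (at s)"
        using flow_deriv_at[OF flow z(1) s] by (simp add: has_vector_derivative_def)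
      then have dy: "(y has_derivative (\<lambda>h. W *v (h *\<^sub>R F ?x))) (at s)"
        unfolding y_def by (rule bounded_linear.has_derivative[OF bounded_linear_matrix])
      have WF: "W *v F ?x = (\<chi> j. lam j * y s $ j) + r"
        unfolding r_def by (simp add: vec_eq_iff matrix_vector_mult_diff_distrib WV(3) y_def)
      have "(E has_derivative (\<lambda>h. exp (c * s) * (y s \<bullet> (W *v (h *\<^sub>R F ?x)) + (W *v (h *\<^sub>R F ?x)) \<bullet> y s) + (c * h * exp (c * s)) * (y s \<bullet> y s))) (at s)"
        unfolding E_def
        by (rule has_derivative_mult[OF _ has_derivative_inner[OF dy dy], THEN has_derivative_eq_rhs])
          (auto intro!: derivative_eq_intros)
      then have DE: "DERIV E s :> exp (c * s) * (2 * (y s \<bullet> (W *v F ?x)) + c * (y s \<bullet> y s))"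
        unfolding has_field_derivative_def
        by (rule has_derivative_eq_rhs)
          (simp add: fun_eq_iff bounded_linear.linear[OF bounded_linear_matrix] linear_scale inner_commute algebra_simps)
      have "norm r \<le> BW * (K * norm ?x * norm ?x)"
      proof -
        have "norm (F ?x - jacobian F 0 *v ?x) \<le> K * norm ?x * norm ?x"
          using K(3)[of ?x 0] sm[of s] s e hD(1) K(1) by simp
        then have "BW * norm (F ?x - jacobian F 0 *v ?x) \<le> BW * (K * norm ?x * norm ?x)"
          using BW(1) by (intro mult_left_mono) auto
        then show ?thesis unfolding r_def by (rule order_trans[OF BW(2)])
      qed
      also have "\<dots> \<le> BW * (K * e * (BV * norm (y s)))"
        using sm[of s] s xW[of ?x] BW(1) K(2) e(1) unfolding y_def by (intro mult_left_mono mult_mono) auto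
      also have "\<dots> \<le> (c / 2) * norm (y s)"
      proof -
        have "BW * K * BV * e \<le> K' * e" using e(1) by (simp add: K'_def)
        then have "BW * K * BV * e * norm (y s) \<le> (c / 2) * norm (y s)" using e(3) by (intro mult_right_mono) auto
        then show ?thesis by (simp add: mult_ac)
      qed
      finally have r: "norm r \<le> (c / 2) * norm (y s)" .
      have "y s \<bullet> r \<le> norm (y s) * norm r" by (rule norm_cauchy_schwarz)
      also have "\<dots> \<le> norm (y s) * ((c / 2) * norm (y s))" by (intro mult_left_mono r) auto
      finally have "y s \<bullet> r \<le> (c / 2) * (norm (y s))\<^sup>2" by (simp add: power2_eq_square mult_ac)
      moreover have "y s \<bullet> (\<chi> j. lam j * y s $ j) \<le> - c * (norm (y s))\<^sup>2"
        by (rule inner_diagonal_le[OF c(2)])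
      moreover have "y s \<bullet> y s = (norm (y s))\<^sup>2" by (simp add: power2_norm_eq_inner)
      ultimately have "2 * (y s \<bullet> (W *v F ?x)) + c * (y s \<bullet> y s) \<le> 0"
        unfolding WF inner_add_right by simp
      then have "exp (c * s) * (2 * (y s \<bullet> (W *v F ?x)) + c * (y s \<bullet> y s)) \<le> 0"
        by (intro mult_nonneg_nonpos) auto
      then show ?thesis using DE by blast
    qed
    have "continuous_on {0..t} (\<lambda>t. \<phi> t z)"
      using flow_continuous_time[OF flow z(1)] by (rule continuous_on_subset) auto
    then have "continuous_on {0..t} E"
      unfolding E_def y_def by (intro continuous_intros bounded_linear.continuous_on[OF bounded_linear_matrix])
    then have "E t \<le> E 0"
      by (intro DERIV_nonpos_imp_decreasing_open[OF t]) (use dE in auto)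
    then have "exp (c * t) * (norm (y t))\<^sup>2 \<le> (norm (y 0))\<^sup>2"
      by (simp add: E_def power2_norm_eq_inner)
    then have "(exp (c/2 * t) * norm (y t))\<^sup>2 \<le> (norm (y 0))\<^sup>2"
      using exp_double[of "c/2 * t"] by (simp add: power_mult_distrib)
    then have "exp (c/2 * t) * norm (y t) \<le> norm (y 0)"
      by (rule power2_le_imp_le) simp
    then have "norm (y t) \<le> exp (- (c/2) * t) * norm (y 0)"
      by (simp add: exp_minus field_simps)
    also have "\<dots> \<le> exp (- (c/2) * t) * (BW * norm z)"
      using BW(2)[of z] flowD(3)[OF flow z(1)] by (simp add: y_def)
    finally have "BV * norm (y t) \<le> BV * (exp (- (c/2) * t) * (BW * norm z))"
      using BV(1) by (intro mult_left_mono) auto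
    then show ?thesis using xW[of "\<phi> t z"] by (simp add: y_def mult_ac)
  qed
  show ?thesis by (rule that[of "c/2" "BV * BW" d]) (use c BV BW d main in auto)
qed

section \<open>From attraction of single points to decay uniform in the initial state\<close>

lemma flow_tendsto_0:
  fixes F :: "complex^'n \<Rightarrow> complex^'n"
  assumes flow: "holomorphic_flow F \<phi>" and hyp: "stable_hyperbolic F \<phi> lam" and z: "z \<in> \<D>"
  shows "((\<lambda>t. \<phi> t z) \<longlongrightarrow> 0) at_top"
proof -
  have "z \<in> basin \<phi>" using stable_hyperbolicD(3)[OF hyp] z closure_subset by blast
  then have lim: "((\<lambda>t. Lim (at z within \<D>) (\<phi> t)) \<longlongrightarrow> 0) at_top" by (simp add: basin_def)
  have "Lim (at z within \<D>) (\<phi> t) = \<phi> t z" if "0 \<le> t" for t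
  proof -
    have "continuous_on \<D> (\<phi> t)"
      using flowD(8)[OF flow that] by (rule continuous_on_subset) auto
    then have "(\<phi> t \<longlongrightarrow> \<phi> t z) (at z within \<D>)" using z by (simp add: continuous_on_def)
    then show ?thesis using z by (intro tendsto_Lim) (simp_all add: at_within_open[OF _ open_polydisc])
  qed
  then have "\<forall>\<^sub>F t in at_top. Lim (at z within \<D>) (\<phi> t) = \<phi> t z"
    by (rule eventually_mono[OF eventually_ge_at_top[of 0]])
  then show ?thesis by (rule Lim_transform_eventually[OF lim])
qed

text \<open>The maximum principle, applied to each component of the time-one map, carries the bound
  on the torus to all of \<open>\<D>\<close>.\<close>

lemma flow_compact_image:
  fixes F :: "complex^'n \<Rightarrow> complex^'n"
  assumes flow: "holomorphic_flow F \<phi>" and fw: "forward_invariant \<phi>"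
  obtains R where "0 < R" "R < 1" "\<And>z i. z \<in> \<D> \<Longrightarrow> cmod (\<phi> 1 z $ i) \<le> R"
proof -
  obtain R where R: "0 < R" "R < 1" "\<And>z. z \<in> \<T> \<Longrightarrow> \<phi> 1 z \<in> polydisc R"
    using fw zero_less_one unfolding forward_invariant_def by blast
  have "cmod (\<phi> 1 z $ i) \<le> R" if z: "z \<in> \<D>" for z i
  proof (rule polydisc_max_principle[OF _ _ _ z])
    show "holo_on (\<lambda>z. \<phi> 1 z $ i) \<D>" by (rule flowD(7)[OF flow]) simp
    show "continuous_on (\<D> \<union> \<T>) (\<lambda>z. \<phi> 1 z $ i)"
      by (intro continuous_intros flowD(8)[OF flow]) simp
    show "cmod (\<phi> 1 z $ i) \<le> R" if "z \<in> \<T>" for z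
      using R(3)[OF that] by (simp add: polydisc_def less_imp_le)
  qed
  then show ?thesis using that R by blast
qed

text \<open>After time 1 all states lie in the compact polydisc \<open>K\<close>. Each point of
  \<open>K\<close> enters the ball of radius \<open>d\<close>, by continuity together with a
  neighbourhood; finitely many neighbourhoods cover \<open>K\<close>, and by stability an orbit that
  has entered stays within \<open>\<delta>\<close>.\<close>

lemma flow_uniform_entrance:
  fixes F :: "complex^'n \<Rightarrow> complex^'n"
  assumes flow: "holomorphic_flow F \<phi>" and fw: "forward_invariant \<phi>"
    and hyp: "stable_hyperbolic F \<phi> lam" and \<delta>: "0 < \<delta>"
  obtains T where "0 \<le> T" "\<And>z. z \<in> \<D> \<Longrightarrow> norm (\<phi> T z) < \<delta>"
proof -
  obtain R where R: "0 < R" "R < 1" "\<And>z i. z \<in> \<D> \<Longrightarrow> cmod (\<phi> 1 z $ i) \<le> R"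
    using flow_compact_image[OF flow fw] by blast
  define K where "K = {z :: complex^'n. \<forall>i. cmod (z $ i) \<le> R}"
  have KD: "K \<subseteq> \<D>" using R(2) by (auto simp: K_def polydisc_def intro: le_less_trans)
  have "closed K"
  proof -
    have "K = (\<Inter>i. {z. cmod (z $ i) \<le> R})" by (auto simp: K_def)
    then show ?thesis by (auto intro!: closed_Collect_le continuous_intros)
  qed
  moreover have "bounded K"
    unfolding bounded_iff K_def using norm_le_card_mult by blast
  ultimately have cK: "compact K" by (simp add: compact_eq_bounded_closed)
  obtain d where d: "0 < d" "\<And>z t. z \<in> \<D> \<Longrightarrow> norm z < d \<Longrightarrow> 0 \<le> t \<Longrightarrow> norm (\<phi> t z) < \<delta>"
    using stable_hyperbolicD(2)[OF hyp \<delta>] by blast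
  have "\<exists>t U. 0 \<le> t \<and> open U \<and> x \<in> U \<and> (\<forall>y\<in>U \<inter> \<D>. norm (\<phi> t y) < d)" if x: "x \<in> K" for x
  proof -
    have xD: "x \<in> \<D>" using x KD by blast
    have "\<forall>\<^sub>F t in at_top. norm (\<phi> t x) < d"
      using tendstoD[OF flow_tendsto_0[OF flow hyp xD] d(1)] by simp
    then obtain t where t: "0 \<le> t" "norm (\<phi> t x) < d"
      using eventually_happens'[OF _ eventually_conj[OF _ eventually_ge_at_top[of 0]]]
      by (metis (no_types, lifting) trivial_limit_at_top_linorder)
    have "continuous_on \<D> (\<lambda>y. norm (\<phi> t y))"
      by (intro continuous_intros continuous_on_subset[OF flowD(8)[OF flow t(1)]]) auto
    then have "open ((\<lambda>y. norm (\<phi> t y)) -` {..<d} \<inter> \<D>)"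
      using continuous_on_open_vimage[OF open_polydisc] open_lessThan by blast
    then show ?thesis
      using t xD by (intro exI[of _ t] exI[of _ "(\<lambda>y. norm (\<phi> t y)) -` {..<d} \<inter> \<D>"]) auto
  qed
  then obtain t U where tU: "\<And>x. x \<in> K \<Longrightarrow> 0 \<le> t x" "\<And>x. x \<in> K \<Longrightarrow> open (U x)" "\<And>x. x \<in> K \<Longrightarrow> x \<in> U x"
    "\<And>x y. x \<in> K \<Longrightarrow> y \<in> U x \<inter> \<D> \<Longrightarrow> norm (\<phi> (t x) y) < d"
    by metis
  obtain K' where K': "K' \<subseteq> K" "finite K'" "K \<subseteq> (\<Union>x\<in>K'. U x)"
  proof (rule compactE_image[OF cK tU(2)])
    show "K \<subseteq> (\<Union>x\<in>K. U x)" using tU(3) by blast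
  qed
  \<comment> \<open>The entrance times are nonnegative, so their sum is a common upper
    bound.\<close>
  define T where "T = (\<Sum>x\<in>K'. t x)"
  have tT: "t x \<le> T" if "x \<in> K'" for x
    unfolding T_def by (rule member_le_sum[OF that]) (use K' tU(1) in auto)
  have T0: "0 \<le> T" unfolding T_def by (intro sum_nonneg) (use K' tU(1) in auto)
  have TK: "norm (\<phi> T y) < \<delta>" if y: "y \<in> K" for y
  proof -
    obtain x where x: "x \<in> K'" "y \<in> U x" using y K'(3) by blast
    then have xK: "x \<in> K" using K'(1) by blast
    have yD: "y \<in> \<D>" using y KD by blast
    have "norm (\<phi> (t x) y) < d" using tU(4)[OF xK] x(2) yD by blast
    then have "norm (\<phi> (T - t x) (\<phi> (t x) y)) < \<delta>"
      using tT[OF x(1)] by (intro d(2) flowD(4)[OF flow] tU(1)[OF xK] yD) auto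
    moreover have "\<phi> (T - t x) (\<phi> (t x) y) = \<phi> T y"
      using flowD(5)[OF flow _ tU(1)[OF xK] yD, of "T - t x"] tT[OF x(1)] by simp
    ultimately show ?thesis by simp
  qed
  have "norm (\<phi> (T + 1) z) < \<delta>" if z: "z \<in> \<D>" for z
    using TK[of "\<phi> 1 z"] R(3)[OF z] flowD(5)[OF flow T0 _ z, of 1] by (simp add: K_def)
  then show ?thesis using that[of "T + 1"] T0 by simp
qed

text \<open>Local decay is started at the common entrance time, so neither constant depends on the
  initial state.\<close>

lemma flow_decay:
  fixes F :: "complex^'n \<Rightarrow> complex^'n"
  assumes flow: "holomorphic_flow F \<phi>" and fw: "forward_invariant \<phi>" and hyp: "stable_hyperbolic F \<phi> lam"
  obtains c C where "0 < c" "0 < C" "\<And>z t. z \<in> \<D> \<Longrightarrow> 0 \<le> t \<Longrightarrow> norm (\<phi> t z) \<le> C * exp (- c * t)"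
proof -
  obtain c C \<delta> where loc: "0 < c" "0 < C" "0 < \<delta>"
    "\<And>z t. z \<in> \<D> \<Longrightarrow> norm z < \<delta> \<Longrightarrow> 0 \<le> t \<Longrightarrow> norm (\<phi> t z) \<le> C * exp (- c * t) * norm z"
    using local_decay[OF flow hyp] by blast
  obtain T where T: "0 \<le> T" "\<And>z. z \<in> \<D> \<Longrightarrow> norm (\<phi> T z) < \<delta>"
    using flow_uniform_entrance[OF flow fw hyp loc(3)] by blast
  define N where "N = real CARD('n)"
  have N: "0 < N" by (simp add: N_def)
  \<comment> \<open>\<open>C * \<delta>\<close> serves for times after \<open>T\<close> and the
    trivial bound \<open>N\<close> on \<open>\<D>\<close> before; \<open>exp (c * T)\<close> pays
    for the shift of the time origin.\<close>
  define C' where "C' = (C * \<delta> + N) * exp (c * T)"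
  have C': "0 < C'" using loc N by (simp add: C'_def add_pos_pos)
  have "norm (\<phi> t z) \<le> C' * exp (- c * t)" if z: "z \<in> \<D>" and t: "0 \<le> t" for z t
  proof (cases "T \<le> t")
    case True
    have zT: "\<phi> T z \<in> \<D>" by (rule flowD(4)[OF flow T(1) z])
    have "norm (\<phi> (t - T) (\<phi> T z)) \<le> C * exp (- c * (t - T)) * norm (\<phi> T z)"
      using loc(4)[OF zT T(2)[OF z]] True by simp
    also have "\<dots> \<le> C * exp (- c * (t - T)) * \<delta>"
      using T(2)[OF z] loc by (intro mult_left_mono) auto
    also have "\<dots> = C * \<delta> * exp (c * T) * exp (- c * t)"
      by (simp add: right_diff_distrib exp_diff exp_minus field_simps)
    also have "\<dots> \<le> C' * exp (- c * t)"
      unfolding C'_def using N by (intro mult_right_mono) auto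
    finally show ?thesis using flowD(5)[OF flow _ T(1) z, of "t - T"] True by simp
  next
    case False
    have "\<phi> t z \<in> \<D>" by (rule flowD(4)[OF flow t z])
    then have "norm (\<phi> t z) \<le> N * 1"
      unfolding N_def by (intro norm_le_card_mult) (simp add: polydisc_def less_imp_le)
    also have "1 \<le> exp (c * T) * exp (- c * t)"
      using False loc(1) by (simp add: exp_add[symmetric])
    then have "N * 1 \<le> N * (exp (c * T) * exp (- c * t))" using N by (intro mult_left_mono) auto
    also have "\<dots> \<le> C' * exp (- c * t)"
      unfolding C'_def using loc by (simp add: mult.assoc[symmetric])
    finally show ?thesis .
  qed
  then show ?thesis using that loc(1) C' by blast
qed

section \<open>The generator on products of linear forms\<close>

lemma frechet_derivative_on_disc:
  assumes "holo_on f \<D>" "z \<in> \<D>"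
  shows "frechet_derivative (on_disc f) (at z) = frechet_derivative f (at z)"
proof -
  have "(on_disc f has_derivative frechet_derivative f (at z)) (at z)"
    by (rule has_derivative_transform_within_open[OF holo_onD(1)[OF assms] open_polydisc assms(2)])
      (simp add: on_disc_eq)
  then show ?thesis by (rule frechet_derivative_at[symmetric])
qed

lemma gen_on_disc:
  fixes f :: "complex^'n \<Rightarrow> complex"
  assumes f: "holo_on f \<D>"
  shows "gen F (on_disc f) = on_disc (\<lambda>z. frechet_derivative f (at z) (F z))"
proof
  fix z :: "complex^'n"
  show "gen F (on_disc f) z = on_disc (\<lambda>z. frechet_derivative f (at z) (F z)) z"
  proof (cases "z \<in> \<D>")
    case True
    then show ?thesis
      by (simp add: gen_def on_disc_eq partial_deriv_eq[OF holo_on_disc[OF f] True]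
          frechet_derivative_on_disc[OF f True] frechet_derivative_coords[OF f True, of "F z"] mult.commute)
  qed (simp add: gen_def on_disc_def)
qed

definition lin_form :: "complex^'n \<Rightarrow> complex^'n \<Rightarrow> complex" where
  "lin_form a x = (\<Sum>k\<in>UNIV. a $ k * x $ k)"

text \<open>Products of linear forms contain both the monomials (factors \<open>axis k 1\<close>)
  and the products of left eigenvectors, so one passes from the former to the latter without leaving
  the class.\<close>

definition form_prod :: "(complex^'n) list \<Rightarrow> complex^'n \<Rightarrow> complex" where
  "form_prod as x = prod_list (map (\<lambda>a. lin_form a x) as)"

text \<open>The derivative at \<open>x\<close> in direction \<open>v\<close> by Leibniz' rule; for
  \<open>v = F x\<close> it is the generator.\<close>

fun form_prod_deriv :: "(complex^'n) list \<Rightarrow> complex^'n \<Rightarrow> complex^'n \<Rightarrow> complex" where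
  "form_prod_deriv [] x v = 0"
| "form_prod_deriv (a # as) x v = lin_form a v * form_prod as x + lin_form a x * form_prod_deriv as x v"

lemma form_prod_simps [simp]:
  "form_prod [] x = 1" "form_prod (a # as) x = lin_form a x * form_prod as x"
  "form_prod (as @ bs) x = form_prod as x * form_prod bs x"
  by (simp_all add: form_prod_def)

lemma lin_form_axis [simp]: "lin_form (axis k 1) x = x $ k"
  by (simp add: lin_form_def axis_def if_distrib[of "\<lambda>x. x * _"] cong: if_cong)

lemma lin_form_linear: "lin_form a (x + y) = lin_form a x + lin_form a y" "lin_form a (c *s x) = c * lin_form a x"
  "lin_form a (x - y) = lin_form a x - lin_form a y"
  by (simp_all add: lin_form_def distrib_left right_diff_distrib sum.distrib sum_subtractf sum_distrib_left mult_ac)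

lemma holo_lin_form: "(\<And>k. holo_on (\<lambda>z. G z $ k) S) \<Longrightarrow> holo_on (\<lambda>z. lin_form a (G z)) S"
  unfolding lin_form_def by (intro holo_sum holo_cmult)

lemma continuous_lin_form: "continuous_on S G \<Longrightarrow> continuous_on S (\<lambda>z. lin_form a (G z))"
  unfolding lin_form_def by (intro continuous_intros)

lemma holo_form_prod: "holo_on (form_prod as) S"
proof (induction as)
  case Nil
  have "form_prod ([] :: (complex^'a) list) = (\<lambda>z. 1)" by (simp add: fun_eq_iff)
  then show ?case using holo_const by metis
next
  case (Cons a as)
  have "form_prod (a # as) = (\<lambda>x. lin_form a x * form_prod as x)" by (simp add: fun_eq_iff)
  then show ?case using holo_mult[OF holo_lin_form[OF holo_coord] Cons] by metis
qed

lemma continuous_form_prod: "continuous_on S (form_prod as)"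
  by (rule holo_on_continuous_on[OF holo_form_prod])

lemma holo_form_prod_deriv:
  assumes "\<And>k. holo_on (\<lambda>z. G z $ k) S"
  shows "holo_on (\<lambda>z. form_prod_deriv as z (G z)) S"
  by (induction as) (auto intro!: holo_const holo_add holo_mult holo_lin_form holo_coord assms holo_form_prod)

lemma continuous_form_prod_deriv:
  assumes "continuous_on S G"
  shows "continuous_on S (\<lambda>z. form_prod_deriv as z (G z))"
  by (induction as) (auto intro!: continuous_intros continuous_lin_form assms continuous_form_prod)

lemma form_prod_has_derivative: "(form_prod as has_derivative form_prod_deriv as x) (at x)"
proof (induction as)
  case Nil
  have "form_prod ([] :: (complex^'a) list) = (\<lambda>z. 1)" "form_prod_deriv [] x = (\<lambda>_. 0)"
    by (simp_all add: fun_eq_iff)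
  then show ?case by simp
next
  case (Cons a as)
  have eq: "form_prod (a # as) = (\<lambda>x. lin_form a x * form_prod as x)" by (simp add: fun_eq_iff)
  have "(lin_form a has_derivative lin_form a) (at x)"
    unfolding lin_form_def
    by (intro bounded_linear_imp_has_derivative bounded_linear_sum
        bounded_linear_compose[OF bounded_linear_mult_right bounded_linear_vec_nth])
  then have "((\<lambda>x. lin_form a x * form_prod as x) has_derivative
      (\<lambda>v. lin_form a x * form_prod_deriv as x v + lin_form a v * form_prod as x)) (at x)"
    by (intro has_derivative_mult Cons)
  moreover have "form_prod_deriv (a # as) x = (\<lambda>v. lin_form a x * form_prod_deriv as x v + lin_form a v * form_prod as x)"
    by (simp add: fun_eq_iff add.commute)
  ultimately show ?case unfolding eq by simp
qed

lemma gen_form_prod: "gen F (on_disc (form_prod as)) = on_disc (\<lambda>z. form_prod_deriv as z (F z))"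
  unfolding gen_on_disc[OF holo_form_prod] frechet_derivative_at[OF form_prod_has_derivative, symmetric] ..

lemma hardy_form_prod: "on_disc (form_prod as) \<in> \<H>\<^sup>2"
  by (intro hardy_on_disc holo_form_prod continuous_form_prod)

text \<open>The image under the generator is a polynomial expression in \<open>z\<close> and
  \<open>F z\<close>, which inherits from \<open>F\<close> the continuity up to the torus.\<close>

lemma gen_dom_form_prod:
  assumes flow: "holomorphic_flow F \<phi>"
  shows "on_disc (form_prod as) \<in> gen_dom F"
  unfolding gen_dom_def mem_Collect_eq gen_form_prod
  by (intro conjI hardy_form_prod hardy_on_disc holo_form_prod_deriv continuous_form_prod_deriv flowD[OF flow])

lemma form_prod_deriv_diff: "form_prod_deriv as x (v - w) = form_prod_deriv as x v - form_prod_deriv as x w"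
  by (induction as) (simp_all add: lin_form_linear left_diff_distrib right_diff_distrib)

lemma lin_form_bound:
  obtains B where "0 \<le> B" "\<And>x. cmod (lin_form a x) \<le> B * norm x"
proof
  show "0 \<le> (\<Sum>k\<in>UNIV. cmod (a $ k))" by (intro sum_nonneg) auto
  fix x
  have "cmod (lin_form a x) \<le> (\<Sum>k\<in>UNIV. cmod (a $ k) * cmod (x $ k))"
    unfolding lin_form_def norm_mult[symmetric] by (rule norm_sum)
  also have "\<dots> \<le> (\<Sum>k\<in>UNIV. cmod (a $ k) * norm x)"
    by (intro sum_mono mult_left_mono norm_nth_le_vec) auto
  finally show "cmod (lin_form a x) \<le> (\<Sum>k\<in>UNIV. cmod (a $ k)) * norm x" by (simp add: sum_distrib_right)
qed

lemma form_prod_bound: "\<exists>B\<ge>0. \<forall>x. cmod (form_prod as x) \<le> B * norm x ^ length as"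
proof (induction as)
  case Nil
  show ?case by (intro exI[of _ 1]) auto
next
  case (Cons a as)
  obtain B where B: "0 \<le> B" "\<And>x. cmod (form_prod as x) \<le> B * norm x ^ length as" using Cons by blast
  obtain A where A: "0 \<le> A" "\<And>x. cmod (lin_form a x) \<le> A * norm x" using lin_form_bound by blast
  have "cmod (form_prod (a # as) x) \<le> (A * B) * norm x ^ length (a # as)" for x
  proof -
    have "cmod (form_prod (a # as) x) \<le> (A * norm x) * (B * norm x ^ length as)"
      unfolding form_prod_simps norm_mult using A B by (intro mult_mono) auto
    then show ?thesis by (simp add: mult_ac)
  qed
  then show ?case using A B by (intro exI[of _ "A * B"]) auto
qed

lemma form_prod_deriv_bound: "\<exists>B\<ge>0. \<forall>x v. cmod (form_prod_deriv as x v) \<le> B * norm x ^ (length as - 1) * norm v"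
proof (induction as)
  case Nil
  show ?case by (intro exI[of _ 0]) auto
next
  case (Cons a as)
  obtain B where B: "0 \<le> B" "\<And>x v. cmod (form_prod_deriv as x v) \<le> B * norm x ^ (length as - 1) * norm v" using Cons by blast
  obtain A where A: "0 \<le> A" "\<And>x. cmod (lin_form a x) \<le> A * norm x" using lin_form_bound by blast
  obtain P where P: "0 \<le> P" "\<And>x. cmod (form_prod as x) \<le> P * norm x ^ length as" using form_prod_bound by blast
  have "cmod (form_prod_deriv (a # as) x v) \<le> (A * P + A * B) * norm x ^ (length (a # as) - 1) * norm v" for x v
  proof -
    have 1: "cmod (lin_form a v * form_prod as x) \<le> (A * norm v) * (P * norm x ^ length as)"
      unfolding norm_mult using A P by (intro mult_mono) auto
    have 2: "cmod (lin_form a x * form_prod_deriv as x v) \<le> A * B * norm x ^ length as * norm v"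
    \<comment> \<open>For the empty list the exponent \<open>length as - 1\<close> is truncated to
      0, so one factor \<open>norm x\<close> cannot be absorbed; there the derivative is 0.\<close>
    proof (cases as)
      case Nil
      then show ?thesis using A B by simp
    next
      case (Cons b bs)
      have "cmod (lin_form a x * form_prod_deriv as x v) \<le> (A * norm x) * (B * norm x ^ (length as - 1) * norm v)"
        unfolding norm_mult using A B by (intro mult_mono) auto
      then show ?thesis using Cons by (simp add: mult_ac)
    qed
    have "cmod (form_prod_deriv (a # as) x v) \<le> cmod (lin_form a v * form_prod as x) + cmod (lin_form a x * form_prod_deriv as x v)"
      unfolding form_prod_deriv.simps by (rule norm_triangle_ineq)
    also have "\<dots> \<le> (A * norm v) * (P * norm x ^ length as) + A * B * norm x ^ length as * norm v"
      by (rule add_mono[OF 1 2])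
    finally show ?thesis by (simp add: algebra_simps)
  qed
  then show ?case using A B P by (intro exI[of _ "A * P + A * B"]) auto
qed

text \<open>Leibniz' rule adds up the eigenvalues of the factors; this sum is what non-resonance
  keeps apart from \<open>lam j\<close>.\<close>

lemma form_prod_deriv_eigen:
  assumes "\<And>a. a \<in> set as \<Longrightarrow> lin_form a (J *v x) = \<mu> a * lin_form a x"
  shows "form_prod_deriv as x (J *v x) = sum_list (map \<mu> as) * form_prod as x"
  using assms by (induction as) (simp_all add: algebra_simps)

lemma vmono_form_prod:
  fixes \<alpha> :: "'n::finite \<Rightarrow> nat"
  obtains as where "length as = deg \<alpha>" "(\<lambda>z. vmono z \<alpha>) = form_prod as"
proof -
  have "\<exists>as. length as = (\<Sum>k\<in>S. \<alpha> k) \<and> (\<forall>z. (\<Prod>k\<in>S. (z $ k) ^ \<alpha> k) = form_prod as z)" if "finite S" for S :: "'n set"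
    using that
  proof (induction S rule: finite_induct)
    case empty
    show ?case by (intro exI[of _ "[]"]) auto
  next
    case (insert k S)
    then obtain as where as: "length as = (\<Sum>k\<in>S. \<alpha> k)" "\<forall>z. (\<Prod>k\<in>S. (z $ k) ^ \<alpha> k) = form_prod as z" by blast
    have "form_prod (replicate m (axis k 1)) z = (z $ k) ^ m" for m z
      by (induction m) simp_all
    then show ?case using as insert.hyps by (intro exI[of _ "replicate (\<alpha> k) (axis k 1) @ as"]) simp
  qed
  from this[of UNIV] obtain as where "length as = deg \<alpha>" "\<forall>z. vmono z \<alpha> = form_prod as z"
    by (auto simp: deg_def vmono_def)
  then show ?thesis using that by (simp add: fun_eq_iff)
qed

lemma gen_dom_vmono:
  assumes "holomorphic_flow F \<phi>"
  shows "on_disc (\<lambda>z. vmono z \<alpha>) \<in> gen_dom F"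
  using vmono_form_prod[of \<alpha>] gen_dom_form_prod[OF assms] by metis

section \<open>Eigenfunctions of the dual generator\<close>

text \<open>The pairing is conjugate-linear in its second argument, which turns the eigenvalue
  \<open>cnj \<mu>\<close> of the adjoint into \<open>\<mu>\<close> in the weak form. The uniqueness
  of the adjoint value, which monomials in the domain provide, identifies it with the witness from
  \<open>adj_dom\<close>.\<close>

lemma dual_eigenfunctionD:
  fixes F :: "complex^'n \<Rightarrow> complex^'n"
  assumes flow: "holomorphic_flow F \<phi>" and eig: "dual_eigenfunction F (cnj \<mu>) \<psi>"
  shows "\<psi> \<in> \<H>\<^sup>2" "\<psi> \<noteq> (\<lambda>z. 0)" "f \<in> gen_dom F \<Longrightarrow> hinner (gen F f) \<psi> = \<mu> * hinner f \<psi>"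
proof -
  have "\<psi> \<in> adj_dom (gen_dom F) (gen F)" and ne: "\<psi> \<noteq> (\<lambda>z. 0)" and ad: "gen_adj F \<psi> = (\<lambda>z. cnj \<mu> * \<psi> z)"
    using eig by (auto simp: dual_eigenfunction_def gen_adj_dom_def)
  then obtain g' where \<psi>: "\<psi> \<in> \<H>\<^sup>2" and g': "g' \<in> \<H>\<^sup>2" "\<And>f. f \<in> gen_dom F \<Longrightarrow> hinner (gen F f) \<psi> = hinner f g'"
    by (auto simp: adj_dom_def)
  have "gen_adj F \<psi> = g'"
    unfolding gen_adj_def by (rule adj_eqI[OF gen_dom_vmono[OF flow] g'])
  then have "g' = (\<lambda>z. cnj \<mu> * \<psi> z)" using ad by simp
  then show "f \<in> gen_dom F \<Longrightarrow> hinner (gen F f) \<psi> = \<mu> * hinner f \<psi>"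
    using g'(2) hinner_cmult_right[OF hardyD(1)[OF \<psi>], of f "cnj \<mu>"] by simp
  show "\<psi> \<in> \<H>\<^sup>2" "\<psi> \<noteq> (\<lambda>z. 0)" by fact+
qed

lemma hinner_sum:
  fixes f :: "'i \<Rightarrow> complex^'n \<Rightarrow> complex"
  assumes f: "\<And>i. i \<in> I \<Longrightarrow> f i \<in> \<H>\<^sup>2" and k: "k \<in> \<H>\<^sup>2" and I: "finite I"
  shows "hinner (\<lambda>z. \<Sum>i\<in>I. c i * f i z) k = (\<Sum>i\<in>I. c i * hinner (f i) k)"
proof -
  have "taylor (\<lambda>z. \<Sum>i\<in>I. c i * f i z) = (\<lambda>\<alpha>. \<Sum>i\<in>I. c i * taylor (f i) \<alpha>)"
  proof (rule taylor_eqI)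
    show "continuous_on \<D> (\<lambda>z. \<Sum>i\<in>I. c i * f i z)"
      by (intro holo_on_continuous_on holo_sum holo_cmult hardyD(1) f)
    fix z :: "complex^'n" assume "z \<in> \<D>"
    then have "((\<lambda>\<alpha>. \<Sum>i\<in>I. c i * (taylor (f i) \<alpha> * vmono z \<alpha>)) has_sum (\<Sum>i\<in>I. c i * f i z)) UNIV"
      by (intro has_sum_finite_sum has_sum_cmult_right taylor_has_sum hardyD(1) f)
    then show "((\<lambda>\<alpha>. (\<Sum>i\<in>I. c i * taylor (f i) \<alpha>) * vmono z \<alpha>) has_sum (\<Sum>i\<in>I. c i * f i z)) UNIV"
      by (simp add: sum_distrib_right mult.assoc)
  qed
  moreover have "((\<lambda>\<alpha>. \<Sum>i\<in>I. c i * (taylor (f i) \<alpha> * cnj (taylor k \<alpha>))) has_sum (\<Sum>i\<in>I. c i * hinner (f i) k)) UNIV"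
    unfolding hinner_def by (intro has_sum_finite_sum has_sum_cmult_right has_sum_infsum hinner_summable f k)
  ultimately show ?thesis
    unfolding hinner_def[of "\<lambda>z. \<Sum>i\<in>I. c i * f i z"] by (intro infsumI) (simp add: sum_distrib_right mult.assoc)
qed

text \<open>On the eigenforms of the linear part, the generator is diagonal up to terms of higher degree.\<close>

lemma hinner_eigenforms_zero:
  fixes F :: "complex^'n \<Rightarrow> complex^'n"
  assumes flow: "holomorphic_flow F \<phi>" and F0: "F 0 = 0" and eig: "dual_eigenfunction F (cnj \<mu>) \<psi>"
    and high: "\<And>\<alpha>. length as < deg \<alpha> \<Longrightarrow> taylor \<psi> \<alpha> = 0" and ne: "as \<noteq> []"
    and form: "\<And>a x. a \<in> set as \<Longrightarrow> lin_form a (jacobian F 0 *v x) = \<nu> a * lin_form a x"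
    and res: "sum_list (map \<nu> as) \<noteq> \<mu>"
  shows "hinner (on_disc (form_prod as)) \<psi> = 0"
proof -
  define s where "s = sum_list (map \<nu> as)"
  define q where "q = (\<lambda>z. form_prod_deriv as z (F z))"
  have hq: "holo_on q \<D>" unfolding q_def by (intro holo_form_prod_deriv flowD[OF flow])
  obtain K \<delta> where K: "0 < \<delta>" "0 \<le> K"
    "\<And>x y. norm x \<le> \<delta> \<Longrightarrow> norm y \<le> \<delta> \<Longrightarrow>
      norm (F x - F y - jacobian F 0 *v (x - y)) \<le> K * (norm x + norm y) * norm (x - y)"
    using vector_field_difference_at_0[OF flowD(1)[OF flow]] by metis
  obtain B where B: "0 \<le> B" "\<And>x v. cmod (form_prod_deriv as x v) \<le> B * norm x ^ (length as - 1) * norm v"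
    using form_prod_deriv_bound by blast
  have low: "taylor (\<lambda>z. q z - s * form_prod as z) \<alpha> = 0" if "deg \<alpha> \<le> length as" for \<alpha>
  proof (rule taylor_vanish[OF _ K(1) _ that])
    show "holo_on (\<lambda>z. q z - s * form_prod as z) \<D>" by (intro holo_diff hq holo_cmult holo_form_prod)
    fix z :: "complex^'n" assume z: "norm z \<le> \<delta>"
    have "q z - s * form_prod as z = form_prod_deriv as z (F z - jacobian F 0 *v z)"
      unfolding form_prod_deriv_diff q_def s_def using form_prod_deriv_eigen[of as "jacobian F 0" z \<nu>] form by simp
    then have "cmod (q z - s * form_prod as z) \<le> B * norm z ^ (length as - 1) * norm (F z - jacobian F 0 *v z)"
      using B(2) by simp
    also have "\<dots> \<le> B * norm z ^ (length as - 1) * (K * norm z * norm z)"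
      using K(3)[OF z, of 0] K(1) B(1) F0 by (intro mult_left_mono) auto
    also have "\<dots> = B * K * norm z ^ Suc (length as)"
      using ne by (cases as) (simp_all add: mult_ac)
    finally show "cmod (q z - s * form_prod as z) \<le> B * K * norm z ^ Suc (length as)" .
  qed
  \<comment> \<open>Up to degree \<open>length as\<close> the coefficients of \<open>q\<close> and
    of \<open>s\<close> times the form agree by \<open>low\<close>; above it those of
    \<open>\<psi>\<close> vanish by assumption.\<close>
  have "taylor q \<alpha> * cnj (taylor \<psi> \<alpha>) = s * (taylor (form_prod as) \<alpha> * cnj (taylor \<psi> \<alpha>))" for \<alpha>
  proof (cases "deg \<alpha> \<le> length as")
    case True
    have "taylor q \<alpha> - s * taylor (form_prod as) \<alpha> = 0"
      using low[OF True] unfolding taylor_diff[OF hq holo_cmult[OF holo_form_prod]] taylor_cmult[OF holo_form_prod] .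
    then show ?thesis by simp
  qed (use high in simp)
  then have "hinner (on_disc q) \<psi> = s * hinner (on_disc (form_prod as)) \<psi>"
    unfolding hinner_def taylor_on_disc by (simp only: infsum_cmult_right')
  moreover have "hinner (on_disc q) \<psi> = \<mu> * hinner (on_disc (form_prod as)) \<psi>"
    using dual_eigenfunctionD(3)[OF flow eig gen_dom_form_prod[OF flow]] unfolding gen_form_prod q_def .
  ultimately show ?thesis using res by (simp add: s_def)
qed

text \<open>Connects lists of eigenforms with the multi-indices of the non-resonance
  condition.\<close>

lemma eigval_count_list: "eigval lam (count_list js) = sum_list (map lam js)"
proof (induction js)
  case (Cons k js)
  have "eigval lam (count_list (k # js)) = (\<Sum>j\<in>UNIV. of_nat (count_list js j) * lam j + (if j = k then lam k else 0))"
    unfolding eigval_def by (intro sum.cong) (auto simp: algebra_simps)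
  then show ?case using Cons by (simp add: sum.distrib eigval_def)
qed (simp add: eigval_def)

lemma sum_count_list_UNIV: "(\<Sum>j\<in>(UNIV :: 'n::finite set). count_list js j) = length js"
proof (induction js)
  case (Cons k js)
  have "(\<Sum>j\<in>UNIV. count_list (k # js) j) = (\<Sum>j\<in>UNIV. count_list js j + (if j = k then 1 else 0))"
    by (intro sum.cong) auto
  then show ?case using Cons by (simp add: sum.distrib)
qed simp

text \<open>Every linear form is a combination of the rows of \<open>W\<close>. Expanding the
  factors one at a time reduces the claim to products of rows, whose eigenvalue sum differs from
  \<open>lam j\<close> by non-resonance since \<open>2 \<le> d\<close>.\<close>

lemma hinner_forms_zero:
  fixes F :: "complex^'n \<Rightarrow> complex^'n"
  assumes flow: "holomorphic_flow F \<phi>" and hyp: "stable_hyperbolic F \<phi> lam" and nr: "nonresonant lam"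
    and eig: "dual_eigenfunction F (cnj (lam j)) \<psi>" and d: "2 \<le> d"
    and high: "\<And>\<alpha>. d < deg \<alpha> \<Longrightarrow> taylor \<psi> \<alpha> = 0"
    and len: "length as = d"
  shows "hinner (on_disc (form_prod as)) \<psi> = 0"
proof -
  note hD = stable_hyperbolicD[OF hyp]
  obtain W V where WV: "W ** V = mat 1" "V ** W = mat 1"
    "\<And>j x. (W *v (jacobian F 0 *v x)) $ j = lam j * (W *v x) $ j"
    using eigencoordinates[OF hD(4)] by blast
  have Wrow: "(W *v x) $ j = lin_form (W $ j) x" for x j
    by (simp add: matrix_vector_mult_def lin_form_def)
  have expand: "lin_form a x = (\<Sum>j\<in>UNIV. (\<Sum>k\<in>UNIV. a $ k * V $ k $ j) * lin_form (W $ j) x)" for a x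
  proof -
    have "lin_form a x = lin_form a (V *v (W *v x))" by (simp add: matrix_vector_mul_assoc WV(2))
    also have "\<dots> = (\<Sum>k\<in>UNIV. \<Sum>j\<in>UNIV. a $ k * V $ k $ j * lin_form (W $ j) x)"
      unfolding Wrow[symmetric] lin_form_def[of a]
      by (subst matrix_vector_mult_def) (simp add: sum_distrib_left mult.assoc)
    also have "\<dots> = (\<Sum>j\<in>UNIV. \<Sum>k\<in>UNIV. a $ k * V $ k $ j * lin_form (W $ j) x)" by (rule sum.swap)
    finally show ?thesis by (simp add: sum_distrib_right)
  qed
  have base: "hinner (on_disc (form_prod (map (\<lambda>j. W $ j) js))) \<psi> = 0" if js: "length js = d" for js
  proof (rule hinner_eigenforms_zero[OF flow hD(1) eig])
    show "taylor \<psi> \<alpha> = 0" if "length (map (\<lambda>j. W $ j) js) < deg \<alpha>" for \<alpha>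
      using high that js by simp
    show "map (\<lambda>j. W $ j) js \<noteq> []" using js d by auto
    have "lin_form (W $ j) (jacobian F 0 *v x) = lam j * lin_form (W $ j) x" for j x
      unfolding Wrow[symmetric] by (rule WV(3))
    \<comment> \<open>The eigenvalue has to be a function of the form rather than of its index, so
      the index is recovered from the row; distinctness of the rows follows from invertibility of
      \<open>W\<close>.\<close>
    moreover have injW: "inj (\<lambda>j. W $ j)"
    proof (rule injI)
      fix i j assume ij: "W $ i = W $ j"
      have "(W ** V) $ i $ i = (W ** V) $ j $ i"
        using ij by (simp add: matrix_matrix_mult_def)
      then show "i = j" by (simp add: WV(1) mat_def split: if_splits)
    qed
    ultimately show "lin_form a (jacobian F 0 *v x) = lam (inv (\<lambda>j. W $ j) a) * lin_form a x"
      if "a \<in> set (map (\<lambda>j. W $ j) js)" for a x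
      using that by (auto simp: inv_f_f[OF injW])
    have "sum_list (map (\<lambda>a. lam (inv (\<lambda>j. W $ j) a)) (map (\<lambda>j. W $ j) js)) = eigval lam (count_list js)"
      by (simp add: eigval_count_list o_def inv_f_f[OF injW])
    then show "sum_list (map (\<lambda>a. lam (inv (\<lambda>j. W $ j) a)) (map (\<lambda>j. W $ j) js)) \<noteq> lam j"
      using nr d js sum_count_list_UNIV[of js] unfolding nonresonant_def by metis
  qed
  \<comment> \<open>\<open>as\<close> holds the factors still to be expanded and \<open>js\<close>
    the indices of the rows already chosen, with total length \<open>d\<close>.\<close>
  have "hinner (on_disc (form_prod (as @ map (\<lambda>j. W $ j) js))) \<psi> = 0" if "length as + length js = d" for as js
    using that
  proof (induction as arbitrary: js)
    case Nil
    then show ?case using base by simp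
  next
    case (Cons a as)
    define c where "c = (\<lambda>j. \<Sum>k\<in>UNIV. a $ k * V $ k $ j)"
    have ec: "lin_form a z = (\<Sum>j\<in>UNIV. c j * lin_form (W $ j) z)" for z
      unfolding c_def by (rule expand)
    have "on_disc (form_prod ((a # as) @ map (\<lambda>j. W $ j) js)) =
        (\<lambda>z. \<Sum>i\<in>UNIV. c i * on_disc (form_prod (as @ map (\<lambda>j. W $ j) (i # js))) z)"
    proof
      fix z
      show "on_disc (form_prod ((a # as) @ map (\<lambda>j. W $ j) js)) z =
        (\<Sum>i\<in>UNIV. c i * on_disc (form_prod (as @ map (\<lambda>j. W $ j) (i # js))) z)"
        unfolding on_disc_def
        by (cases "z \<in> \<D>") (simp_all add: ec sum_distrib_left sum_distrib_right mult_ac)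
    qed
    then have "hinner (on_disc (form_prod ((a # as) @ map (\<lambda>j. W $ j) js))) \<psi> =
        (\<Sum>i\<in>UNIV. c i * hinner (on_disc (form_prod (as @ map (\<lambda>j. W $ j) (i # js)))) \<psi>)"
      by (simp only:) (intro hinner_sum hardy_form_prod dual_eigenfunctionD(1)[OF flow eig] finite)
    moreover have "hinner (on_disc (form_prod (as @ map (\<lambda>j. W $ j) (i # js)))) \<psi> = 0" for i
      by (rule Cons.IH) (use Cons.prems in simp)
    ultimately show ?case by (simp only: mult_zero_right sum.neutral_const)
  qed
  from this[of as "[]"] show ?thesis using len by simp
qed

text \<open>Only the unit indices contribute, and there the coefficients of \<open>h\<close> are its
  partial derivatives at 0; the conjugated coefficients of \<open>\<psi>\<close> thus form the
  direction of differentiation.\<close>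

lemma hinner_degree_one:
  fixes h \<psi> :: "complex^'n \<Rightarrow> complex"
  assumes h: "holo_on h \<D>" and \<psi>: "\<And>\<alpha>. deg \<alpha> \<noteq> 1 \<Longrightarrow> taylor \<psi> \<alpha> = 0"
  shows "hinner h \<psi> = frechet_derivative h (at 0) (\<chi> l. cnj (taylor \<psi> (unit_index l)))"
proof -
  have unit: "\<alpha> \<in> range unit_index" if "deg \<alpha> = 1" for \<alpha> :: "'n \<Rightarrow> nat"
  proof -
    obtain k where "\<alpha> k = 1" "\<And>b. b \<noteq> k \<Longrightarrow> \<alpha> b = 0"
      using \<open>deg \<alpha> = 1\<close> sum_eq_1_iff[of UNIV \<alpha>] by (auto simp: deg_def)
    then have "\<alpha> = unit_index k" by (auto simp: unit_index_def fun_eq_iff)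
    then show ?thesis by blast
  qed
  have zero: "taylor \<psi> \<alpha> = 0" if "\<alpha> \<notin> range unit_index" for \<alpha>
    using unit \<psi> that by blast
  have "((\<lambda>\<alpha>. taylor h \<alpha> * cnj (taylor \<psi> \<alpha>)) has_sum (\<Sum>\<alpha>\<in>range unit_index. taylor h \<alpha> * cnj (taylor \<psi> \<alpha>))) UNIV"
    by (rule has_sum_finite_neutralI[of "range unit_index"]) (use zero in simp_all)
  then have "hinner h \<psi> = (\<Sum>\<alpha>\<in>range unit_index. taylor h \<alpha> * cnj (taylor \<psi> \<alpha>))"
    unfolding hinner_def by (rule infsumI)
  also have "\<dots> = (\<Sum>l\<in>UNIV. taylor h (unit_index l) * cnj (taylor \<psi> (unit_index l)))"
    by (subst sum.reindex) (auto simp: inj_def unit_index_inj)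
  also have "\<dots> = frechet_derivative h (at 0) (\<chi> l. cnj (taylor \<psi> (unit_index l)))"
    by (subst frechet_derivative_coords[OF h zero_in_disc]) (simp add: taylor_unit_index[OF h])
  finally show ?thesis .
qed

section \<open>Laplace transforms along the flow\<close>

lemma exp_decay_tendsto_0:
  fixes a :: real
  assumes "a < 0"
  shows "((\<lambda>t. exp (a * t)) \<longlongrightarrow> 0) at_top"
proof (rule filterlim_compose[OF exp_at_bot])
  have "filterlim (\<lambda>t. - a * t) at_top at_top"
    by (rule filterlim_tendsto_pos_mult_at_top[OF tendsto_const _ filterlim_ident]) (use assms in simp)
  then have "filterlim (\<lambda>t. - (- a * t)) at_bot at_top"
    by (rule filterlim_uminus_at_top[THEN iffD1])
  then show "filterlim (\<lambda>t. a * t) at_bot at_top" by (simp only: mult_minus_left minus_minus)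
qed

lemma integrable_exp_decay:
  fixes \<kappa> B :: real
  assumes "0 < \<kappa>"
  shows "integrable lborel (\<lambda>t. indicator {0..} t * (B * exp (- \<kappa> * t)))"
proof -
  have d: "((\<lambda>t. - exp (- \<kappa> * t) / \<kappa>) has_real_derivative exp (- \<kappa> * t)) (at t)" for t
    using assms by (auto intro!: derivative_eq_intros)
  have "((\<lambda>t. - exp (- \<kappa> * t) / \<kappa>) \<longlongrightarrow> - 0 / \<kappa>) at_top"
    by (intro tendsto_intros exp_decay_tendsto_0) (use assms in auto)
  from nn_integral_FTC_atLeast[OF _ d _ this, of 0]
  have nn: "(\<integral>\<^sup>+t. ennreal (exp (- \<kappa> * t)) * indicator {0..} t \<partial>lborel) = ennreal (- 0 / \<kappa> - - exp (- \<kappa> * 0) / \<kappa>)"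
    by simp
  have "integrable lborel (\<lambda>t. indicator {0..} t * exp (- \<kappa> * t))"
  proof (rule integrableI_nonneg)
    have "(\<integral>\<^sup>+t. ennreal (indicator {0..} t * exp (- \<kappa> * t)) \<partial>lborel) =
        (\<integral>\<^sup>+t. ennreal (exp (- \<kappa> * t)) * indicator {0..} t \<partial>lborel)"
      by (intro nn_integral_cong) (auto simp: indicator_def)
    then show "(\<integral>\<^sup>+t. ennreal (indicator {0..} t * exp (- \<kappa> * t)) \<partial>lborel) < \<infinity>" using nn by simp
  qed auto
  from integrable_mult_right[OF this, of B] show ?thesis by (simp add: mult_ac)
qed

text \<open>Estimates and time regularity are available on \<open>\<D>\<close>; this sequence
  transports them to the torus. The shift by 2 keeps the factor in [1/2, 1).\<close>

lemma radial_approximation: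
  fixes z :: "complex^'n"
  assumes "z \<in> \<D> \<union> \<T>"
  shows "of_real (1 - 1 / real (n + 2)) *s z \<in> \<D>" "(\<lambda>n. of_real (1 - 1 / real (n + 2)) *s z) \<longlonglongrightarrow> z"
proof -
  have le: "cmod (z $ k) \<le> 1" for k using assms by (auto simp: polydisc_def torus_def less_imp_le)
  show "of_real (1 - 1 / real (n + 2)) *s z \<in> \<D>"
    unfolding polydisc_def
  proof (safe)
    fix k
    have "(1 - 1 / real (n + 2)) * cmod (z $ k) \<le> (1 - 1 / real (n + 2)) * 1"
      by (intro mult_left_mono le) (simp add: field_simps)
    also have "\<dots> < 1" by simp
    finally show "cmod ((of_real (1 - 1 / real (n + 2)) *s z) $ k) < 1"
      by (simp add: norm_mult del: of_real_diff) 
  qed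
  have "(\<lambda>n. 1 - 1 / real (n + 2)) \<longlonglongrightarrow> 1 - 0"
    by (intro tendsto_diff tendsto_const LIMSEQ_ignore_initial_segment[OF lim_1_over_n])
  then have "(\<lambda>n. (1 - 1 / real (n + 2)) *\<^sub>R z) \<longlonglongrightarrow> (1 - 0) *\<^sub>R z"
    by (intro tendsto_scaleR tendsto_const)
  then show "(\<lambda>n. of_real (1 - 1 / real (n + 2)) *s z) \<longlonglongrightarrow> z"
    unfolding vector_smult_scaleR by simp
qed

text \<open>Time regularity and decay are demanded on \<open>\<D>\<close> only, as they are for a
  flow. The integral over time turns out to be holomorphic on \<open>\<D>\<close> and continuous on
  \<open>\<D> \<union> \<T>\<close>, which is what membership in the Hardy space is derived
  from.\<close>

locale decaying_family =
  fixes f :: "real \<Rightarrow> complex^'n \<Rightarrow> complex" and B \<kappa> :: real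
  assumes holo: "\<And>t. 0 \<le> t \<Longrightarrow> holo_on (f t) \<D>"
    and cont: "\<And>t. 0 \<le> t \<Longrightarrow> continuous_on (\<D> \<union> \<T>) (f t)"
    and time: "\<And>z. z \<in> \<D> \<Longrightarrow> continuous_on {0..} (\<lambda>t. f t z)"
    and bound: "\<And>t z. 0 \<le> t \<Longrightarrow> z \<in> \<D> \<Longrightarrow> cmod (f t z) \<le> B * exp (- \<kappa> * t)"
    and \<kappa>: "0 < \<kappa>"
begin

definition U :: "complex^'n \<Rightarrow> complex" where
  "U z = (\<integral>t. indicator {0..} t *\<^sub>R f t z \<partial>lborel)"

definition b :: "real \<Rightarrow> real" where "b t = indicator {0..} t * (B * exp (- \<kappa> * t))"

lemma b_integrable: "integrable lborel b"
  unfolding b_def by (rule integrable_exp_decay[OF \<kappa>])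

lemma seq_limit:
  assumes "z \<in> \<D> \<union> \<T>" "0 \<le> t"
  shows "(\<lambda>n. f t (of_real (1 - 1 / real (n + 2)) *s z)) \<longlonglongrightarrow> f t z"
proof (rule continuous_on_tendsto_compose[OF cont[OF assms(2)] radial_approximation(2)[OF assms(1)] assms(1)])
  show "\<forall>\<^sub>F n in sequentially. of_real (1 - 1 / real (n + 2)) *s z \<in> \<D> \<union> \<T>"
    using radial_approximation(1)[OF assms(1)] by simp
qed

lemma bound_closed:
  assumes "z \<in> \<D> \<union> \<T>" "0 \<le> t"
  shows "cmod (f t z) \<le> B * exp (- \<kappa> * t)"
  by (rule tendsto_upperbound[OF tendsto_norm[OF seq_limit[OF assms]]])
    (use bound[OF assms(2) radial_approximation(1)[OF assms(1)]] in auto)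

lemma measurable_disc:
  assumes "z \<in> \<D>"
  shows "(\<lambda>t. indicator {0..} t *\<^sub>R f t z) \<in> borel_measurable lborel"
  using borel_measurable_continuous_on_indicator[OF _ time[OF assms]] by simp

text \<open>On the torus continuity in time is not among the assumptions of the locale;
  measurability survives as a pointwise limit from inside.\<close>

lemma measurable_closed:
  assumes "z \<in> \<D> \<union> \<T>"
  shows "(\<lambda>t. indicator {0..} t *\<^sub>R f t z) \<in> borel_measurable lborel"
proof (rule borel_measurable_LIMSEQ_metric)
  show "(\<lambda>t. indicator {0..} t *\<^sub>R f t (of_real (1 - 1 / real (n + 2)) *s z)) \<in> borel_measurable lborel" for n
    by (rule measurable_disc[OF radial_approximation(1)[OF assms]])
  show "(\<lambda>n. indicator {0..} t *\<^sub>R f t (of_real (1 - 1 / real (n + 2)) *s z)) \<longlonglongrightarrow> indicator {0..} t *\<^sub>R f t z" for t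
  proof (cases "0 \<le> t")
    case True
    then show ?thesis by (intro tendsto_scaleR tendsto_const seq_limit assms)
  qed simp
qed

lemma norm_le_b:
  assumes "z \<in> \<D> \<union> \<T>"
  shows "norm (indicator {0..} t *\<^sub>R f t z) \<le> b t"
  using bound_closed[OF assms] by (auto simp: b_def indicator_def)

lemma integrable_closed:
  assumes "z \<in> \<D> \<union> \<T>"
  shows "integrable lborel (\<lambda>t. indicator {0..} t *\<^sub>R f t z)"
proof (rule Bochner_Integration.integrable_bound[OF b_integrable measurable_closed[OF assms]])
  show "AE t in lborel. norm (indicator {0..} t *\<^sub>R f t z) \<le> norm (b t)"
    using norm_le_b[OF assms] by (intro AE_I2) (metis abs_ge_self order_trans real_norm_def)
qed

lemma U_continuous: "continuous_on (\<D> \<union> \<T>) U"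
  unfolding continuous_on_sequentially
proof (intro allI ballI impI)
  fix x :: "nat \<Rightarrow> complex^'n" and a assume a: "a \<in> \<D> \<union> \<T>" and x: "(\<forall>n. x n \<in> \<D> \<union> \<T>) \<and> x \<longlonglongrightarrow> a"
  show "(U \<circ> x) \<longlonglongrightarrow> U a"
    unfolding U_def o_def
  proof (rule integral_dominated_convergence[where w = b])
    show "AE t in lborel. (\<lambda>n. indicator {0..} t *\<^sub>R f t (x n)) \<longlonglongrightarrow> indicator {0..} t *\<^sub>R f t a"
    proof (intro AE_I2)
      fix t :: real
      show "(\<lambda>n. indicator {0..} t *\<^sub>R f t (x n)) \<longlonglongrightarrow> indicator {0..} t *\<^sub>R f t a"
      proof (cases "0 \<le> t")
        case True
        then have "(\<lambda>n. f t (x n)) \<longlonglongrightarrow> f t a"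
          using continuous_on_tendsto_compose[OF cont[OF True] _ a, of x] x by simp
        then show ?thesis by (intro tendsto_intros)
      qed simp
    qed
  qed (use a x measurable_closed norm_le_b b_integrable in auto)
qed

text \<open>The derivative is the time integral of the derivatives \<open>D t\<close>. The
  second-order remainder of \<open>f t\<close> at \<open>z\<close> is at most a multiple of
  \<open>b t * (norm h)\<^sup>2\<close>, so it may be integrated; \<open>D t h\<close> is measurable
  in \<open>t\<close> as a limit of difference quotients.\<close>

lemma U_holo: "holo_on U \<D>"
  unfolding holo_on_def
proof
  fix z :: "complex^'n" assume z: "z \<in> \<D>"
  obtain d where d: "0 < d" "ball z d \<subseteq> \<D>" using open_contains_ball open_polydisc z by blast
  define D where "D = (\<lambda>t. frechet_derivative (f t) (at z))"
  have t2: "cmod (f t (z + h) - f t z - D t h) \<le> 8 * (B * exp (- \<kappa> * t)) / d\<^sup>2 * (norm h)\<^sup>2"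
    if "0 \<le> t" "norm h \<le> d / 4" for t h
    unfolding D_def by (rule holo_taylor2[OF holo[OF that(1)] d(2) _ d(1) that(2)]) (use bound that d in blast)
  have Db: "cmod (D t h) \<le> 10 * (B * exp (- \<kappa> * t)) / d * norm h" if "0 \<le> t" for t h
    unfolding D_def by (rule holo_derivative_bound[OF holo[OF that] d(2) _ d(1)]) (use bound that d in blast)
  have Dlim: "(\<lambda>n. of_real (real (Suc n)) * (f t (z + of_real (inverse (real (Suc n))) *s h) - f t z)) \<longlonglongrightarrow> D t h" if t: "0 \<le> t" for t h
  proof -
    have "((\<lambda>\<zeta>. f t (z + \<zeta> *s h)) has_field_derivative D t h) (at 0)"
      using holo_line_derivative[OF holo[OF t], of z 0 h] z by (simp add: D_def)
    then have "((\<lambda>\<zeta>. (f t (z + \<zeta> *s h) - f t z) / \<zeta>) \<longlongrightarrow> D t h) (at 0)"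
      by (simp add: has_field_derivative_iff)
    moreover have "filterlim (\<lambda>n. complex_of_real (inverse (real (Suc n)))) (at 0) sequentially"
      unfolding filterlim_at
      using tendsto_of_real[OF LIMSEQ_inverse_real_of_nat, where 'a=complex] by (simp del: of_real_inverse)
    ultimately have "(\<lambda>n. (f t (z + of_real (inverse (real (Suc n))) *s h) - f t z) / of_real (inverse (real (Suc n)))) \<longlonglongrightarrow> D t h"
      by (rule filterlim_compose)
    then show ?thesis by (simp add: field_simps del: of_nat_Suc)
  qed
  have Dmeas: "(\<lambda>t. indicator {0..} t *\<^sub>R D t h) \<in> borel_measurable lborel" for h
  proof -
    have ev: "\<forall>\<^sub>F n in sequentially. z + of_real (inverse (real (Suc n))) *s h \<in> \<D>"
    proof -
      have "(\<lambda>n. z + inverse (real (Suc n)) *\<^sub>R h) \<longlonglongrightarrow> z + 0 *\<^sub>R h"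
        by (intro tendsto_intros LIMSEQ_inverse_real_of_nat)
      then have "\<forall>\<^sub>F n in sequentially. z + inverse (real (Suc n)) *\<^sub>R h \<in> \<D>"
        by (rule topological_tendstoD[OF _ open_polydisc]) (use z in simp)
      then show ?thesis unfolding vector_smult_scaleR .
    qed
    \<comment> \<open>Starting the sequence at \<open>N\<close> keeps all points of the difference
      quotients in \<open>\<D>\<close>, where measurability in time is known.\<close>
    then obtain N where N: "\<And>n. N \<le> n \<Longrightarrow> z + of_real (inverse (real (Suc n))) *s h \<in> \<D>"
      unfolding eventually_sequentially by blast
    show ?thesis
    proof (rule borel_measurable_LIMSEQ_metric)
      fix n
      have "(\<lambda>t. of_real (real (Suc (n + N))) * (indicator {0..} t *\<^sub>R f t (z + of_real (inverse (real (Suc (n + N)))) *s h) - indicator {0..} t *\<^sub>R f t z)) \<in> borel_measurable lborel"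
        by (intro borel_measurable_times borel_measurable_diff borel_measurable_const measurable_disc N z) simp
      then show "(\<lambda>t. indicator {0..} t *\<^sub>R (of_real (real (Suc (n + N))) * (f t (z + of_real (inverse (real (Suc (n + N)))) *s h) - f t z))) \<in> borel_measurable lborel"
        by (simp add: scaleR_conv_of_real algebra_simps)
    next
      fix t
      show "(\<lambda>n. indicator {0..} t *\<^sub>R (of_real (real (Suc (n + N))) * (f t (z + of_real (inverse (real (Suc (n + N)))) *s h) - f t z))) \<longlonglongrightarrow> indicator {0..} t *\<^sub>R D t h"
      proof (cases "0 \<le> t")
        case True
        then show ?thesis
          by (intro tendsto_scaleR tendsto_const LIMSEQ_ignore_initial_segment[OF Dlim])
      qed simp
    qed
  qed
  have Dint: "integrable lborel (\<lambda>t. indicator {0..} t *\<^sub>R D t h)" for h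
  proof (rule Bochner_Integration.integrable_bound[OF integrable_mult_right[OF b_integrable, of "10 / d * norm h"] Dmeas])
    have "norm (indicator {0..} t *\<^sub>R D t h) \<le> 10 / d * norm h * b t" for t
      using Db[of t h] by (auto simp: b_def indicator_def mult_ac)
    then show "AE t in lborel. norm (indicator {0..} t *\<^sub>R D t h) \<le> norm (10 / d * norm h * b t)"
      by (intro AE_I2) (metis abs_ge_self order_trans real_norm_def)
  qed
  define L where "L = (\<lambda>h. \<integral>t. indicator {0..} t *\<^sub>R D t h \<partial>lborel)"
  have Dadd: "indicator {0..} t *\<^sub>R D t (h + k) = indicator {0..} t *\<^sub>R D t h + indicator {0..} t *\<^sub>R D t k" for t h k
    using linear_add[OF has_derivative_linear[OF holo_onD(1)[OF holo z]], of t]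
    by (cases "0 \<le> t") (auto simp: D_def)
  have Dsc: "indicator {0..} t *\<^sub>R D t (c *s h) = c * (indicator {0..} t *\<^sub>R D t h)" for t c h
    using holo_onD(2)[OF holo z, of t] by (cases "0 \<le> t") (auto simp: D_def)
  have Lsc: "L (c *s h) = c * L h" for c h unfolding L_def Dsc by (rule integral_mult_right_zero)
  have "linear L"
  proof (rule linearI)
    show "L (h + k) = L h + L k" for h k unfolding L_def Dadd using Dint by simp
    show "L (r *\<^sub>R h) = r *\<^sub>R L h" for r h
      unfolding vector_smult_scaleR[symmetric] Lsc by (simp add: scaleR_conv_of_real)
  qed
  then have bL: "bounded_linear L" by (simp add: linear_conv_bounded_linear)
  define C where "C = 8 / d\<^sup>2 * (\<integral>t. b t \<partial>lborel)"
  have est: "cmod (U (z + h) - U z - L h) \<le> C * (norm h)\<^sup>2" if h: "norm h \<le> d / 4" for h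
  proof -
    have zh: "z + h \<in> \<D>" using d h by (intro subsetD[OF d(2)]) (simp add: dist_norm)
    have "U (z + h) - U z - L h = (\<integral>t. indicator {0..} t *\<^sub>R f t (z + h) - indicator {0..} t *\<^sub>R f t z - indicator {0..} t *\<^sub>R D t h \<partial>lborel)"
      unfolding U_def L_def using integrable_closed z zh Dint by simp
    also have "norm \<dots> \<le> (\<integral>t. 8 / d\<^sup>2 * (norm h)\<^sup>2 * b t \<partial>lborel)"
    proof (rule Bochner_Integration.integral_norm_bound_integral)
      show "integrable lborel (\<lambda>t. indicator {0..} t *\<^sub>R f t (z + h) - indicator {0..} t *\<^sub>R f t z - indicator {0..} t *\<^sub>R D t h)"
        using integrable_closed z zh Dint by simp
      show "integrable lborel (\<lambda>t. 8 / d\<^sup>2 * (norm h)\<^sup>2 * b t)" using b_integrable by simp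
      show "norm (indicator {0..} t *\<^sub>R f t (z + h) - indicator {0..} t *\<^sub>R f t z - indicator {0..} t *\<^sub>R D t h) \<le> 8 / d\<^sup>2 * (norm h)\<^sup>2 * b t" for t
        using t2[OF _ h, of t] by (auto simp: b_def indicator_def mult_ac)
    qed
    finally show ?thesis by (simp add: C_def mult_ac)
  qed
  have "(U has_derivative L) (at z)"
  proof (rule has_derivativeI_sandwich[where e = "d / 4" and H = "\<lambda>y. C * norm (y - z)"])
    show "norm (U y - U z - L (y - z)) / norm (y - z) \<le> C * norm (y - z)" if "y \<noteq> z" "dist y z < d / 4" for y
    proof -
      have "0 < norm (y - z)" using that by simp
      moreover have "norm (U y - U z - L (y - z)) \<le> C * norm (y - z) * norm (y - z)"
        using est[of "y - z"] that by (simp add: dist_norm power2_eq_square)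
      ultimately show ?thesis by (simp add: pos_divide_le_eq)
    qed
    show "((\<lambda>y. C * norm (y - z)) \<longlongrightarrow> 0) (at z)"
    proof -
      have "((\<lambda>y. C * norm (y - z)) \<longlongrightarrow> C * norm (z - z)) (at z)" by (intro tendsto_intros)
      then show ?thesis by simp
    qed
  qed (use d bL in auto)
  then show "\<exists>f'. (U has_derivative f') (at z) \<and> (\<forall>c v. f' (c *s v) = c * f' v)"
    using Lsc by blast
qed

end

text \<open>If \<open>g\<close> vanishes to high order at the origin, the Laplace transform
  \<open>u z = \<integral>\<^sub>0\<^sup>\<infinity> exp (- \<mu> t) g (\<phi> t z) dt\<close> converges and solves \<open>F \<cdot> \<nabla>u - \<mu> u = - g\<close>;
  pairing with an eigenfunction for \<open>cnj \<mu>\<close> gives zero.\<close>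

lemma dual_eigenfunction_high_degree:
  fixes F :: "complex^'n \<Rightarrow> complex^'n"
  assumes flow: "holomorphic_flow F \<phi>" and fw: "forward_invariant \<phi>" and hyp: "stable_hyperbolic F \<phi> lam"
    and eig: "dual_eigenfunction F (cnj \<mu>) \<psi>"
  obtains N where "\<And>\<alpha>. N \<le> deg \<alpha> \<Longrightarrow> taylor \<psi> \<alpha> = 0"
proof -
  obtain c C where c: "0 < c" "0 < C" "\<And>z t. z \<in> \<D> \<Longrightarrow> 0 \<le> t \<Longrightarrow> norm (\<phi> t z) \<le> C * exp (- c * t)"
    using flow_decay[OF flow fw hyp] by blast
  \<comment> \<open>From degree \<open>N\<close> on the decay \<open>deg \<alpha> * c\<close> of the
    monomial along orbits outweighs the possible growth of \<open>exp (- \<mu> * t)\<close>, that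
    is, \<open>\<kappa>\<close> is positive.\<close>
  obtain N :: nat where N: "- Re \<mu> / c < N" using reals_Archimedean2 by blast
  have "taylor \<psi> \<alpha> = 0" if \<alpha>: "N \<le> deg \<alpha>" for \<alpha>
  proof -
    define \<kappa> where "\<kappa> = real (deg \<alpha>) * c + Re \<mu>"
    define f where "f = (\<lambda>t z. exp (- \<mu> * of_real t) * vmono (\<phi> t z) \<alpha>)"
    have "- Re \<mu> / c < real (deg \<alpha>)" using N \<alpha> by simp
    then have \<kappa>: "0 < \<kappa>" using c(1) by (simp add: \<kappa>_def field_simps)
    interpret decaying_family f "C ^ deg \<alpha>" \<kappa>
    proof
      show "holo_on (f t) \<D>" if "0 \<le> t" for t
        unfolding f_def by (intro holo_cmult holo_compose[OF holo_vmono[of _ UNIV] flowD(7)[OF flow that]]) auto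
      show "continuous_on (\<D> \<union> \<T>) (f t)" if "0 \<le> t" for t
        unfolding f_def by (intro continuous_intros continuous_on_compose2[OF vmono_continuous[of UNIV] flowD(8)[OF flow that]]) auto
      show "continuous_on {0..} (\<lambda>t. f t z)" if "z \<in> \<D>" for z
        unfolding f_def by (intro continuous_intros continuous_on_compose2[OF vmono_continuous[of UNIV] flow_continuous_time[OF flow that]]) auto
      show "cmod (f t z) \<le> C ^ deg \<alpha> * exp (- \<kappa> * t)" if "0 \<le> t" "z \<in> \<D>" for t z
      proof -
        have "cmod (vmono (\<phi> t z) \<alpha>) \<le> norm (\<phi> t z) ^ deg \<alpha>"
          by (rule norm_vmono_le[OF norm_nth_le_vec])
        also have "\<dots> \<le> (C * exp (- c * t)) ^ deg \<alpha>"
          by (intro power_mono c(3) that norm_ge_zero)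
        also have "\<dots> = C ^ deg \<alpha> * exp (real (deg \<alpha>) * (- c * t))"
          by (simp only: power_mult_distrib exp_of_nat_mult)
        finally have "cmod (f t z) \<le> exp (- Re \<mu> * t) * (C ^ deg \<alpha> * exp (real (deg \<alpha>) * (- c * t)))"
          unfolding f_def norm_mult by (intro mult_mono) (auto simp: norm_exp_eq_Re)
        also have "\<dots> = C ^ deg \<alpha> * exp (- \<kappa> * t)"
          by (simp add: \<kappa>_def exp_add[symmetric] algebra_simps)
        finally show ?thesis .
      qed
      show "0 < \<kappa>" by (rule \<kappa>)
    qed
    \<comment> \<open>By the semigroup law \<open>U\<close> along an orbit is explicit up to an
      integral over [0, s], so its derivative at \<open>s = 0\<close> follows from the fundamental
      theorem of calculus.\<close>
    have shift: "U (\<phi> s z) = exp (\<mu> * of_real s) * (U z - integral {0..s} (\<lambda>t. f t z))" if z: "z \<in> \<D>" and s: "0 \<le> s" for z s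
    proof -
      have zDT: "z \<in> \<D> \<union> \<T>" using z by simp
      have fs: "f t (\<phi> s z) = exp (\<mu> * of_real s) * f (s + t) z" if "0 \<le> t" for t
      proof -
        have "\<phi> t (\<phi> s z) = \<phi> (s + t) z" using flowD(5)[OF flow that s z] by (simp add: add.commute)
        moreover have "exp (- \<mu> * of_real t) = exp (\<mu> * of_real s) * exp (- \<mu> * of_real (s + t))"
          by (simp add: exp_add[symmetric] algebra_simps)
        ultimately show ?thesis by (simp add: f_def)
      qed
      have "U (\<phi> s z) = (\<integral>t. exp (\<mu> * of_real s) * (indicator {s..} (s + 1 * t) *\<^sub>R f (s + 1 * t) z) \<partial>lborel)"
        unfolding U_def by (intro Bochner_Integration.integral_cong) (auto simp: indicator_def fs)
      also have "\<dots> = exp (\<mu> * of_real s) * (\<integral>t. indicator {s..} (s + 1 * t) *\<^sub>R f (s + 1 * t) z \<partial>lborel)"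
        by (rule integral_mult_right_zero)
      also have "(\<integral>t. indicator {s..} (s + 1 * t) *\<^sub>R f (s + 1 * t) z \<partial>lborel) = (\<integral>t. indicator {s..} t *\<^sub>R f t z \<partial>lborel)"
        by (subst lborel_integral_real_affine[of 1 "\<lambda>t. indicator {s..} t *\<^sub>R f t z" s]) simp_all
      also have "\<dots> = U z - integral {0..s} (\<lambda>t. f t z)"
      proof -
        have cs: "continuous_on {0..s} (\<lambda>t. f t z)" by (rule continuous_on_subset[OF time[OF z]]) auto
        have int0: "set_integrable lborel {0..s} (\<lambda>t. f t z)" by (rule borel_integrable_atLeastAtMost'[OF cs])
        have ints: "integrable lborel (\<lambda>t. indicator {s..} t *\<^sub>R f t z)"
        proof -
          have "integrable lborel (\<lambda>t. indicator {s..} t *\<^sub>R (indicator {0..} t *\<^sub>R f t z))"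
            by (intro integrable_mult_indicator integrable_closed[OF zDT]) simp
          moreover have "(\<lambda>t. indicator {s..} t *\<^sub>R (indicator {0..} t *\<^sub>R f t z)) = (\<lambda>t. indicator {s..} t *\<^sub>R f t z)"
            using s by (auto simp: indicator_def fun_eq_iff)
          ultimately show ?thesis by simp
        qed
        \<comment> \<open>The intervals \<open>{0..s}\<close> and \<open>{s..}\<close> overlap in
          the point \<open>s\<close>.\<close>
        have "AE t in lborel. t \<noteq> s" by (rule AE_lborel_singleton)
        then have "U z = (\<integral>t. indicator {0..s} t *\<^sub>R f t z + indicator {s..} t *\<^sub>R f t z \<partial>lborel)"
          unfolding U_def
          using integrable_closed[OF zDT] ints int0 s
          by (intro integral_cong_AE) (auto simp: indicator_def set_integrable_def)
        also have "\<dots> = (\<integral>t. indicator {0..s} t *\<^sub>R f t z \<partial>lborel) + (\<integral>t. indicator {s..} t *\<^sub>R f t z \<partial>lborel)"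
          using ints int0 by (intro Bochner_Integration.integral_add) (simp_all add: set_integrable_def)
        also have "(\<integral>t. indicator {0..s} t *\<^sub>R f t z \<partial>lborel) = integral {0..s} (\<lambda>t. f t z)"
          using set_borel_integral_eq_integral(2)[OF int0] by (simp add: set_lebesgue_integral_def)
        finally show ?thesis by simp
      qed
      finally show ?thesis .
    qed
    have DU: "frechet_derivative U (at z) (F z) = \<mu> * U z - vmono z \<alpha>" if z: "z \<in> \<D>" for z
    proof -
      have f0: "f 0 z = vmono z \<alpha>" using flowD(3)[OF flow z] by (simp add: f_def)
      \<comment> \<open>Derivatives at 0 are one-sided because the flow is given for nonnegative
        times; on \<open>{0..1}\<close> they are still unique.\<close>
      have d\<phi>: "((\<lambda>s. \<phi> s z) has_derivative (\<lambda>h. h *\<^sub>R F z)) (at 0 within {0..1})"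
        using has_vector_derivative_within_subset[OF flowD(6)[OF flow order_refl z], of "{0..1}"] flowD(3)[OF flow z]
        by (simp add: has_vector_derivative_def)
      have dU: "(U has_derivative frechet_derivative U (at z)) (at (\<phi> 0 z))"
        using holo_onD(1)[OF U_holo z] flowD(3)[OF flow z] by simp
      have "((\<lambda>s. U (\<phi> s z)) has_derivative (\<lambda>h. frechet_derivative U (at z) (h *\<^sub>R F z))) (at 0 within {0..1})"
        by (rule has_derivative_compose[OF d\<phi> dU])
      then have 1: "((\<lambda>s. U (\<phi> s z)) has_vector_derivative frechet_derivative U (at z) (F z)) (at 0 within {0..1})"
        unfolding has_vector_derivative_def vector_smult_scaleR[symmetric] holo_onD(2)[OF U_holo z]
        by (simp add: scaleR_conv_of_real)
      have "((\<lambda>s. integral {0..s} (\<lambda>t. f t z)) has_vector_derivative f 0 z) (at 0 within {0..1})"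
        by (rule integral_has_vector_derivative) (auto intro: continuous_on_subset[OF time[OF z]])
      moreover have "((\<lambda>s. exp (\<mu> * of_real s)) has_vector_derivative \<mu> * exp (\<mu> * of_real 0)) (at 0 within {0..1})"
        by (rule has_vector_derivative_real_field) (auto intro!: derivative_eq_intros)
      ultimately have "((\<lambda>s. exp (\<mu> * of_real s) * (U z - integral {0..s} (\<lambda>t. f t z))) has_vector_derivative
          exp (\<mu> * of_real 0) * (0 - f 0 z) + \<mu> * exp (\<mu> * of_real 0) * (U z - integral {0..0} (\<lambda>t. f t z))) (at 0 within {0..1})"
        by (intro has_vector_derivative_mult has_vector_derivative_diff has_vector_derivative_const)
      then have "((\<lambda>s. exp (\<mu> * of_real s) * (U z - integral {0..s} (\<lambda>t. f t z))) has_vector_derivative \<mu> * U z - vmono z \<alpha>) (at 0 within {0..1})"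
        by (simp add: f0)
      then have 2: "((\<lambda>s. U (\<phi> s z)) has_vector_derivative \<mu> * U z - vmono z \<alpha>) (at 0 within {0..1})"
        by (rule has_vector_derivative_transform[rotated 2]) (use shift[OF z] in auto)
      show ?thesis
        using vector_derivative_unique_within_closed_interval[of 0 "1::real" 0 "\<lambda>s. U (\<phi> s z)"] 1 2 by (simp add: cbox_interval)
    qed
    have gU: "gen F (on_disc U) = (\<lambda>z. \<mu> * on_disc U z - on_disc (\<lambda>z. vmono z \<alpha>) z)"
      unfolding gen_on_disc[OF U_holo] by (auto simp: on_disc_def DU fun_eq_iff)
    have U2: "on_disc U \<in> \<H>\<^sup>2" by (rule hardy_on_disc[OF U_holo U_continuous])
    have "(\<lambda>z. \<mu> * on_disc U z - on_disc (\<lambda>z. vmono z \<alpha>) z) = on_disc (\<lambda>z. \<mu> * U z - vmono z \<alpha>)"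
      by (auto simp: on_disc_def fun_eq_iff)
    also have "\<dots> \<in> \<H>\<^sup>2"
      by (intro hardy_on_disc holo_diff holo_cmult U_holo holo_vmono continuous_intros U_continuous vmono_continuous)
    finally have "on_disc U \<in> gen_dom F" using U2 by (simp add: gen_dom_def gU)
    \<comment> \<open>The terms with \<open>U\<close> cancel, so the monomial is orthogonal to
      \<open>\<psi>\<close>, and its pairing is the conjugate of the coefficient in
      question.\<close>
    from dual_eigenfunctionD(3)[OF flow eig this]
    have "\<mu> * hinner (on_disc U) \<psi> - hinner (on_disc (\<lambda>z. vmono z \<alpha>)) \<psi> = \<mu> * hinner (on_disc U) \<psi>"
      unfolding gU hinner_scale_diff[OF U2 hardy_vmono dual_eigenfunctionD(1)[OF flow eig]] .
    then show ?thesis by (simp add: hinner_vmono)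
  qed
  then show ?thesis using that by blast
qed

text \<open>Degrees from 2 on are removed downwards from a degree above which all coefficients
  vanish. In degree 0 the generator kills constants, while \<open>lam j\<close> is nonzero.\<close>

lemma dual_eigenfunction_degree_one:
  fixes F :: "complex^'n \<Rightarrow> complex^'n"
  assumes flow: "holomorphic_flow F \<phi>" and fw: "forward_invariant \<phi>" and hyp: "stable_hyperbolic F \<phi> lam"
    and nr: "nonresonant lam" and eig: "dual_eigenfunction F (cnj (lam j)) \<psi>" and \<alpha>: "deg \<alpha> \<noteq> 1"
  shows "taylor \<psi> \<alpha> = 0"
proof -
  obtain N where N: "\<And>\<alpha>. N \<le> deg \<alpha> \<Longrightarrow> taylor \<psi> \<alpha> = 0"
    using dual_eigenfunction_high_degree[OF flow fw hyp eig] by blast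
  have step: "taylor \<psi> \<beta> = 0" if d: "2 \<le> deg \<beta>" "\<And>\<gamma>. deg \<beta> < deg \<gamma> \<Longrightarrow> taylor \<psi> \<gamma> = 0" for \<beta>
  proof -
    obtain as where as: "length as = deg \<beta>" "(\<lambda>z. vmono z \<beta>) = form_prod as" using vmono_form_prod .
    have "hinner (on_disc (form_prod as)) \<psi> = 0"
      by (rule hinner_forms_zero[OF flow hyp nr eig d(1) d(2) as(1)])
    then show ?thesis unfolding as(2)[symmetric] hinner_vmono by simp
  qed
  \<comment> \<open>\<open>m\<close> bounds the distance from \<open>deg \<beta>\<close> up to
    \<open>N\<close>, so the induction runs through decreasing degrees.\<close>
  have "taylor \<psi> \<beta> = 0" if "2 \<le> deg \<beta>" "N \<le> deg \<beta> + m" for \<beta> m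
    using that
  proof (induction m arbitrary: \<beta>)
    case 0
    then show ?case using N by simp
  next
    case (Suc m)
    show ?case by (rule step[OF Suc.prems(1)], rule Suc.IH) (use Suc.prems in auto)
  qed
  from this[of \<alpha> N] have ge2: "2 \<le> deg \<alpha> \<Longrightarrow> taylor \<psi> \<alpha> = 0" by simp
  show ?thesis
  proof (cases "deg \<alpha> = 0")
    case True
    then have \<alpha>0: "\<alpha> = (\<lambda>_. 0)" by (auto simp: deg_def)
    have vm: "(\<lambda>z. vmono z \<alpha>) = form_prod ([] :: (complex^'n) list)" by (simp add: \<alpha>0 vmono_def fun_eq_iff)
    \<comment> \<open>The zero function is written as an empty sum, so that
      \<open>hinner_sum\<close> evaluates its pairing.\<close>
    have "gen F (on_disc (\<lambda>z. vmono z \<alpha>)) = (\<lambda>z. \<Sum>i\<in>({} :: nat set). 0 * on_disc (\<lambda>z. vmono z \<alpha>) z)"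
      unfolding vm gen_form_prod by (auto simp: on_disc_def fun_eq_iff)
    then have "hinner (gen F (on_disc (\<lambda>z. vmono z \<alpha>))) \<psi> = 0"
      using hinner_sum[OF hardy_vmono dual_eigenfunctionD(1)[OF flow eig], of "{} :: nat set"] by simp
    then have "lam j * hinner (on_disc (\<lambda>z. vmono z \<alpha>)) \<psi> = 0"
      using dual_eigenfunctionD(3)[OF flow eig gen_dom_vmono[OF flow]] by simp
    moreover have "lam j \<noteq> 0" using stable_hyperbolicD(5)[OF hyp, of j] by auto
    ultimately show ?thesis by (simp add: hinner_vmono)
  next
    case False
    then show ?thesis using ge2 \<alpha> by simp
  qed
qed

text \<open>If \<open>v\<close> were 0, all coefficients of \<open>\<psi>\<close> would vanish. That
  \<open>v\<close> is a right eigenvector is the weak eigenvalue equation tested with the coordinate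
  functions, which the generator maps to the components of \<open>F\<close>.\<close>

lemma principal_eigenfunction:
  fixes F :: "complex^'n \<Rightarrow> complex^'n"
  assumes flow: "holomorphic_flow F \<phi>" and fw: "forward_invariant \<phi>" and hyp: "stable_hyperbolic F \<phi> lam"
    and nr: "nonresonant lam" and eig: "dual_eigenfunction F (cnj (lam j)) \<psi>"
  obtains v where "v \<noteq> 0" "jacobian F 0 *v v = lam j *s v"
    "\<And>h. holo_on h \<D> \<Longrightarrow> hinner h \<psi> = frechet_derivative h (at 0) v"
proof -
  note deg1 = dual_eigenfunction_degree_one[OF flow fw hyp nr eig]
  define v where "v = (\<chi> l. cnj (taylor \<psi> (unit_index l)))"
  have rep: "hinner h \<psi> = frechet_derivative h (at 0) v" if "holo_on h \<D>" for h
    unfolding v_def by (rule hinner_degree_one[OF that deg1])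
  have "v \<noteq> 0"
  proof
    assume v0: "v = 0"
    have "taylor \<psi> \<alpha> = taylor (\<lambda>z::complex^'n. 0) \<alpha>" for \<alpha>
    proof -
      have "cnj (taylor \<psi> \<alpha>) = frechet_derivative (on_disc (\<lambda>z. vmono z \<alpha>)) (at 0) 0"
        using rep[OF hardyD(1)[OF hardy_vmono]] v0 by (simp add: hinner_vmono)
      also have "\<dots> = 0"
        by (rule linear_0[OF has_derivative_linear[OF holo_onD(1)[OF hardyD(1)[OF hardy_vmono] zero_in_disc]]])
      finally have "taylor \<psi> \<alpha> = 0" by simp
      moreover have "taylor (\<lambda>z::complex^'n. 0) = (\<lambda>\<alpha>. 0)" by (rule taylor_eqI) auto
      ultimately show ?thesis by simp
    qed
    moreover have "(\<lambda>z::complex^'n. 0) \<in> \<H>\<^sup>2"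
      by (rule hardy_I[of _ "\<lambda>_. 0"]) (auto intro: holo_const)
    ultimately have "\<psi> = (\<lambda>z. 0)"
      using dual_eigenfunctionD(1)[OF flow eig] by (intro hardy_eqI) auto
    then show False using dual_eigenfunctionD(2)[OF flow eig] by blast
  qed
  moreover have "(jacobian F 0 *v v) $ k = (lam j *s v) $ k" for k
  proof -
    have vm: "(\<lambda>z::complex^'n. z $ k) = form_prod [axis k 1]" by (simp add: fun_eq_iff)
    have "gen F (on_disc (\<lambda>z. z $ k)) = on_disc (\<lambda>z. F z $ k)"
      unfolding vm gen_form_prod by simp
    then have "hinner (on_disc (\<lambda>z. F z $ k)) \<psi> = lam j * hinner (on_disc (\<lambda>z. z $ k)) \<psi>"
      using dual_eigenfunctionD(3)[OF flow eig gen_dom_form_prod[OF flow, of "[axis k 1]"]] unfolding vm by simp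
    moreover have "hinner (on_disc (\<lambda>z. F z $ k)) \<psi> = (jacobian F 0 *v v) $ k"
      using rep[OF holo_on_disc[OF flowD(1)[OF flow, of k]]]
      by (simp add: frechet_derivative_on_disc[OF flowD(1)[OF flow] zero_in_disc] jacobian_mult[OF flowD(1)[OF flow]])
    moreover have "hinner (on_disc (\<lambda>z. z $ k)) \<psi> = v $ k"
      using hinner_vmono[of "unit_index k" \<psi>] by (simp add: vmono_unit_index v_def)
    ultimately show ?thesis by simp
  qed
  then have "jacobian F 0 *v v = lam j *s v" by (simp add: vec_eq_iff)
  ultimately show ?thesis using that rep by blast
qed

section \<open>Exponential sums and perturbed diagonal systems\<close>

text \<open>Nonzero solutions of \<open>exp w = 1\<close> have modulus at least 2 pi. Normalising a
  modulus to 1 is thus a simple way to choose a time at which two exponentials differ.\<close>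

lemma exp_eq_1_imp_large:
  assumes "cmod w = 1"
  shows "exp w \<noteq> 1"
proof
  assume "exp w = 1"
  then obtain n :: int where n: "Re w = 0" "Im w = of_int (2 * n) * pi" by (auto simp: exp_eq_1)
  have "\<bar>Im w\<bar> = 1" using assms n(1) by (simp add: cmod_def)
  then have "\<bar>of_int (2 * n)\<bar> * pi = 1" using n(2) by (simp add: abs_mult)
  moreover have "n \<noteq> 0" using calculation by auto
  then have "1 \<le> \<bar>real_of_int (2 * n)\<bar>" by simp
  then have "pi \<le> \<bar>of_int (2 * n)\<bar> * pi" using pi_gt_zero by simp
  ultimately show False using pi_gt3 by simp
qed

text \<open>Replacing \<open>f t\<close> by \<open>f (t + \<tau>) - exp (l k * \<tau>) * f t\<close> removes the \<open>k\<close>-th exponential.\<close>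

lemma exp_sum_coeffs_zero:
  fixes l :: "'i \<Rightarrow> complex"
  assumes "finite S" "inj_on l S" "\<And>j. j \<in> S \<Longrightarrow> \<kappa> < Re (l j)"
    and "\<And>t. T \<le> t \<Longrightarrow> cmod (\<Sum>j\<in>S. d j * exp (l j * of_real t)) \<le> M * exp (\<kappa> * t)" and "j \<in> S"
  shows "d j = 0"
  using assms
proof (induction S arbitrary: d M j rule: finite_induct)
  case (insert k S)
  let ?f = "\<lambda>t::real. \<Sum>j\<in>insert k S. d j * exp (l j * of_real t)"
  have S0: "d i = 0" if i: "i \<in> S" for i
  proof -
    have ne: "l i \<noteq> l k" using insert.prems(1) insert.hyps(2) i by (metis inj_on_contraD insertCI)
    \<comment> \<open>The shift is adapted to the pair \<open>i\<close>, \<open>k\<close>: it makes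
      the exponent difference of modulus 1, so the new factor of the \<open>i\<close>-th coefficient
      is nonzero.\<close>
    define \<tau> where "\<tau> = 1 / cmod (l i - l k)"
    have \<tau>: "0 < \<tau>" using ne by (simp add: \<tau>_def)
    have "cmod ((l i - l k) * of_real \<tau>) = 1" using ne by (simp add: \<tau>_def norm_mult norm_divide)
    then have "exp ((l i - l k) * of_real \<tau>) \<noteq> 1" by (rule exp_eq_1_imp_large)
    then have dne: "exp (l i * of_real \<tau>) - exp (l k * of_real \<tau>) \<noteq> 0"
      by (simp add: left_diff_distrib exp_diff)
    have "d i * (exp (l i * of_real \<tau>) - exp (l k * of_real \<tau>)) = 0"
    proof (rule insert.IH[of "\<lambda>j. d j * (exp (l j * of_real \<tau>) - exp (l k * of_real \<tau>))"
          "M * exp (\<kappa> * \<tau>) + cmod (exp (l k * of_real \<tau>)) * M"])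
      show "inj_on l S" using insert.prems(1) by (rule inj_on_subset) auto
      fix t assume t: "T \<le> t"
      have "(\<Sum>j\<in>S. d j * (exp (l j * of_real \<tau>) - exp (l k * of_real \<tau>)) * exp (l j * of_real t)) =
          (\<Sum>j\<in>insert k S. d j * (exp (l j * of_real \<tau>) - exp (l k * of_real \<tau>)) * exp (l j * of_real t))"
        using insert.hyps by simp
      also have "\<dots> = ?f (t + \<tau>) - exp (l k * of_real \<tau>) * ?f t"
        unfolding sum_distrib_left sum_subtractf[symmetric]
        by (intro sum.cong) (simp_all add: exp_add distrib_left algebra_simps)
      also have "cmod \<dots> \<le> cmod (?f (t + \<tau>)) + cmod (exp (l k * of_real \<tau>)) * cmod (?f t)"
        unfolding norm_mult[symmetric] by (rule norm_triangle_ineq4)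
      also have "\<dots> \<le> M * exp (\<kappa> * (t + \<tau>)) + cmod (exp (l k * of_real \<tau>)) * (M * exp (\<kappa> * t))"
        using insert.prems(3)[of t] insert.prems(3)[of "t + \<tau>"] t \<tau> by (intro add_mono mult_left_mono) auto
      also have "\<dots> = (M * exp (\<kappa> * \<tau>) + cmod (exp (l k * of_real \<tau>)) * M) * exp (\<kappa> * t)"
        by (simp add: distrib_left exp_add algebra_simps)
      finally show "cmod (\<Sum>j\<in>S. d j * (exp (l j * of_real \<tau>) - exp (l k * of_real \<tau>)) * exp (l j * of_real t))
          \<le> (M * exp (\<kappa> * \<tau>) + cmod (exp (l k * of_real \<tau>)) * M) * exp (\<kappa> * t)" .
    qed (use insert.prems i in auto)
    then show ?thesis using dne by simp
  qed
  \<comment> \<open>Only the \<open>k\<close>-th exponential remains, and its rate exceeds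
    \<open>\<kappa>\<close>.\<close>
  have "cmod (d k) \<le> M * exp (- (Re (l k) - \<kappa>) * t)" if "T \<le> t" for t
  proof -
    have "cmod (d k) * exp (Re (l k) * t) \<le> M * exp (\<kappa> * t)"
      using insert.prems(3)[OF that] insert.hyps S0 by (simp add: norm_mult norm_exp_eq_Re)
    then have "cmod (d k) * exp (Re (l k) * t) * exp (- Re (l k) * t) \<le> M * exp (\<kappa> * t) * exp (- Re (l k) * t)"
      by (rule mult_right_mono) simp
    then show ?thesis by (simp add: mult.assoc exp_add[symmetric] algebra_simps)
  qed
  then have ev: "\<forall>\<^sub>F t in at_top. cmod (d k) \<le> M * exp (- (Re (l k) - \<kappa>) * t)"
    by (rule eventually_mono[OF eventually_ge_at_top[of T]])
  have "((\<lambda>t. M * exp (- (Re (l k) - \<kappa>) * t)) \<longlongrightarrow> M * 0) at_top"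
    by (intro tendsto_intros exp_decay_tendsto_0) (use insert.prems(2)[of k] in simp)
  then have "cmod (d k) \<le> M * 0" by (rule tendsto_lowerbound[OF _ ev]) simp
  then show ?case using S0 insert.prems(4) by auto
qed simp

text \<open>\<open>M / a * exp (a * t)\<close> is a primitive of the bound for either sign of
  \<open>a\<close>: positive \<open>a\<close> limits growth, negative \<open>a\<close> gives a
  Cauchy estimate at infinity.\<close>

lemma exp_integrated_bound:
  fixes p p' :: "real \<Rightarrow> complex"
  assumes p: "\<And>t. T \<le> t \<Longrightarrow> (p has_vector_derivative p' t) (at t)"
    and p': "\<And>t. T \<le> t \<Longrightarrow> cmod (p' t) \<le> M * exp (a * t)" and a: "a \<noteq> 0" and st: "T \<le> s" "s \<le> t"
  shows "cmod (p t - p s) \<le> M / a * exp (a * t) - M / a * exp (a * s)"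
proof (cases "s = t")
  case False
  show ?thesis
  proof (rule differentiable_bound_general[where f = p and f' = p' and \<phi>' = "\<lambda>t. M * exp (a * t)" and \<phi> = "\<lambda>t. M / a * exp (a * t)"])
    show "s < t" using False st by simp
    show "continuous_on {s..t} p"
      using has_vector_derivative_continuous[OF p] st(1) by (intro continuous_at_imp_continuous_on) simp
    show "continuous_on {s..t} (\<lambda>t. M / a * exp (a * t))" by (intro continuous_intros)
    show "(p has_vector_derivative p' x) (at x)" if "s < x" "x < t" for x using p that st by simp
    show "((\<lambda>t. M / a * exp (a * t)) has_vector_derivative M * exp (a * x)) (at x)" for x
      unfolding has_real_derivative_iff_has_vector_derivative[symmetric]
      using a by (auto intro!: derivative_eq_intros)
    show "cmod (p' x) \<le> M * exp (a * x)" if "s < x" "x < t" for x using p' that st by simp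
  qed
qed simp

lemma exp_bounded_mono:
  fixes T :: real
  assumes "0 \<le> T" "T \<le> t" "\<rho> \<le> \<kappa>" "0 \<le> M"
  shows "M * exp (\<rho> * t) \<le> M * exp (\<kappa> * t)"
  using assms by (intro mult_left_mono) (auto intro: mult_right_mono)

text \<open>Variation of constants: \<open>p t = exp (- l * t) * y t\<close> has derivative
  \<open>exp (- l * t) * r t\<close>. If \<open>Re l > \<kappa>\<close>, then \<open>p\<close>
  converges and \<open>b\<close> is its limit; otherwise the homogeneous solution is itself within
  the error.\<close>

lemma scalar_asymptotics:
  fixes y r :: "real \<Rightarrow> complex" and l :: complex
  assumes y: "\<And>t. T \<le> t \<Longrightarrow> (y has_vector_derivative (l * y t + r t)) (at t)"
    and r: "\<And>t. T \<le> t \<Longrightarrow> cmod (r t) \<le> M * exp (\<rho> * t)" and M: "0 \<le> M" and T: "0 \<le> T" and \<rho>: "\<rho> < \<kappa>"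
  obtains b M' where "0 \<le> M'" "\<And>t. T \<le> t \<Longrightarrow> cmod (y t - b * exp (l * of_real t)) \<le> M' * exp (\<kappa> * t)"
    "Re l \<le> \<kappa> \<Longrightarrow> b = 0"
proof -
  define p where "p = (\<lambda>t. exp (- l * of_real t) * y t)"
  have p: "(p has_vector_derivative exp (- l * of_real t) * r t) (at t)" if "T \<le> t" for t
  proof -
    have e: "((\<lambda>t. exp (- l * of_real t)) has_vector_derivative - l * exp (- l * of_real t)) (at t)"
      by (rule has_vector_derivative_real_field) (auto intro!: derivative_eq_intros)
    have "(p has_vector_derivative exp (- l * of_real t) * (l * y t + r t) + (- l * exp (- l * of_real t)) * y t) (at t)"
      unfolding p_def by (rule has_vector_derivative_mult[OF e y[OF that]])
    then show ?thesis by (simp add: algebra_simps)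
  qed
  have p': "cmod (exp (- l * of_real t) * r t) \<le> M * exp ((\<nu> - Re l) * t)" if "T \<le> t" "\<rho> \<le> \<nu>" for t \<nu>
  proof -
    have "cmod (exp (- l * of_real t) * r t) \<le> exp (- Re l * t) * (M * exp (\<nu> * t))"
      unfolding norm_mult using r[OF that(1)] exp_bounded_mono[OF T that M]
      by (intro mult_mono) (auto simp: norm_exp_eq_Re)
    then show ?thesis by (simp add: left_diff_distrib exp_diff exp_minus field_simps)
  qed
  have yp: "y t = p t * exp (l * of_real t)" for t
    by (simp add: p_def exp_minus field_simps)
  have nexp: "cmod (exp (l * of_real t)) = exp (Re l * t)" for t by (simp add: norm_exp_eq_Re)
  consider "Re l < \<kappa>" | "Re l = \<kappa>" | "\<kappa> < Re l" by linarith
  then show ?thesis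
  proof cases
    case 1
    \<comment> \<open>The rate of \<open>r\<close> is weakened from \<open>\<rho>\<close> to
      \<open>\<kappa>\<close>, which makes the exponent positive; \<open>\<rho> - Re l\<close> could
      be 0 here.\<close>
    define a where "a = \<kappa> - Re l"
    have a: "0 < a" using 1 by (simp add: a_def)
    have "cmod (y t - 0 * exp (l * of_real t)) \<le> (cmod (p T) + M / a) * exp (\<kappa> * t)" if t: "T \<le> t" for t
    proof -
      have "cmod (p t - p T) \<le> M / a * exp (a * t) - M / a * exp (a * T)"
        unfolding a_def by (rule exp_integrated_bound[OF p p' _ order_refl t]) (use \<rho> 1 in auto)
      moreover have "0 \<le> M / a * exp (a * T)" using M a by simp
      moreover have "cmod (p t) \<le> cmod (p T) + cmod (p t - p T)" using norm_triangle_sub[of "p t" "p T"] by simp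
      moreover have "cmod (p T) * 1 \<le> cmod (p T) * exp (a * t)" using a t T by (intro mult_left_mono) auto
      ultimately have "cmod (p t) \<le> (cmod (p T) + M / a) * exp (a * t)" by (simp add: distrib_right)
      then have "cmod (p t) * exp (Re l * t) \<le> (cmod (p T) + M / a) * exp (a * t) * exp (Re l * t)"
        by (intro mult_right_mono) auto
      then show ?thesis
        by (simp add: yp norm_mult nexp a_def mult.assoc exp_add[symmetric] left_diff_distrib)
    qed
    then show ?thesis using that[of "cmod (p T) + M / a" 0] M a by simp
  next
    case 2
    \<comment> \<open>Here \<open>\<rho> < \<kappa>\<close> must be used strictly: it keeps
      \<open>p\<close> bounded, whereas the rate \<open>\<kappa>\<close> would produce an additional
      factor \<open>t\<close>.\<close>
    define a where "a = \<rho> - Re l"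
    have a: "a < 0" using 2 \<rho> by (simp add: a_def)
    have "cmod (y t - 0 * exp (l * of_real t)) \<le> (cmod (p T) + M / (- a)) * exp (\<kappa> * t)" if t: "T \<le> t" for t
    proof -
      have "cmod (p t - p T) \<le> M / a * exp (a * t) - M / a * exp (a * T)"
        unfolding a_def by (rule exp_integrated_bound[OF p p' _ order_refl t]) (use a in \<open>auto simp: a_def\<close>)
      moreover have "M / a * exp (a * t) \<le> 0" using M a by (simp add: divide_nonneg_neg mult_nonpos_nonneg)
      moreover have "M / (- a) * exp (a * T) \<le> M / (- a) * 1"
        using M a T by (intro mult_left_mono) (auto simp: mult_nonpos_nonneg divide_nonneg_neg)
      moreover have "cmod (p t) \<le> cmod (p T) + cmod (p t - p T)" using norm_triangle_sub[of "p t" "p T"] by simp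
      ultimately have "cmod (p t) \<le> cmod (p T) + M / (- a)" by simp
      then have "cmod (p t) * exp (Re l * t) \<le> (cmod (p T) + M / (- a)) * exp (Re l * t)"
        by (intro mult_right_mono) auto
      then show ?thesis using 2 by (simp add: yp norm_mult nexp)
    qed
    moreover have "0 \<le> cmod (p T) + M / (- a)"
      using M a by (intro add_nonneg_nonneg divide_nonneg_pos) auto
    ultimately show ?thesis using that by blast
  next
    case 3
    define a where "a = \<rho> - Re l"
    have a: "a < 0" using 3 \<rho> by (simp add: a_def)
    have diff: "cmod (p t - p s) \<le> M / (- a) * exp (a * s)" if st: "T \<le> s" "s \<le> t" for s t
    proof -
      have "cmod (p t - p s) \<le> M / a * exp (a * t) - M / a * exp (a * s)"
        unfolding a_def by (rule exp_integrated_bound[OF p p' _ st]) (use a in \<open>auto simp: a_def\<close>)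
      moreover have "M / a * exp (a * t) \<le> 0" using M a by (simp add: divide_nonneg_neg mult_nonpos_nonneg)
      ultimately show ?thesis by simp
    qed
    have "p (T + real n) \<in> cball (p T) (M / (- a) * exp (a * T))" for n
      using diff[of T "T + real n"] by (simp add: dist_norm norm_minus_commute)
    \<comment> \<open>A limit along a subsequence of the times \<open>T + n\<close> is enough,
      because \<open>diff\<close> controls \<open>p\<close> at all later times.\<close>
    then obtain b q where b: "strict_mono (q :: nat \<Rightarrow> nat)" "((\<lambda>n. p (T + real n)) \<circ> q) \<longlonglongrightarrow> b"
      using compact_cball unfolding compact_def by (metis (no_types, lifting))
    have lim: "cmod (b - p s) \<le> M / (- a) * exp (a * s)" if s: "T \<le> s" for s
    proof (rule tendsto_upperbound)
      show "(\<lambda>n. cmod (p (T + real (q n)) - p s)) \<longlonglongrightarrow> cmod (b - p s)"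
        using b(2) unfolding o_def by (intro tendsto_intros)
      have "cmod (p (T + real (q n)) - p s) \<le> M / (- a) * exp (a * s)" if n: "nat \<lceil>s\<rceil> \<le> n" for n
      proof (rule diff[OF s])
        have "s \<le> real n" using n by linarith
        also have "real n \<le> real (q n)" using seq_suble[OF b(1)] by simp
        finally show "s \<le> T + real (q n)" using T by simp
      qed
      then show "\<forall>\<^sub>F n in sequentially. cmod (p (T + real (q n)) - p s) \<le> M / (- a) * exp (a * s)"
        unfolding eventually_sequentially by blast
    qed simp
    have "cmod (y t - b * exp (l * of_real t)) \<le> M / (- a) * exp (\<kappa> * t)" if t: "T \<le> t" for t
    proof -
      have "cmod (y t - b * exp (l * of_real t)) = cmod (b - p t) * exp (Re l * t)"
        unfolding yp left_diff_distrib[symmetric] norm_mult nexp by (simp add: norm_minus_commute)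
      also have "\<dots> \<le> M / (- a) * exp (a * t) * exp (Re l * t)" by (intro mult_right_mono lim t) simp
      also have "\<dots> = M / (- a) * exp (\<rho> * t)"
        by (simp add: a_def mult.assoc exp_add[symmetric] left_diff_distrib)
      also have "\<dots> \<le> M / (- a) * exp (\<kappa> * t)"
        by (rule exp_bounded_mono[OF T t]) (use \<rho> M a in \<open>auto simp: divide_nonneg_neg\<close>)
      finally show ?thesis .
    qed
    then show ?thesis using that[of "M / (- a)" b] M a 3 by (simp add: divide_nonneg_neg)
  qed
qed

text \<open>The exponentials slower than the improved rate are annihilated by the output up to that rate,
  hence absent by independence of exponentials.\<close>

lemma observed_decay_step:
  fixes y :: "real \<Rightarrow> complex^'n" and g :: "'m \<Rightarrow> 'n \<Rightarrow> complex"
  assumes ode: "\<And>j t. T \<le> t \<Longrightarrow> ((\<lambda>t. y t $ j) has_vector_derivative (lam j * y t $ j + r j t)) (at t)"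
    and r: "\<And>j t. T \<le> t \<Longrightarrow> cmod (r j t) \<le> M * exp (- c * t) * norm (y t)"
    and g: "\<And>i t. T \<le> t \<Longrightarrow> cmod (\<Sum>j\<in>UNIV. g i j * y t $ j) \<le> M * exp (- c * t) * norm (y t)"
    and obs: "\<And>j. \<beta> < Re (lam j) \<Longrightarrow> \<exists>i. g i j \<noteq> 0"
    and inj: "inj lam" and T: "0 \<le> T" and M: "0 \<le> M"
    and y: "\<And>t. T \<le> t \<Longrightarrow> norm (y t) \<le> A * exp (\<sigma> * t)" and A: "0 \<le> A"
    and s: "s < c" "\<beta> \<le> \<sigma> - s"
  obtains A' where "0 \<le> A'" "\<And>t. T \<le> t \<Longrightarrow> norm (y t) \<le> A' * exp ((\<sigma> - s) * t)"
proof -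
  define \<kappa> where "\<kappa> = \<sigma> - s"
  have small: "M * exp (- c * t) * norm (y t) \<le> M * A * exp ((\<sigma> - c) * t)" if "T \<le> t" for t
  proof -
    have "M * exp (- c * t) * norm (y t) \<le> M * exp (- c * t) * (A * exp (\<sigma> * t))"
      using y[OF that] M by (intro mult_left_mono) auto
    also have "\<dots> = M * A * (exp (- c * t) * exp (\<sigma> * t))" by simp
    also have "exp (- c * t) * exp (\<sigma> * t) = exp ((\<sigma> - c) * t)"
      by (simp add: exp_add[symmetric] algebra_simps)
    finally show ?thesis .
  qed
  have MA: "0 \<le> M * A" using M A by simp
  \<comment> \<open>The remainder has rate \<open>\<sigma> - c\<close>, which lies strictly below
    \<open>\<kappa> = \<sigma> - s\<close> because \<open>s < c\<close>.\<close>
  have "\<exists>b M'. 0 \<le> M' \<and> (\<forall>t\<ge>T. cmod (y t $ j - b * exp (lam j * of_real t)) \<le> M' * exp (\<kappa> * t)) \<and> (Re (lam j) \<le> \<kappa> \<longrightarrow> b = 0)" for j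
    by (rule scalar_asymptotics[where y = "\<lambda>t. y t $ j" and r = "r j" and l = "lam j" and T = T and M = "M * A" and \<rho> = "\<sigma> - c" and \<kappa> = \<kappa>])
      (use ode order_trans[OF r small] MA T s in \<open>auto simp: \<kappa>_def\<close>)
  then obtain b M' where b: "\<And>j. 0 \<le> M' j" "\<And>j t. T \<le> t \<Longrightarrow> cmod (y t $ j - b j * exp (lam j * of_real t)) \<le> M' j * exp (\<kappa> * t)"
    "\<And>j. Re (lam j) \<le> \<kappa> \<Longrightarrow> b j = 0"
    by metis
  have "b j = 0" for j
  proof (cases "Re (lam j) \<le> \<kappa>")
    case False
    define S where "S = {j. \<kappa> < Re (lam j)}"
    have jS: "j \<in> S" using False by (simp add: S_def)
    have "\<beta> < Re (lam j)" using False s by (simp add: \<kappa>_def)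
    then obtain i where i: "g i j \<noteq> 0" using obs by blast
    have "g i j * b j = 0"
    proof (rule exp_sum_coeffs_zero[where S = S and l = lam and d = "\<lambda>j. g i j * b j" and \<kappa> = \<kappa> and T = T
          and M = "M * A + (\<Sum>j\<in>UNIV. cmod (g i j) * M' j)"])
      show "inj_on lam S" using inj by (rule inj_on_subset) simp
      fix t assume t: "T \<le> t"
      have "(\<Sum>j\<in>S. g i j * b j * exp (lam j * of_real t)) = (\<Sum>j\<in>UNIV. g i j * b j * exp (lam j * of_real t))"
        by (rule sum.mono_neutral_left) (use b(3) in \<open>auto simp: S_def\<close>)
      also have "\<dots> = (\<Sum>j\<in>UNIV. g i j * y t $ j) - (\<Sum>j\<in>UNIV. g i j * (y t $ j - b j * exp (lam j * of_real t)))"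
        by (simp add: sum_subtractf[symmetric] algebra_simps)
      also have "cmod \<dots> \<le> cmod (\<Sum>j\<in>UNIV. g i j * y t $ j) + cmod (\<Sum>j\<in>UNIV. g i j * (y t $ j - b j * exp (lam j * of_real t)))"
        by (rule norm_triangle_ineq4)
      also have "\<dots> \<le> M * A * exp (\<kappa> * t) + (\<Sum>j\<in>UNIV. cmod (g i j) * (M' j * exp (\<kappa> * t)))"
      proof (rule add_mono)
        have "cmod (\<Sum>j\<in>UNIV. g i j * y t $ j) \<le> M * A * exp ((\<sigma> - c) * t)"
          by (rule order_trans[OF g[OF t] small[OF t]])
        also have "\<dots> \<le> M * A * exp (\<kappa> * t)"
          by (rule exp_bounded_mono[OF T t _ MA]) (use s in \<open>simp add: \<kappa>_def\<close>)
        finally show "cmod (\<Sum>j\<in>UNIV. g i j * y t $ j) \<le> M * A * exp (\<kappa> * t)" .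
        show "cmod (\<Sum>j\<in>UNIV. g i j * (y t $ j - b j * exp (lam j * of_real t))) \<le> (\<Sum>j\<in>UNIV. cmod (g i j) * (M' j * exp (\<kappa> * t)))"
          by (rule order_trans[OF norm_sum sum_mono]) (auto simp: norm_mult intro!: mult_left_mono b(2)[OF t])
      qed
      finally show "cmod (\<Sum>j\<in>S. g i j * b j * exp (lam j * of_real t)) \<le> (M * A + (\<Sum>j\<in>UNIV. cmod (g i j) * M' j)) * exp (\<kappa> * t)"
        by (simp add: distrib_right sum_distrib_right mult.assoc)
    qed (use jS in \<open>auto simp: S_def\<close>)
    then show ?thesis using i by simp
  qed (rule b(3))
  then have yj: "cmod (y t $ j) \<le> M' j * exp (\<kappa> * t)" if "T \<le> t" for j t
    using b(2)[OF that, of j] by simp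
  have "norm (y t) \<le> (\<Sum>j\<in>UNIV. M' j) * exp (\<kappa> * t)" if t: "T \<le> t" for t
  proof -
    have "norm (y t) \<le> (\<Sum>j\<in>UNIV. cmod (y t $ j))" unfolding norm_vec_def by (rule L2_set_le_sum) auto
    also have "\<dots> \<le> (\<Sum>j\<in>UNIV. M' j * exp (\<kappa> * t))" by (intro sum_mono yj t)
    finally show ?thesis by (simp add: sum_distrib_right)
  qed
  then show ?thesis using that[of "\<Sum>j\<in>UNIV. M' j"] b(1) unfolding \<kappa>_def by (simp add: sum_nonneg)
qed

text \<open>Starting from mere boundedness, the rate is lowered by the same amount \<open>s\<close>
  in each step.\<close>

lemma observed_decay:
  fixes y :: "real \<Rightarrow> complex^'n" and g :: "'m \<Rightarrow> 'n \<Rightarrow> complex"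
  assumes ode: "\<And>j t. T \<le> t \<Longrightarrow> ((\<lambda>t. y t $ j) has_vector_derivative (lam j * y t $ j + r j t)) (at t)"
    and r: "\<And>j t. T \<le> t \<Longrightarrow> cmod (r j t) \<le> M * exp (- c * t) * norm (y t)"
    and g: "\<And>i t. T \<le> t \<Longrightarrow> cmod (\<Sum>j\<in>UNIV. g i j * y t $ j) \<le> M * exp (- c * t) * norm (y t)"
    and obs: "\<And>j. \<beta> < Re (lam j) \<Longrightarrow> \<exists>i. g i j \<noteq> 0"
    and inj: "inj lam" and T: "0 \<le> T" and M: "0 \<le> M" and c: "0 < c" and \<beta>: "\<beta> < 0"
    and y: "\<And>t. T \<le> t \<Longrightarrow> norm (y t) \<le> A" and A: "0 \<le> A"
  obtains A' where "\<And>t. T \<le> t \<Longrightarrow> norm (y t) \<le> A' * exp (\<beta> * t)"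
proof -
  obtain N :: nat where N: "- \<beta> / c < N" using reals_Archimedean2 by blast
  have N0: "0 < real N" using N \<beta> c by (smt (verit) divide_pos_pos)
  \<comment> \<open>The choice of \<open>N\<close> makes \<open>s < c\<close>, and \<open>N\<close>
    equal steps end exactly at \<open>\<beta>\<close>, so no step asks for a rate below
    \<open>\<beta>\<close>.\<close>
  define s where "s = - \<beta> / N"
  have s: "0 < s" "s < c" "real N * s = - \<beta>" using N N0 \<beta> c by (auto simp: s_def field_simps)
  have "\<exists>A'\<ge>0. \<forall>t\<ge>T. norm (y t) \<le> A' * exp (- (real k * s) * t)" if "k \<le> N" for k
    using that
  proof (induction k)
    case 0
    then show ?case using y A by (intro exI[of _ A]) auto
  next
    case (Suc k)
    then obtain B where B: "0 \<le> B" "\<And>t. T \<le> t \<Longrightarrow> norm (y t) \<le> B * exp (- (real k * s) * t)" by auto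
    have "real (Suc k) * s \<le> real N * s" using Suc.prems s(1) by (intro mult_right_mono) auto
    then have "\<beta> \<le> - (real k * s) - s" using s(3) by (simp add: algebra_simps)
    from observed_decay_step[OF ode r g obs inj T M B(2,1) s(2) this]
    obtain A' where "0 \<le> A'" "\<And>t. T \<le> t \<Longrightarrow> norm (y t) \<le> A' * exp ((- (real k * s) - s) * t)" by blast
    moreover have "- (real k * s) - s = - (real (Suc k) * s)" by (simp add: algebra_simps)
    ultimately show ?case by auto
  qed
  from this[of N] obtain A' where "\<forall>t\<ge>T. norm (y t) \<le> A' * exp (\<beta> * t)" using s(3) by auto
  then show ?thesis using that by blast
qed

section \<open>Detectability\<close>

text \<open>The points of the open interval from 0 to \<open>t + 1\<close> where \<open>H\<close> is
  nonzero form an open set, which cannot be both nonempty and negligible.\<close>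

lemma AE_zero_continuous:
  fixes H :: "real \<Rightarrow> complex"
  assumes cont: "continuous_on {0..} H" and ae: "\<And>\<tau>. 0 < \<tau> \<Longrightarrow> AE t in lborel. t \<in> {0..\<tau>} \<longrightarrow> H t = 0" and t: "0 < t"
  shows "H t = 0"
proof (rule ccontr)
  assume "H t \<noteq> 0"
  define S where "S = {x \<in> {0<..<t + 1}. H x \<noteq> 0}"
  have "continuous_on {0<..<t + 1} H" by (rule continuous_on_subset[OF cont]) auto
  then have "open (H -` (- {0}) \<inter> {0<..<t + 1})"
    using continuous_on_open_vimage[of "{0<..<t + 1}" H] open_Compl[of "{0}"] by auto
  moreover have "H -` (- {0}) \<inter> {0<..<t + 1} = S" by (auto simp: S_def)
  ultimately have "open S" by simp
  moreover have "t \<in> S" using \<open>H t \<noteq> 0\<close> t by (simp add: S_def)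
  ultimately have "\<not> negligible S" using open_not_negligible by blast
  moreover have "negligible S"
  proof -
    obtain N where N: "{x \<in> space lborel. \<not> (x \<in> {0..t + 1} \<longrightarrow> H x = 0)} \<subseteq> N" "emeasure lborel N = 0" "N \<in> sets lborel"
      using AE_E[OF ae[of "t + 1"]] t by auto
    have "N \<in> null_sets lebesgue" using N(2,3) by (intro null_sets_completionI) auto
    then have "negligible N" by (simp add: negligible_iff_null_sets)
    moreover have "S \<subseteq> N" using N(1) by (auto simp: S_def)
    ultimately show ?thesis by (rule negligible_subset)
  qed
  ultimately show False by blast
qed

lemma observation_rkernel_diff:
  fixes h :: "complex^'n \<Rightarrow> complex^'m"
  assumes flow: "holomorphic_flow F \<phi>" and h: "\<And>i. output_component h i \<in> \<H>\<^sup>2"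
    and t: "0 \<le> t" and z: "z \<in> \<D>" "z' \<in> \<D>"
  shows "observation \<phi> h (\<lambda>x. rkernel z x - rkernel z' x) t $ i =
    cnj (output_component h i (\<phi> t z) - output_component h i (\<phi> t z'))"
  unfolding observation_def output_op_def koopman_adj_rkernel_diff[OF flow t z]
  using reproducing_diff[OF hardyD(1)[OF h] flowD(4)[OF flow t z(1)] flowD(4)[OF flow t z(2)]]
  by (simp add: hinner_cnj[of "\<lambda>x. rkernel (\<phi> t z) x - rkernel (\<phi> t z') x"])

lemma unit_index_eigval: "eigval lam (unit_index j) = lam j"
proof -
  have "eigval lam (unit_index j) = (\<Sum>k\<in>UNIV. if k = j then lam k else 0)"
    unfolding eigval_def by (intro sum.cong) (auto simp: unit_index_def)
  then show ?thesis by simp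
qed

text \<open>The hypothesis of the theorem is phrased by membership in a span;
  \<open>\<beta> < Re (lam j)\<close> makes \<open>\<psi> (unit_index j)\<close> one of its
  generators.\<close>

lemma unstable_space_principal:
  assumes "\<beta> < Re (lam j)"
  shows "\<psi> (unit_index j) \<in> unstable_space \<beta> lam \<psi>"
proof -
  have "unit_index j \<in> unstable_indices \<beta> lam"
    using assms unfolding unstable_indices_def mem_Collect_eq unit_index_eigval
    by (auto simp: unit_index_def fun_eq_iff)
  then show ?thesis
    unfolding unstable_space_def complex_span_def mem_Collect_eq
    by (intro exI[of _ "{\<psi> (unit_index j)}"] exI[of _ "\<lambda>_. 1"]) auto
qed

lemma complex_linear_coords:
  fixes L :: "complex^'n \<Rightarrow> complex"
  assumes "\<And>x y. L (x + y) = L x + L y" "\<And>c x. L (c *s x) = c * L x"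
  shows "L y = (\<Sum>j\<in>UNIV. L (axis j 1) * y $ j)"
proof -
  have L0: "L 0 = 0" using assms(2)[of 0 0] by simp
  have "L (\<Sum>j\<in>S. y $ j *s axis j 1) = (\<Sum>j\<in>S. L (axis j 1) * y $ j)" if "finite S" for S
    using that by (induction S rule: finite_induct) (simp_all add: L0 assms mult.commute)
  moreover have "(\<Sum>j\<in>UNIV. y $ j *s axis j 1) = y"
    by (simp add: vec_eq_iff axis_def if_distrib[of "\<lambda>x. _ * x"] cong: if_cong)
  ultimately show ?thesis by (metis finite_class.finite_UNIV)
qed

text \<open>Simple eigenvalues have one-dimensional eigenspaces: \<open>v\<close> is a multiple of
  the \<open>j\<close>-th column of \<open>V\<close>. Hence an output that sees \<open>v\<close>
  also sees that column.\<close>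

lemma eigenvector_in_eigencoordinates:
  fixes J :: "complex^'n^'n"
  assumes VW: "V ** W = mat 1" and W: "\<And>j x. (W *v (J *v x)) $ j = lam j * (W *v x) $ j"
    and inj: "inj lam" and v: "J *v v = lam j *s v"
  shows "v = (W *v v) $ j *s (V *v axis j 1)"
proof -
  have "(W *v v) $ k = 0" if "k \<noteq> j" for k
  proof -
    have "(W *v (J *v v)) $ k = lam j * (W *v v) $ k" by (simp add: v vector_scalar_commute)
    then have "lam k * (W *v v) $ k = lam j * (W *v v) $ k" unfolding W .
    moreover have "lam k \<noteq> lam j" using inj that by (auto dest: injD)
    ultimately show ?thesis by simp
  qed
  then have "W *v v = (W *v v) $ j *s axis j 1" by (auto simp: vec_eq_iff axis_def)
  then have "V *v (W *v v) = (W *v v) $ j *s (V *v axis j 1)" by (metis vector_scalar_commute)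
  then show ?thesis by (simp add: matrix_vector_mul_assoc VW)
qed

text \<open>In the coordinates \<open>y\<close> the linear part is diagonal, and
  \<open>g i j\<close> is the derivative of the \<open>i\<close>-th output at 0 along the
  \<open>j\<close>-th column of \<open>V\<close>. Equal outputs say that the
  \<open>g\<close>-combination of \<open>y\<close> equals a remainder.\<close>

lemma undistinguished_decay:
  fixes F :: "complex^'n \<Rightarrow> complex^'n" and hc :: "'m::finite \<Rightarrow> complex^'n \<Rightarrow> complex"
  assumes flow: "holomorphic_flow F \<phi>" and fw: "forward_invariant \<phi>" and hyp: "stable_hyperbolic F \<phi> lam"
    and nr: "nonresonant lam" and h: "\<And>i. holo_on (hc i) \<D>"
    and eig: "\<And>j. dual_eigenfunction F (cnj (lam j)) (\<psi> j)" and \<beta>: "\<beta> < 0"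
    and obs: "\<And>j. \<beta> < Re (lam j) \<Longrightarrow> \<exists>i. hinner (hc i) (\<psi> j) \<noteq> 0"
    and z: "z \<in> \<D>" "z' \<in> \<D>" and eq: "\<And>i t. 0 < t \<Longrightarrow> hc i (\<phi> t z) = hc i (\<phi> t z')"
  obtains A T where "\<And>t. T \<le> t \<Longrightarrow> norm (\<phi> t z - \<phi> t z') \<le> A * exp (\<beta> * t)"
proof -
  note hD = stable_hyperbolicD[OF hyp]
  have inj: "inj lam" using hD(4) by (simp add: simple_eigenvalues_def)
  obtain W V where WV: "W ** V = mat 1" "V ** W = mat 1"
    "\<And>j x. (W *v (jacobian F 0 *v x)) $ j = lam j * (W *v x) $ j"
    using eigencoordinates[OF hD(4)] by blast
  obtain BW where BW: "0 < BW" "\<And>x. norm (W *v x) \<le> BW * norm x" using matrix_norm_bound[of W] by blast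
  obtain BV where BV: "0 < BV" "\<And>x. norm (V *v x) \<le> BV * norm x" using matrix_norm_bound[of V] by blast
  have VWx: "V *v (W *v x) = x" for x by (simp add: matrix_vector_mul_assoc WV(2))
  have xW: "norm x \<le> BV * norm (W *v x)" for x using BV(2)[of "W *v x"] by (simp add: VWx)
  obtain c C where c: "0 < c" "0 < C" "\<And>z t. z \<in> \<D> \<Longrightarrow> 0 \<le> t \<Longrightarrow> norm (\<phi> t z) \<le> C * exp (- c * t)"
    using flow_decay[OF flow fw hyp] by blast
  obtain K \<delta> where K: "0 < \<delta>" "0 \<le> K"
    "\<And>x y. norm x \<le> \<delta> \<Longrightarrow> norm y \<le> \<delta> \<Longrightarrow>
      norm (F x - F y - jacobian F 0 *v (x - y)) \<le> K * (norm x + norm y) * norm (x - y)"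
    using vector_field_difference_at_0[OF flowD(1)[OF flow]] by metis
  \<comment> \<open>The outputs are bundled into one map, so that a single radius and a single
    constant serve all components.\<close>
  define G where "G = (\<lambda>x. \<chi> i. hc i x)"
  have Gh: "holo_on (\<lambda>z. G z $ i) \<D>" for i using h by (simp add: G_def)
  obtain K' \<delta>' where K': "0 < \<delta>'" "0 \<le> K'"
    "\<And>x y. norm x \<le> \<delta>' \<Longrightarrow> norm y \<le> \<delta>' \<Longrightarrow>
      norm (G x - G y - (\<chi> i. frechet_derivative (\<lambda>z. G z $ i) (at 0) (x - y))) \<le> K' * (norm x + norm y) * norm (x - y)"
    using holo_vector_difference_at_0[OF Gh] by metis
  define e where "e = min \<delta> \<delta>'"
  have e: "0 < e" using K(1) K'(1) by (simp add: e_def)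
  \<comment> \<open>By \<open>exp x \<ge> 1 + x\<close> this time already forces
    \<open>C * exp (- c * t) \<le> e\<close>, so from \<open>T\<close> on both orbits lie where the
    remainder bounds hold.\<close>
  define T where "T = C / (e * c) + 1"
  have T: "0 < T" using c e by (simp add: T_def add_pos_pos)
  have small: "norm (\<phi> t x) \<le> e" if "T \<le> t" "x \<in> \<D>" for t x
  proof -
    have "C \<le> e * (c * T)" using c e by (simp add: T_def field_simps)
    also have "\<dots> \<le> e * (c * t)" using c e that by (intro mult_left_mono) auto
    also have "\<dots> \<le> e * exp (c * t)" using exp_ge_add_one_self[of "c * t"] e by (intro mult_left_mono) linarith+
    finally have "C * exp (- c * t) \<le> e" by (simp add: exp_minus field_simps)
    then show ?thesis using c(3)[OF that(2), of t] that(1) T by simp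
  qed
  define w where "w = (\<lambda>t. \<phi> t z - \<phi> t z')"
  define y where "y = (\<lambda>t. W *v w t)"
  define g where "g = (\<lambda>i j. frechet_derivative (hc i) (at 0) (V *v axis j 1))"
  define r where "r = (\<lambda>j t. (W *v (F (\<phi> t z) - F (\<phi> t z') - jacobian F 0 *v w t)) $ j)"
  \<comment> \<open>One constant for the remainders of both \<open>F\<close> and the outputs:
    \<open>2 * C\<close> from the two orbits, \<open>BV\<close> from returning from \<open>w\<close>
    to \<open>y\<close>.\<close>
  define M where "M = (BW * K + K') * (2 * C * BV)"
  have prod: "k * (norm (\<phi> t z) + norm (\<phi> t z')) * norm (w t) \<le> k * (2 * C * BV) * exp (- c * t) * norm (y t)"
    if t: "T \<le> t" and k: "0 \<le> k" for k t
  proof -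
    have "norm (\<phi> t z) + norm (\<phi> t z') \<le> 2 * C * exp (- c * t)"
      using c(3)[OF z(1), of t] c(3)[OF z(2), of t] T t by simp
    then have "k * (norm (\<phi> t z) + norm (\<phi> t z')) * norm (w t) \<le> k * (2 * C * exp (- c * t)) * (BV * norm (y t))"
      using xW[of "w t"] k c by (intro mult_mono mult_left_mono) (auto simp: y_def)
    then show ?thesis by (simp add: mult_ac)
  qed
  have KM: "BW * (K * (norm (\<phi> t z) + norm (\<phi> t z')) * norm (w t)) \<le> M * exp (- c * t) * norm (y t)"
    "K' * (norm (\<phi> t z) + norm (\<phi> t z')) * norm (w t) \<le> M * exp (- c * t) * norm (y t)" if t: "T \<le> t" for t
  proof -
    have n: "0 \<le> BW * K * (2 * C * BV) * exp (- c * t) * norm (y t)" "0 \<le> K' * (2 * C * BV) * exp (- c * t) * norm (y t)"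
      using BW K K' c BV by simp_all
    have M: "M * exp (- c * t) * norm (y t) = BW * K * (2 * C * BV) * exp (- c * t) * norm (y t) + K' * (2 * C * BV) * exp (- c * t) * norm (y t)"
      by (simp add: M_def algebra_simps)
    show "BW * (K * (norm (\<phi> t z) + norm (\<phi> t z')) * norm (w t)) \<le> M * exp (- c * t) * norm (y t)"
    proof -
      have "BW * K * (norm (\<phi> t z) + norm (\<phi> t z')) * norm (w t) \<le> BW * K * (2 * C * BV) * exp (- c * t) * norm (y t)"
        by (rule prod[OF t]) (use BW(1) K(2) in simp)
      moreover have "BW * (K * (norm (\<phi> t z) + norm (\<phi> t z')) * norm (w t)) = BW * K * (norm (\<phi> t z) + norm (\<phi> t z')) * norm (w t)"
        by (simp only: mult.assoc)
      ultimately show ?thesis using n unfolding M by linarith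
    qed
    show "K' * (norm (\<phi> t z) + norm (\<phi> t z')) * norm (w t) \<le> M * exp (- c * t) * norm (y t)"
      using prod[OF t K'(2)] n unfolding M by linarith
  qed
  obtain A where A: "\<And>t. T \<le> t \<Longrightarrow> norm (y t) \<le> A * exp (\<beta> * t)"
  proof (rule observed_decay[where y = y and T = T and lam = lam and r = r and M = M and c = c and g = g and \<beta> = \<beta> and A = "BW * (2 * C)"])
    fix j t assume t: "T \<le> t"
    have "((\<lambda>t. \<phi> t z - \<phi> t z') has_vector_derivative (F (\<phi> t z) - F (\<phi> t z'))) (at t)"
      by (intro has_vector_derivative_diff flow_deriv_at[OF flow] z) (use t T in auto)
    then have "((\<lambda>t. y t $ j) has_vector_derivative (W *v (F (\<phi> t z) - F (\<phi> t z'))) $ j) (at t)"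
      unfolding y_def w_def
      by (intro bounded_linear.has_vector_derivative[OF bounded_linear_vec_nth]
          bounded_linear.has_vector_derivative[OF bounded_linear_matrix])
    moreover have "(W *v (F (\<phi> t z) - F (\<phi> t z'))) $ j = lam j * y t $ j + r j t"
      unfolding r_def y_def WV(3)[symmetric] by (simp add: matrix_vector_mult_diff_distrib)
    ultimately show "((\<lambda>t. y t $ j) has_vector_derivative (lam j * y t $ j + r j t)) (at t)" by simp
  next
    fix j t assume t: "T \<le> t"
    have "cmod (r j t) \<le> norm (W *v (F (\<phi> t z) - F (\<phi> t z') - jacobian F 0 *v w t))"
      unfolding r_def by (rule norm_nth_le_vec)
    also have "\<dots> \<le> BW * norm (F (\<phi> t z) - F (\<phi> t z') - jacobian F 0 *v w t)" by (rule BW(2))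
    also have "\<dots> \<le> BW * (K * (norm (\<phi> t z) + norm (\<phi> t z')) * norm (w t))"
      unfolding w_def using small[OF t] z BW(1) by (intro mult_left_mono K(3)) (auto simp: e_def)
    finally show "cmod (r j t) \<le> M * exp (- c * t) * norm (y t)" using KM(1)[OF t] by simp
  next
    fix i t assume t: "T \<le> t"
    have hi: "hc i (\<phi> t z) = hc i (\<phi> t z')" using eq[of t i] t T by simp
    have lin: "linear (frechet_derivative (hc i) (at 0))"
      by (rule has_derivative_linear[OF holo_onD(1)[OF h zero_in_disc]])
    have "frechet_derivative (hc i) (at 0) (V *v y t) = (\<Sum>j\<in>UNIV. g i j * y t $ j)"
      unfolding g_def
      by (rule complex_linear_coords)
        (simp_all add: matrix_vector_right_distrib linear_add[OF lin] vector_scalar_commute holo_onD(2)[OF h zero_in_disc])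
    then have "(\<Sum>j\<in>UNIV. g i j * y t $ j) = frechet_derivative (hc i) (at 0) (w t)"
      by (simp add: y_def VWx)
    \<comment> \<open>Since the outputs agree on the two orbits, the remainder reduces to minus the
      linear term.\<close>
    also have "cmod \<dots> = cmod ((G (\<phi> t z) - G (\<phi> t z') - (\<chi> i. frechet_derivative (\<lambda>z. G z $ i) (at 0) (\<phi> t z - \<phi> t z'))) $ i)"
      using hi by (simp add: G_def w_def)
    also have "\<dots> \<le> norm (G (\<phi> t z) - G (\<phi> t z') - (\<chi> i. frechet_derivative (\<lambda>z. G z $ i) (at 0) (\<phi> t z - \<phi> t z')))"
      by (rule norm_nth_le_vec)
    also have "\<dots> \<le> K' * (norm (\<phi> t z) + norm (\<phi> t z')) * norm (w t)"
      unfolding w_def using small[OF t] z by (intro K'(3)) (auto simp: e_def)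
    finally show "cmod (\<Sum>j\<in>UNIV. g i j * y t $ j) \<le> M * exp (- c * t) * norm (y t)" using KM(2)[OF t] by simp
  next
    fix j assume "\<beta> < Re (lam j)"
    then obtain i where i: "hinner (hc i) (\<psi> j) \<noteq> 0" using obs by blast
    obtain v where v: "jacobian F 0 *v v = lam j *s v"
      "\<And>h. holo_on h \<D> \<Longrightarrow> hinner h (\<psi> j) = frechet_derivative h (at 0) v"
      using principal_eigenfunction[OF flow fw hyp nr eig[of j]] by blast
    have "frechet_derivative (hc i) (at 0) v = (W *v v) $ j * g i j"
      unfolding g_def holo_onD(2)[OF h zero_in_disc, symmetric]
      using eigenvector_in_eigencoordinates[OF WV(2,3) inj v(1)] by simp
    then have "g i j \<noteq> 0" using i v(2)[OF h, of i] by auto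
    then show "\<exists>i. g i j \<noteq> 0" by blast
  next
    fix t assume t: "T \<le> t"
    have "norm (\<phi> t x) \<le> C" if "x \<in> \<D>" for x
    proof -
      have "norm (\<phi> t x) \<le> C * exp (- c * t)" using c(3)[OF that] t T by simp
      also have "\<dots> \<le> C * 1" using c t T by (intro mult_left_mono) auto
      finally show ?thesis by simp
    qed
    then have "norm (w t) \<le> 2 * C"
      using norm_triangle_ineq4[of "\<phi> t z" "\<phi> t z'"] z unfolding w_def by (smt (verit))
    then have "BW * norm (w t) \<le> BW * (2 * C)" using BW(1) by (intro mult_left_mono) auto
    then show "norm (y t) \<le> BW * (2 * C)" using BW(2)[of "w t"] by (simp add: y_def)
  qed (use inj T c \<beta> BW BV K K' that in \<open>auto simp: M_def\<close>)
  have "norm (\<phi> t z - \<phi> t z') \<le> BV * A * exp (\<beta> * t)" if "T \<le> t" for t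
  proof -
    have "norm (w t) \<le> BV * norm (y t)" using xW[of "w t"] by (simp add: y_def)
    also have "\<dots> \<le> BV * (A * exp (\<beta> * t))" using A[OF that] BV(1) by (intro mult_left_mono) auto
    finally show ?thesis by (simp add: w_def mult.assoc)
  qed
  then show ?thesis using that by blast
qed

theorem lemma20:
  fixes F :: "complex^'n \<Rightarrow> complex^'n"
    and \<phi> :: "real \<Rightarrow> complex^'n \<Rightarrow> complex^'n"
    and h :: "complex^'n \<Rightarrow> complex^'m"
    and lam :: "'n \<Rightarrow> complex"
    and \<psi> :: "('n \<Rightarrow> nat) \<Rightarrow> complex^'n \<Rightarrow> complex"
    and \<beta> :: real
  assumes "holomorphic_flow F \<phi>"
    and "forward_invariant \<phi>"
    and "stable_hyperbolic F \<phi> lam"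
    and "nonresonant lam"
    and "\<forall>i. output_component h i \<in> \<H>\<^sup>2"
    and "\<forall>\<alpha>. dual_eigenfunction F (cnj (eigval lam \<alpha>)) (\<psi> \<alpha>)"
    and "\<beta> < 0"
    and "\<forall>j. \<psi> (unit_index j) \<in> unstable_space \<beta> lam \<psi> \<longrightarrow>
           (\<exists>i. hinner (output_component h i) (\<psi> (unit_index j)) \<noteq> 0)"
  shows "pointwise_detectable \<beta> \<phi> h"
  unfolding pointwise_detectable_def
proof (intro allI impI ballI)
  fix \<gamma> z z' k
  assume \<gamma>: "\<gamma> < - \<beta>" and z: "z \<in> (\<D> :: (complex^'n) set)" and z': "z' \<in> (\<D> :: (complex^'n) set)"
    and ker: "(\<lambda>x. rkernel z x - rkernel z' x) \<in> (\<Inter>\<tau>\<in>{0<..}. observation_kernel \<phi> h \<tau>)"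
  note flow = assms(1)
  have hH: "output_component h i \<in> \<H>\<^sup>2" for i using assms(5) by blast
  have eq: "output_component h i (\<phi> t z) = output_component h i (\<phi> t z')" if t: "0 < t" for i t
  proof -
    \<comment> \<open>The observation vanishes only almost everywhere on each
      \<open>{0..\<tau>}\<close>; continuity of the output along orbits upgrades this to every
      positive time.\<close>
    define H where "H = (\<lambda>t. output_component h i (\<phi> t z) - output_component h i (\<phi> t z'))"
    have "continuous_on {0..} (\<lambda>t. output_component h i (\<phi> t x))" if "x \<in> \<D>" for x
      by (rule continuous_on_compose2[OF holo_on_continuous_on[OF hardyD(1)[OF hH]] flow_continuous_time[OF flow that]])
        (use flowD(4)[OF flow _ that] in auto)
    then have cont: "continuous_on {0..} H" unfolding H_def using z z' by (intro continuous_on_diff) auto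
    have "AE t in lborel. t \<in> {0..\<tau>} \<longrightarrow> H t = 0" if \<tau>: "0 < \<tau>" for \<tau>
    proof -
      have "AE t in lborel. t \<in> {0..\<tau>} \<longrightarrow> observation \<phi> h (\<lambda>x. rkernel z x - rkernel z' x) t = 0"
        using ker \<tau> unfolding observation_kernel_def by blast
      then show ?thesis
      proof (rule AE_mp, intro AE_I2 impI)
        fix t assume obs: "t \<in> {0..\<tau>} \<longrightarrow> observation \<phi> h (\<lambda>x. rkernel z x - rkernel z' x) t = 0" and "t \<in> {0..\<tau>}"
        then have "observation \<phi> h (\<lambda>x. rkernel z x - rkernel z' x) t $ i = 0" "0 \<le> t" by simp_all
        then have "cnj (H t) = 0"
          using observation_rkernel_diff[OF flow hH _ z z', of t i] unfolding H_def by simp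
        then show "H t = 0" by simp
      qed
    qed
    then have "H t = 0" by (rule AE_zero_continuous[OF cont _ t])
    then show ?thesis by (simp add: H_def)
  qed
  obtain A T where AT: "\<And>t. T \<le> t \<Longrightarrow> norm (\<phi> t z - \<phi> t z') \<le> A * exp (\<beta> * t)"
  proof (rule undistinguished_decay[OF flow assms(2,3,4) hardyD(1)[OF hH] _ assms(7) _ z z' eq])
    show "dual_eigenfunction F (cnj (lam j)) (\<psi> (unit_index j))" for j
      using assms(6) unit_index_eigval[of lam j] by metis
    show "\<exists>i. hinner (output_component h i) (\<psi> (unit_index j)) \<noteq> 0" if "\<beta> < Re (lam j)" for j
      using assms(8) unstable_space_principal[where \<beta> = \<beta> and lam = lam and j = j and \<psi> = \<psi>, OF that] by blast
  qed blast+
  let ?f = "\<lambda>t. exp (\<gamma> * t) * cmod (hinner (coord_fun k) (koopman_adj \<phi> t (\<lambda>x. rkernel z x - rkernel z' x)))"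
  have le: "norm (?f t) \<le> A * exp ((\<gamma> + \<beta>) * t)" if t: "max 0 T \<le> t" for t
  proof -
    have t0: "0 \<le> t" using t by simp
    \<comment> \<open>The reproducing property applied to the coordinate function turns the dual
      statement into one about the \<open>k\<close>-th coordinate of the two orbits.\<close>
    have "hinner (coord_fun k) (koopman_adj \<phi> t (\<lambda>x. rkernel z x - rkernel z' x)) = (\<phi> t z - \<phi> t z') $ k"
      unfolding koopman_adj_rkernel_diff[OF flow t0 z z'] coord_fun_def
      using reproducing_diff[OF holo_on_disc[OF holo_coord[of k]] flowD(4)[OF flow t0 z] flowD(4)[OF flow t0 z']]
      by (simp add: on_disc_eq flowD(4)[OF flow t0] z z')
    then have "norm (?f t) \<le> exp (\<gamma> * t) * norm (\<phi> t z - \<phi> t z')"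
      using norm_nth_le_vec[of "\<phi> t z - \<phi> t z'" k] by (simp add: mult_left_mono)
    also have "\<dots> \<le> exp (\<gamma> * t) * (A * exp (\<beta> * t))" using AT[of t] t by (intro mult_left_mono) auto
    also have "\<dots> = A * exp ((\<gamma> + \<beta>) * t)" by (simp add: distrib_right exp_add)
    finally show ?thesis .
  qed
  \<comment> \<open>The strict inequality \<open>\<gamma> < - \<beta>\<close> makes the exponent
    negative.\<close>
  have "((\<lambda>t. A * exp ((\<gamma> + \<beta>) * t)) \<longlongrightarrow> A * 0) at_top"
    by (intro tendsto_intros exp_decay_tendsto_0) (use \<gamma> in simp)
  then have lim: "((\<lambda>t. A * exp ((\<gamma> + \<beta>) * t)) \<longlongrightarrow> 0) at_top" by simp
  show "(?f \<longlongrightarrow> 0) at_top"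
    by (rule Lim_null_comparison[OF eventually_mono[OF eventually_ge_at_top[of "max 0 T"] le] lim])
qed

end
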